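(* Let $K$ be a field and let $p,t,n,d$ be integers such that $n=(t+1)p+d$, where $p\ge 0$, $0\le d\le t$, and $2\le t\le n$. Let $C_n$ be the cycle on $n$ vertices $x_1,\dots,x_n$, let $R=K[x_1,\dots,x_n]$, and let $I_t(C_n)\subset R$ be its path ideal. Then the $\mathbb{N}$-graded Betti numbers of degree $n$ of $R/I_t(C_n)$ are $$\beta_{i,n}(R/I_t(C_n))=\begin{cases} t & \text{if } d=0 \text{ and } i=2\left(\frac{n}{t+1}\right)=2p,\\ 1 & \text{if } d\neq 0 \text{ and } i=2\left(\frac{n-d}{t+1}\right)+1=2p+1,\\ 0 & \text{otherwise.}\end{cases}$$
   Context: The path ideal $I_t(C_n)$ is the ideal of $R=K[x_1,\dots,x_n]$ generated by the monomials $x_{i}x_{i+1}\cdots x_{i+t-1}$, $1\le i\le n$, with indices taken modulo $n$ in $\{1,\dots,n\}$ (one monomial for each path on $t$ vertices in the cycle $C_n$ with edges $\{x_1,x_2\},\dots,\{x_{n-1},x_n\},\{x_n,x_1\}$). $R$ is standard graded, and $\beta_{i,j}(R/I)$ denotes the number of copies of $R(-j)$ in homological degree $i$ of the minimal graded free resolution of $R/I$ (with $R$ itself in homological degree $0$). *)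

theory Defs
  imports "Jordan_Normal_Form.Matrix" "HOL-Library.Poly_Mapping"
begin

text \<open>
  Exponent vectors are finitely supported functions on the variable indices; the polynomial
  ring \<open>K[x\<^sub>1,\<dots>,x\<^sub>n]\<close> is the subring \<open>poly_ring n\<close> of the convolution ring over all
  natural-number indices.
\<close>

type_synonym 'k mpoly = "(nat \<Rightarrow>\<^sub>0 nat) \<Rightarrow>\<^sub>0 'k"

definition poly_ring :: "nat \<Rightarrow> 'k::field mpoly set" where
  "poly_ring n = {f. \<forall>m \<in> Poly_Mapping.keys f. Poly_Mapping.keys m \<subseteq> {1..n}}"

definition var :: "nat \<Rightarrow> 'k::field mpoly" where
  "var i = Poly_Mapping.single (Poly_Mapping.single i 1) 1"

definition mon_degree :: "(nat \<Rightarrow>\<^sub>0 nat) \<Rightarrow> nat" where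
  "mon_degree m = (\<Sum>i \<in> Poly_Mapping.keys m. Poly_Mapping.lookup m i)"

definition ideal_gen :: "nat \<Rightarrow> 'k::field mpoly set \<Rightarrow> 'k mpoly set" where
  "ideal_gen n G =
     {\<Sum>g\<in>A. c g * g | A c. finite A \<and> A \<subseteq> G \<and> (\<forall>g\<in>A. c g \<in> poly_ring n)}"

text \<open>The vertex \<open>k\<close> steps after \<open>x\<^sub>i\<close> on the cycle has index \<open>(i - 1 + k) mod n + 1 \<in> {1..n}\<close>.\<close>

definition cycle_path_monomial :: "nat \<Rightarrow> nat \<Rightarrow> nat \<Rightarrow> 'k::field mpoly" where
  "cycle_path_monomial n t i = (\<Prod>k<t. var ((i - 1 + k) mod n + 1))"

definition cycle_path_ideal :: "nat \<Rightarrow> nat \<Rightarrow> 'k::field mpoly set" where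
  "cycle_path_ideal n t = ideal_gen n (cycle_path_monomial n t ` {1..n})"

text \<open>
  A list \<open>ds\<close> of degrees stands for the graded free module
  \<open>\<Oplus>\<^bsub>c < length ds\<^esub> R(-ds ! c)\<close>, with \<open>R = K[x\<^sub>1,\<dots>,x\<^sub>n]\<close>.  A matrix represents
  a degree-preserving map to \<open>\<Oplus>\<^sub>r R(-ds ! r)\<close> from \<open>\<Oplus>\<^sub>c R(-es ! c)\<close> iff its
  \<open>(r, c)\<close> entry is homogeneous of degree \<open>es ! c - ds ! r\<close> (so zero if that is negative).
\<close>

definition free_module :: "nat \<Rightarrow> nat list \<Rightarrow> 'k::field mpoly vec set" where
  "free_module n ds = {v \<in> carrier_vec (length ds). \<forall>c < length ds. v $ c \<in> poly_ring n}"

definition graded_maps :: "nat \<Rightarrow> nat list \<Rightarrow> nat list \<Rightarrow> 'k::field mpoly mat set" where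
  "graded_maps n ds es =
     {A \<in> carrier_mat (length ds) (length es).
        \<forall>r < length ds. \<forall>c < length es.
          A $$ (r, c) \<in> poly_ring n \<and>
          (\<forall>m \<in> Poly_Mapping.keys (A $$ (r, c)). mon_degree m + ds ! r = es ! c)}"

text \<open>
  Graded free resolutions of \<open>R/I\<close> for a proper ideal \<open>I\<close>, with \<open>F\<^sub>0 = R \<rightarrow> R/I\<close> the quotient map.
  The module \<open>F\<^sub>i\<close> has generator degrees \<open>F i\<close>, and \<open>D i\<close> is the matrix of the differential
  \<open>F\<^bsub>i+1\<^esub> \<rightarrow> F\<^sub>i\<close>.  A resolution of finite length has \<open>F i = []\<close> for all large \<open>i\<close>.
\<close>

definition graded_free_resolution ::
  "nat \<Rightarrow> 'k::field mpoly set \<Rightarrow> (nat \<Rightarrow> nat list) \<Rightarrow> (nat \<Rightarrow> 'k mpoly mat) \<Rightarrow> bool" where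
  "graded_free_resolution n I F D \<longleftrightarrow>
     F 0 = [0] \<and>
     (\<forall>i. D i \<in> graded_maps n (F i) (F (Suc i))) \<and>
     {v \<in> free_module n (F 0). v $ 0 \<in> I} = (*\<^sub>v) (D 0) ` free_module n (F 1) \<and>
     (\<forall>i. {v \<in> free_module n (F (Suc i)). D i *\<^sub>v v = 0\<^sub>v (length (F i))} =
          (*\<^sub>v) (D (Suc i)) ` free_module n (F (Suc (Suc i))))"

text \<open>Minimality: every differential maps \<open>F\<^bsub>i+1\<^esub>\<close> into \<open>(x\<^sub>1,\<dots>,x\<^sub>n)F\<^sub>i\<close>.\<close>

definition minimal_graded_free_resolution ::
  "nat \<Rightarrow> 'k::field mpoly set \<Rightarrow> (nat \<Rightarrow> nat list) \<Rightarrow> (nat \<Rightarrow> 'k mpoly mat) \<Rightarrow> bool" where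
  "minimal_graded_free_resolution n I F D \<longleftrightarrow>
     graded_free_resolution n I F D \<and>
     (\<forall>i. \<forall>r < length (F i). \<forall>c < length (F (Suc i)).
        D i $$ (r, c) \<in> ideal_gen n (var ` {1..n}))"

text \<open>
  \<open>graded_betti n I i j\<close> is \<open>\<beta>\<^bsub>i,j\<^esub>(R/I)\<close>.  The description is meaningful because a proper
  homogeneous ideal has a minimal graded free resolution, unique up to isomorphism.
\<close>

definition graded_betti :: "nat \<Rightarrow> 'k::field mpoly set \<Rightarrow> nat \<Rightarrow> nat \<Rightarrow> nat" where
  "graded_betti n I i j =
     (THE b. \<exists>F D. minimal_graded_free_resolution n I F D \<and> b = count_list (F i) j)"

end

theory Submission
  imports Defs "HOL-Number_Theory.Cong"
begin

text \<open>
  A Betti number can be read off from any graded free resolution \<open>G\<close> of \<open>R/I\<close>, minimal or not.  If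
  \<open>F\<close> is a minimal one, the comparison maps \<open>F \<rightarrow> G \<rightarrow> F\<close> and the homotopies that relate their
  composites to the identity (\<open>resolution_comparison\<close>, \<open>resolution_homotopy\<close>) become matrices over
  \<open>K\<close> after all variables are set to zero.  The differential of \<open>F\<close> then vanishes, so the generators of
  \<open>F\<^sub>i\<close> in degree \<open>j\<close> form a basis of the homology of \<open>G \<otimes> K\<close> in homological degree \<open>i\<close> and degree \<open>j\<close>
  (\<open>retract_dimension\<close>).

  For \<open>G\<close> take the Taylor resolution, whose basis in homological degree \<open>i\<close> consists of the \<open>i\<close>-element
  sets of generators, a set having the degree of its least common multiple.  The part of \<open>G \<otimes> K\<close> in
  degree \<open>n\<close> is spanned by the sets of paths that cover the whole cycle
  (\<open>top_betti_number_eq_homology\<close>).  Name the path that starts at \<open>x\<^bsub>s+1\<^esub>\<close> by \<open>s \<in> {0..<n}\<close>.  A set \<open>S\<close>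
  of paths covers the cycle iff \<open>S\<close> meets every cyclic window of \<open>t\<close> consecutive positions
  (\<open>covering_eq_hitting\<close>).  It remains to compute the homology of the complex of these sets, with the
  simplicial boundary restricted to them.

  Whenever a family of sets is closed under adding a position \<open>x\<close>, the sets from which \<open>x\<close> can be added
  or removed without leaving the family span an acyclic quotient, and the sets that contain \<open>x\<close> and need
  it span a subcomplex with the same homology (\<open>homology_toggle_step\<close>).  Toggling \<open>0\<close> leaves the sets in
  which \<open>0\<close> is indispensable.  These are filtered by the next element \<open>v \<in> {1..t}\<close> after \<open>0\<close>; given \<open>v\<close>,
  the cyclic conditions turn into linear ones (\<open>gap_family_iff\<close>).  Toggling the first position after \<open>v\<close>
  forces two further elements at distance \<open>1\<close> and \<open>t + 1\<close> from \<open>v\<close>, and the remaining problem has the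
  same form with \<open>t + 1\<close> fewer positions (\<open>homology_tail_family\<close>).  With \<open>n = (t + 1) p + d\<close> the
  process ends after \<open>p - 1\<close> rounds with \<open>d\<close> free positions.  For \<open>d = 0\<close> each of the \<open>t\<close> values of \<open>v\<close>
  leaves exactly one set, of size \<open>2 p\<close>; for \<open>d \<noteq> 0\<close> only \<open>v = d\<close> leaves a set, of size \<open>2 p + 1\<close>.  All
  surviving sets have the same size, so their number is the dimension of the homology
  (\<open>homology_hitting_sets\<close>).  In the degenerate case \<open>p = 0\<close> one has \<open>n = t = d\<close>: any nonempty set of
  paths covers the cycle, and toggling \<open>0\<close> leaves only \<open>{0}\<close>.

  The definition of the Betti number as a unique value also requires that a minimal resolution exists.
  For squarefree monomial ideals it can be built from finite-dimensional linear algebra in the finitely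
  many squarefree multidegrees (\<open>minimal_resolution_exists\<close>).
\<close>

section \<open>Chains on families of finite sets\<close>

text \<open>
  The sign with which \<open>S\<close> occurs in the simplicial boundary of \<open>insert s S\<close>, for \<open>s \<notin> S\<close>.
\<close>

definition facet_sign :: "nat \<Rightarrow> nat set \<Rightarrow> 'k::field" where
  "facet_sign s S = (-1) ^ card {a \<in> S. a < s}"

text \<open>
  A chain is stored as its coefficient function on vertex sets, so the coefficient of the boundary at \<open>S\<close>
  collects the contributions of all sets with one vertex more.  The empty set counts as a face, and the
  homological degree of a set is its cardinality.
\<close>

definition boundary :: "nat \<Rightarrow> (nat set \<Rightarrow> 'k::field) \<Rightarrow> nat set \<Rightarrow> 'k" where
  "boundary n f S = (\<Sum>s\<in>{..<n} - S. facet_sign s S * f (insert s S))"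

lemma facet_sign_insert:
  assumes "finite S" "s \<notin> S" "s \<noteq> x"
  shows "(facet_sign x (insert s S) :: 'k::field) = (if s < x then - 1 else 1) * facet_sign x S"
proof -
  have "{a \<in> insert s S. a < x} = (if s < x then insert s {a \<in> S. a < x} else {a \<in> S. a < x})"
    by auto
  then show ?thesis using assms by (simp add: facet_sign_def)
qed

lemma facet_sign_square: "(facet_sign s S :: 'k::field) * facet_sign s S = 1"
  by (simp add: facet_sign_def flip: power_mult_distrib)

lemma facet_sign_swap:
  assumes "finite S" "s \<notin> S" "x \<notin> S" "s \<noteq> x"
  shows "(facet_sign s S :: 'k::field) * facet_sign x (insert s S)
    = - (facet_sign x S * facet_sign s (insert x S))"
  using assms by (simp add: facet_sign_insert mult.commute)

lemma boundary_boundary: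
  fixes f :: "nat set \<Rightarrow> 'k::field"
  assumes "finite S"
  shows "boundary n (boundary n f) S = 0"
proof -
  define G where "G s x = (facet_sign s S :: 'k) * facet_sign x (insert s S) * f (insert x (insert s S))" for s x
  let ?U = "{..<n} - S"
  have anti: "G s x = - G x s" if "s \<in> ?U" "x \<in> ?U" "s \<noteq> x" for s x
    using facet_sign_swap[of S s x, where 'k='k] that assms by (simp add: G_def insert_commute)
  have "boundary n (boundary n f) S = (\<Sum>s\<in>?U. \<Sum>x\<in>{..<n} - insert s S. G s x)"
    unfolding boundary_def G_def by (simp add: sum_distrib_left mult.assoc)
  also have "\<dots> = (\<Sum>s\<in>?U. \<Sum>x\<in>?U. if x \<noteq> s then G s x else 0)"
    by (rule sum.cong[OF refl], rule sum.mono_neutral_cong_left) auto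
  also have "\<dots> = (\<Sum>s\<in>?U. \<Sum>x\<in>?U. (if x < s then G s x else 0) + (if s < x then G s x else 0))"
    by (intro sum.cong refl) auto
  also have "\<dots> = (\<Sum>s\<in>?U. \<Sum>x\<in>?U. if x < s then G s x else 0)
      + (\<Sum>s\<in>?U. \<Sum>x\<in>?U. if s < x then G s x else 0)"
    by (simp add: sum.distrib)
  also have "(\<Sum>s\<in>?U. \<Sum>x\<in>?U. if s < x then G s x else 0)
      = (\<Sum>s\<in>?U. \<Sum>x\<in>?U. if x < s then G x s else 0)"
    by (rule sum.swap)
  also have "\<dots> = (\<Sum>s\<in>?U. \<Sum>x\<in>?U. - (if x < s then G s x else 0))"
  proof (intro sum.cong refl)
    fix s x assume "s \<in> ?U" "x \<in> ?U"
    then show "(if x < s then G x s else 0) = - (if x < s then G s x else 0)"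
      using anti[of x s] by simp
  qed
  finally show ?thesis by (simp add: sum_negf)
qed

text \<open>
  The form in which the sign rule is used when two of the signs have to change sides; \<open>a\<close> and \<open>b\<close> stand
  for signs.
\<close>

lemma sign_cancel:
  fixes a b c x :: "'k::field"
  assumes "a * a = 1" "b * b = 1" "a * x = - (c * b)"
  shows "b * x = - (c * a)"
proof -
  have "b * x = (a * a) * (b * x)" using assms by simp
  also have "\<dots> = a * b * (a * x)" by (simp only: ac_simps)
  also have "\<dots> = - (c * a * (b * b))" unfolding assms(3) by (simp add: ac_simps)
  finally show ?thesis using assms by simp
qed

text \<open>
  Families need not be closed under taking faces: for interval-closed \<open>F\<close> the complex of \<open>F\<close> is the
  subquotient of the full simplex spanned by the members of \<open>F\<close>.  So boundaries are only ever evaluated on members of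
  \<open>F\<close>, both here and in the notions of cycle and exactness below.
\<close>

definition chain_on :: "nat set set \<Rightarrow> nat \<Rightarrow> (nat set \<Rightarrow> 'k::field) \<Rightarrow> bool" where
  "chain_on F i f \<longleftrightarrow> (\<forall>S. f S \<noteq> 0 \<longrightarrow> S \<in> F \<and> card S = i)"

definition cycle_on :: "nat \<Rightarrow> nat set set \<Rightarrow> (nat set \<Rightarrow> 'k::field) \<Rightarrow> bool" where
  "cycle_on n F f \<longleftrightarrow> (\<forall>S\<in>F. boundary n f S = 0)"

text \<open>
  The cycles \<open>z 0, \<dots>, z (m - 1)\<close> represent a basis of the homology in degree \<open>i\<close>.
\<close>

definition homology_basis ::
  "nat \<Rightarrow> nat set set \<Rightarrow> nat \<Rightarrow> nat \<Rightarrow> (nat \<Rightarrow> nat set \<Rightarrow> 'k::field) \<Rightarrow> bool" where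
  "homology_basis n F i m z \<longleftrightarrow>
     (\<forall>k<m. chain_on F i (z k) \<and> cycle_on n F (z k)) \<and>
     (\<forall>f. chain_on F i f \<and> cycle_on n F f \<longrightarrow>
        (\<exists>a y. chain_on F (Suc i) y \<and> (\<forall>S\<in>F. f S = (\<Sum>k<m. a k * z k S) + boundary n y S))) \<and>
     (\<forall>a y. chain_on F (Suc i) y \<and> (\<forall>S\<in>F. (\<Sum>k<m. a k * z k S) = boundary n y S) \<longrightarrow>
        (\<forall>k<m. a k = 0))"

text \<open>
  The coefficient field occurs only in the quantified chains, hence the type argument.
\<close>

definition exact_at :: "'k::field itself \<Rightarrow> nat \<Rightarrow> nat set set \<Rightarrow> nat \<Rightarrow> bool" where
  "exact_at _ n F i \<longleftrightarrow> (\<forall>f :: nat set \<Rightarrow> 'k. chain_on F i f \<and> cycle_on n F f \<longrightarrow>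
     (\<exists>y. chain_on F (Suc i) y \<and> (\<forall>S\<in>F. f S = boundary n y S)))"

definition homology_in_degree :: "'k::field itself \<Rightarrow> nat \<Rightarrow> nat set set \<Rightarrow> nat \<Rightarrow> nat \<Rightarrow> bool" where
  "homology_in_degree K n F i0 m \<longleftrightarrow>
     (\<forall>i. i \<noteq> i0 \<longrightarrow> exact_at K n F i) \<and> (\<exists>z :: nat \<Rightarrow> nat set \<Rightarrow> 'k. homology_basis n F i0 m z)"

lemma exact_atD:
  assumes "exact_at TYPE('k::field) n F i" "chain_on F i (f :: nat set \<Rightarrow> 'k)" "cycle_on n F f"
  shows "\<exists>y. chain_on F (Suc i) y \<and> (\<forall>S\<in>F. f S = boundary n y S)"
  using assms unfolding exact_at_def by blast

lemma homology_basis_0: "homology_basis n F i 0 (z :: nat \<Rightarrow> nat set \<Rightarrow> 'k) \<longleftrightarrow> exact_at TYPE('k::field) n F i"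
  by (auto simp: homology_basis_def exact_at_def)

text \<open>
  The family is a cone with apex \<open>x\<close>: adding \<open>x\<close> to every set is a contracting homotopy.  It is applied
  to the cycle \<open>f\<close> as \<open>y\<close>, and the two cases check \<open>f = \<partial>y\<close> at sets without and with \<open>x\<close>.
\<close>

lemma exact_if_toggle:
  assumes F: "F \<subseteq> Pow {..<n}" and x: "x < n"
    and tog: "\<And>S. S \<in> F \<Longrightarrow> insert x S \<in> F \<and> S - {x} \<in> F"
  shows "exact_at TYPE('k::field) n F i"
  unfolding exact_at_def
proof (intro allI impI)
  fix f :: "nat set \<Rightarrow> 'k" assume f: "chain_on F i f \<and> cycle_on n F f"
  define y where "y S = (if x \<in> S then facet_sign x (S - {x}) * f (S - {x}) else 0)" for S
  have fin: "finite S" if "S \<in> F" for S using F that finite_subset by auto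
  have "chain_on F (Suc i) y"
    unfolding chain_on_def
  proof (intro allI impI)
    fix S assume "y S \<noteq> 0"
    then have "x \<in> S" "f (S - {x}) \<noteq> 0" by (auto simp: y_def split: if_splits)
    then have "S - {x} \<in> F" "card (S - {x}) = i" using f by (auto simp: chain_on_def)
    moreover have "insert x (S - {x}) = S" using \<open>x \<in> S\<close> by auto
    ultimately show "S \<in> F \<and> card S = Suc i"
      using tog[of "S - {x}"] fin[of S] \<open>x \<in> S\<close> by (metis card_Suc_Diff1)
  qed
  moreover have "f S = boundary n y S" if S: "S \<in> F" for S
  proof (cases "x \<in> S")
    case False
    have "boundary n y S = (\<Sum>s\<in>{..<n} - S. if s = x then facet_sign x S * y (insert x S) else 0)"
      unfolding boundary_def using False by (intro sum.cong refl) (auto simp: y_def)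
    also have "\<dots> = facet_sign x S * y (insert x S)" using False x by simp
    finally show ?thesis using False
      by (simp add: y_def facet_sign_square flip: mult.assoc)
  next
    case True
    define T where "T = S - {x}"
    have T: "S = insert x T" "x \<notin> T" "finite T" "T \<in> F"
      using True fin[OF S] tog[OF S] by (auto simp: T_def)
    have "0 = boundary n f T" using f T by (auto simp: cycle_on_def)
    also have "boundary n f T = (\<Sum>s\<in>insert x ({..<n} - S). facet_sign s T * f (insert s T))"
      unfolding boundary_def using x True by (intro sum.cong) (auto simp: T_def)
    also have "\<dots> = facet_sign x T * f S + (\<Sum>s\<in>{..<n} - S. facet_sign s T * f (insert s T))"
      using True by (subst sum.insert) (auto simp flip: T(1))
    finally have e: "(\<Sum>s\<in>{..<n} - S. facet_sign s T * f (insert s T)) = - (facet_sign x T * f S)"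
      by (simp add: eq_neg_iff_add_eq_0 add.commute)
    have "boundary n y S = (\<Sum>s\<in>{..<n} - S. - facet_sign x T * (facet_sign s T * f (insert s T)))"
      unfolding boundary_def
    proof (intro sum.cong refl)
      fix s assume s: "s \<in> {..<n} - S"
      have a: "insert s S - {x} = insert s T" using s T by auto
      have "facet_sign s S * facet_sign x (insert s T) = - (facet_sign x T * facet_sign s T :: 'k)"
      proof -
        have 1: "(facet_sign s T :: 'k) * facet_sign x (insert s T) = - (facet_sign x T * facet_sign s S)"
          using facet_sign_swap[of T s x] s T by auto
        show ?thesis
          by (rule sign_cancel[OF _ _ 1]) (simp_all add: facet_sign_square)
      qed
      then show "facet_sign s S * y (insert s S) = - facet_sign x T * (facet_sign s T * f (insert s T))"
        using True a by (simp add: y_def flip: mult.assoc)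
    qed
    also have "\<dots> = - facet_sign x T * - (facet_sign x T * f S)"
      unfolding sum_distrib_left[symmetric] e ..
    finally show ?thesis by (simp add: facet_sign_square flip: mult.assoc)
  qed
  ultimately show "\<exists>y. chain_on F (Suc i) y \<and> (\<forall>S\<in>F. f S = boundary n y S)" by blast
qed

lemma homology_if_toggle:
  assumes "F \<subseteq> Pow {..<n}" "x < n" "\<And>S. S \<in> F \<Longrightarrow> insert x S \<in> F \<and> S - {x} \<in> F"
  shows "homology_in_degree TYPE('k::field) n F i0 0"
  unfolding homology_in_degree_def homology_basis_0
  using exact_if_toggle[OF assms, where 'k='k] by blast

lemma homology_singleton:
  assumes "A \<subseteq> {..<n}"
  shows "homology_in_degree TYPE('k::field) n {A} (card A) 1"
proof -
  have fin: "finite A" using assms finite_subset by auto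
  have bd0: "boundary n f A = 0" if "chain_on {A} i f" for f :: "nat set \<Rightarrow> 'k" and i
    unfolding boundary_def using that by (intro sum.neutral) (auto simp: chain_on_def)
  have ch: "f A = 0" if "chain_on {A} i f" "i \<noteq> card A" for f :: "nat set \<Rightarrow> 'k" and i
    using that by (auto simp: chain_on_def)
  define z where "z k S = (if S = A then 1 else 0 :: 'k)" for k :: nat and S
  have z: "chain_on {A} (card A) (z k)" for k by (auto simp: chain_on_def z_def)
  have 0: "chain_on {A} i (\<lambda>_. 0 :: 'k)" for i by (simp add: chain_on_def)
  have bd00: "boundary n (\<lambda>_. 0 :: 'k) S = 0" for S by (simp add: boundary_def)
  have "homology_basis n {A} (card A) 1 z"
    unfolding homology_basis_def
  proof (intro conjI allI impI)
    fix f :: "nat set \<Rightarrow> 'k" assume "chain_on {A} (card A) f \<and> cycle_on n {A} f"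
    show "\<exists>a y. chain_on {A} (Suc (card A)) y \<and> (\<forall>S\<in>{A}. f S = (\<Sum>k<1. a k * z k S) + boundary n y S)"
      by (rule exI[of _ "\<lambda>_. f A"], rule exI[of _ "\<lambda>_. 0"]) (simp add: 0 bd00 z_def)
  qed (auto simp: z cycle_on_def bd0[OF z] z_def dest!: bd0)
  moreover have "exact_at TYPE('k) n {A} i" if "i \<noteq> card A" for i
    unfolding exact_at_def using 0 bd00 ch that by fastforce
  ultimately show ?thesis unfolding homology_in_degree_def by blast
qed

definition interval_closed :: "nat set set \<Rightarrow> bool" where
  "interval_closed F \<longleftrightarrow> (\<forall>S\<in>F. \<forall>T\<in>F. \<forall>R. S \<subseteq> R \<and> R \<subseteq> T \<longrightarrow> R \<in> F)"

lemma interval_closedD: "interval_closed F \<Longrightarrow> S \<in> F \<Longrightarrow> T \<in> F \<Longrightarrow> S \<subseteq> R \<Longrightarrow> R \<subseteq> T \<Longrightarrow> R \<in> F"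
  unfolding interval_closed_def by blast

definition restr :: "nat set set \<Rightarrow> (nat set \<Rightarrow> 'k::field) \<Rightarrow> nat set \<Rightarrow> 'k" where
  "restr F f S = (if S \<in> F then f S else 0)"

lemma boundary_add: "boundary n (\<lambda>S. f S + g S) S = boundary n f S + boundary n g S"
  by (simp add: boundary_def algebra_simps sum.distrib)

lemma boundary_diff: "boundary n (\<lambda>S. f S - g S) S = boundary n f S - boundary n g S"
  by (simp add: boundary_def algebra_simps sum_subtractf)

lemma boundary_scale: "boundary n (\<lambda>S. c * f S) S = c * boundary n f S"
  by (simp add: boundary_def sum_distrib_left mult.left_commute)

lemma boundary_sum: "boundary n (\<lambda>S. \<Sum>k\<in>I. f k S) S = (\<Sum>k\<in>I. boundary n (f k) S)"
  unfolding boundary_def sum_distrib_left by (rule sum.swap)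

lemma chain_on_add: "chain_on F i f \<Longrightarrow> chain_on F i g \<Longrightarrow> chain_on F i (\<lambda>S. f S + g S)"
  unfolding chain_on_def by (metis add.right_neutral)

lemma chain_on_diff: "chain_on F i f \<Longrightarrow> chain_on F i g \<Longrightarrow> chain_on F i (\<lambda>S. f S - g S)"
  unfolding chain_on_def by (metis diff_zero)

lemma chain_on_scale: "chain_on F i f \<Longrightarrow> chain_on F i (\<lambda>S. c * f S)"
  by (auto simp: chain_on_def)

lemma chain_on_sum: "(\<And>k. k \<in> I \<Longrightarrow> chain_on F i (f k)) \<Longrightarrow> chain_on F i (\<lambda>S. \<Sum>k\<in>I. f k S)"
  unfolding chain_on_def by (metis sum.neutral)

lemma chain_on_mono: "chain_on F i f \<Longrightarrow> F \<subseteq> G \<Longrightarrow> chain_on G i f"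
  by (auto simp: chain_on_def)

lemma chain_on_restr: "chain_on F i f \<Longrightarrow> chain_on G i (restr G f)"
  by (auto simp: chain_on_def restr_def)

lemma chain_on_boundary:
  assumes "chain_on F (Suc i) y" "F \<subseteq> Pow {..<n}"
  shows "chain_on G i (restr G (boundary n y))"
  unfolding chain_on_def
proof (intro allI impI)
  fix S assume "restr G (boundary n y) S \<noteq> 0"
  then have "S \<in> G" "boundary n y S \<noteq> 0" by (auto simp: restr_def split: if_splits)
  then obtain s where s: "s \<notin> S" "y (insert s S) \<noteq> 0"
    unfolding boundary_def by (auto elim: sum.not_neutral_contains_not_neutral)
  then have "insert s S \<in> F" "card (insert s S) = Suc i" using assms by (auto simp: chain_on_def)
  moreover then have "finite S" using assms finite_subset[of _ "{..<n}"] by fastforce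
  ultimately show "S \<in> G \<and> card S = i" using s \<open>S \<in> G\<close> by auto
qed

lemma cycle_on_boundary:
  assumes "chain_on F i y" "F \<subseteq> Pow {..<n}" "interval_closed F"
  shows "cycle_on n F (restr F (boundary n y))"
  unfolding cycle_on_def
proof
  fix S assume S: "S \<in> F"
  have "boundary n (restr F (boundary n y)) S = boundary n (boundary n y) S"
    unfolding boundary_def[of n _ S]
  proof (intro sum.cong refl arg_cong[where f="(*) _"])
    fix s assume s: "s \<in> {..<n} - S"
    show "restr F (boundary n y) (insert s S) = boundary n y (insert s S)"
    proof (cases "insert s S \<in> F")
      case False
      have "boundary n y (insert s S) = 0"
        unfolding boundary_def
      proof (intro sum.neutral ballI)
        fix x
        have "y (insert x (insert s S)) = 0"
        proof (rule ccontr)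
          assume "\<not> ?thesis"
          then have "insert x (insert s S) \<in> F" using assms by (auto simp: chain_on_def)
          then show False using interval_closedD[OF assms(3) S, of _ "insert s S"] False by blast
        qed
        then show "facet_sign x (insert s S) * y (insert x (insert s S)) = 0" by simp
      qed
      then show ?thesis using False by (simp add: restr_def)
    qed (simp add: restr_def)
  qed
  also have "\<dots> = 0" using S assms(2) finite_subset by (intro boundary_boundary) auto
  finally show "boundary n (restr F (boundary n y)) S = 0" .
qed

lemma sum_lessThan_add: "(\<Sum>k<m1 + m2. g k) = (\<Sum>k<m1. g k) + (\<Sum>k<m2. g (m1 + k) :: 'a::comm_monoid_add)" for m1 m2 :: nat
  by (induction m2) (simp_all add: add.assoc)

lemma homology_basis_independent:
  assumes "homology_basis n F i m z" "chain_on F (Suc i) y" "\<And>S. S \<in> F \<Longrightarrow> (\<Sum>k<m. a k * z k S) = boundary n y S" "k < m"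
  shows "a k = 0"
  using assms unfolding homology_basis_def by metis

text \<open>
  The long exact sequence of the subcomplex \<open>A\<close> and the quotient \<open>Q\<close>, in the case where the homology of
  both is concentrated in the same degree, so that all connecting maps vanish and the dimensions add up.
\<close>

lemma homology_of_filtration_step:
  assumes F: "F \<subseteq> Pow {..<n}" "interval_closed F" and AQ: "F = A \<union> Q" "A \<inter> Q = {}"
    and sub: "\<And>T s. T \<in> Q \<Longrightarrow> s < n \<Longrightarrow> insert s T \<notin> A"
    and HA: "homology_in_degree TYPE('k::field) n A i0 m1"
    and HQ: "homology_in_degree TYPE('k) n Q i0 m2"
  shows "homology_in_degree TYPE('k) n F i0 (m1 + m2)"
proof -
  have A: "A \<subseteq> F" and Q: "Q \<subseteq> F" and PA: "A \<subseteq> Pow {..<n}" and PQ: "Q \<subseteq> Pow {..<n}"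
    using AQ F by auto
  have bdQ: "boundary n (restr Q x) T = boundary n x T" if "T \<in> Q" "chain_on F i x" for x :: "nat set \<Rightarrow> 'k" and T i
    unfolding boundary_def using that sub AQ
    by (intro sum.cong refl) (auto simp: restr_def chain_on_def)
  have bdA: "boundary n x T = 0" if "T \<in> Q" "chain_on A i x" for x :: "nat set \<Rightarrow> 'k" and T i
    unfolding boundary_def using that sub by (intro sum.neutral ballI) (auto simp: chain_on_def)
  have A0: "x T = 0" if "T \<in> Q" "chain_on A i x" for x :: "nat set \<Rightarrow> 'k" and T i
    using that AQ by (auto simp: chain_on_def)
  have cycQ: "cycle_on n Q (restr Q x)" if "chain_on F i x" "cycle_on n F x" for x :: "nat set \<Rightarrow> 'k" and i
    using that Q bdQ unfolding cycle_on_def by auto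
  \<comment> \<open>a chain of \<open>F\<close> that is a boundary in \<open>Q\<close> differs from a chain of \<open>A\<close> by a boundary in \<open>F\<close>\<close>
  have reduce: "\<exists>g. chain_on A i g \<and> (\<forall>S\<in>F. boundary n g S = boundary n f S) \<and> (\<forall>S\<in>F. f S = g S + boundary n y S)"
    if "chain_on F i f" "chain_on Q (Suc i) y" "\<And>S. S \<in> Q \<Longrightarrow> f S = boundary n y S"
    for f y :: "nat set \<Rightarrow> 'k" and i
  proof (intro exI conjI ballI)
    let ?g = "\<lambda>S. f S - restr F (boundary n y) S"
    have yF: "chain_on F (Suc i) y" using chain_on_mono that Q by blast
    have "chain_on F i ?g" by (intro chain_on_diff that chain_on_boundary[OF yF F(1)])
    moreover have "?g S = 0" if "S \<in> Q" for S using \<open>S \<in> Q \<Longrightarrow> f S = boundary n y S\<close> that Q by (auto simp: restr_def)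
    ultimately show "chain_on A i ?g" unfolding chain_on_def using AQ by blast
    fix S assume S: "S \<in> F"
    show "boundary n ?g S = boundary n f S"
      using cycle_on_boundary[OF yF F] S by (simp add: boundary_diff cycle_on_def)
    show "f S = ?g S + boundary n y S" using S by (simp add: restr_def)
  qed
  have exA: "exact_at TYPE('k) n A i" and exQ: "exact_at TYPE('k) n Q i" if "i \<noteq> i0" for i
    using HA HQ that unfolding homology_in_degree_def by auto
  have ex: "exact_at TYPE('k) n F i" if i: "i \<noteq> i0" for i
    unfolding exact_at_def
  proof (intro allI impI)
    fix f :: "nat set \<Rightarrow> 'k" assume f: "chain_on F i f \<and> cycle_on n F f"
    obtain y where y: "chain_on Q (Suc i) y" "\<And>S. S \<in> Q \<Longrightarrow> restr Q f S = boundary n y S"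
      using exact_atD[OF exQ[OF i]] cycQ chain_on_restr f by metis
    then obtain g where g: "chain_on A i g" "\<And>S. S \<in> F \<Longrightarrow> boundary n g S = boundary n f S" "\<And>S. S \<in> F \<Longrightarrow> f S = g S + boundary n y S"
      using reduce[of i f y] f by (auto simp: restr_def)
    have "cycle_on n A g" using g(2) f A by (auto simp: cycle_on_def)
    then obtain y' where y': "chain_on A (Suc i) y'" "\<And>S. S \<in> A \<Longrightarrow> g S = boundary n y' S"
      using exact_atD[OF exA[OF i] g(1)] by metis
    have "f S = boundary n (\<lambda>S. y' S + y S) S" if "S \<in> F" for S
      using g(3)[OF that] y'(2)[of S] bdA[OF _ y'(1)] A0[OF _ g(1)] that AQ by (auto simp: boundary_add)
    moreover have "chain_on F (Suc i) (\<lambda>S. y' S + y S)"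
      using chain_on_add[OF chain_on_mono[OF y'(1) A] chain_on_mono[OF y(1) Q]] .
    ultimately show "\<exists>y. chain_on F (Suc i) y \<and> (\<forall>S\<in>F. f S = boundary n y S)" by blast
  qed
  obtain z z' :: "nat \<Rightarrow> nat set \<Rightarrow> 'k" where z: "homology_basis n A i0 m1 z" and z': "homology_basis n Q i0 m2 z'"
    using HA HQ unfolding homology_in_degree_def by blast
  have zc: "chain_on A i0 (z k)" "cycle_on n A (z k)" if "k < m1" for k
    using z that unfolding homology_basis_def by auto
  have zc': "chain_on Q i0 (z' k)" "cycle_on n Q (z' k)" if "k < m2" for k
    using z' that unfolding homology_basis_def by auto
  \<comment> \<open>the connecting map vanishes because the homology of \<open>A\<close> does so in degree \<open>i0 - 1\<close>;
     therefore cycles of \<open>Q\<close> can be corrected by chains of \<open>A\<close> to cycles of \<open>F\<close>\<close>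
  have "\<exists>w. chain_on A i0 w \<and> (\<forall>S\<in>A. boundary n (z' k) S = boundary n w S)" if k: "k < m2" for k
  proof (cases i0)
    case 0
    have "boundary n (z' k) S = 0" for S
      unfolding boundary_def using zc'(1)[OF k] PQ 0
      by (intro sum.neutral ballI) (auto simp: chain_on_def card_eq_0_iff intro: finite_subset)
    then show ?thesis by (intro exI[of _ "\<lambda>_. 0"]) (simp add: chain_on_def boundary_def)
  next
    case (Suc j)
    have F': "chain_on F (Suc j) (z' k)" using zc'(1)[OF k] Suc chain_on_mono Q by blast
    have e: "restr A (boundary n (z' k)) = restr F (boundary n (z' k))"
      using zc'(2)[OF k] AQ by (auto simp: restr_def cycle_on_def)
    have c1: "chain_on A j (restr A (boundary n (z' k)))" using chain_on_boundary[OF F' F(1)] .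
    have c2: "cycle_on n A (restr A (boundary n (z' k)))"
      using cycle_on_boundary[OF F' F] A unfolding e cycle_on_def by auto
    have "j \<noteq> i0" using Suc by simp
    obtain w where "chain_on A (Suc j) w" "\<And>S. S \<in> A \<Longrightarrow> restr A (boundary n (z' k)) S = boundary n w S"
      using exact_atD[OF exA[OF \<open>j \<noteq> i0\<close>] c1 c2] by blast
    then show ?thesis using Suc by (auto simp: restr_def)
  qed
  then obtain w where w: "\<And>k. k < m2 \<Longrightarrow> chain_on A i0 (w k)"
    "\<And>k S. k < m2 \<Longrightarrow> S \<in> A \<Longrightarrow> boundary n (z' k) S = boundary n (w k) S" by metis
  define v where "v k S = z' k S - w k S" for k S
  have v: "chain_on F i0 (v k)" "cycle_on n F (v k)" "\<And>S. S \<in> Q \<Longrightarrow> v k S = z' k S" if k: "k < m2" for k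
  proof -
    show "chain_on F i0 (v k)" unfolding v_def
      using chain_on_diff[OF chain_on_mono[OF zc'(1)[OF k] Q] chain_on_mono[OF w(1)[OF k] A]] .
    show "v k S = z' k S" if "S \<in> Q" for S using A0[OF that w(1)[OF k]] by (simp add: v_def)
    show "cycle_on n F (v k)"
      unfolding cycle_on_def v_def boundary_diff
      using w(2)[OF k] bdA[OF _ w(1)[OF k]] zc'(2)[OF k] AQ by (auto simp: cycle_on_def)
  qed
  define Z where "Z k = (if k < m1 then z k else v (k - m1))" for k
  have Zsum: "(\<Sum>k<m1 + m2. a k * Z k S) = (\<Sum>k<m1. a k * z k S) + (\<Sum>k<m2. a (m1 + k) * v k S)" for a S
    by (simp add: sum_lessThan_add Z_def)
  have z0: "(\<Sum>k<m1. a k * z k S) = 0" if "S \<in> Q" for a S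
    using A0[OF that zc(1)] by (intro sum.neutral) auto
  have "homology_basis n F i0 (m1 + m2) Z"
    unfolding homology_basis_def
  proof (intro conjI allI impI)
    fix k assume k: "k < m1 + m2"
    show "chain_on F i0 (Z k)"
      using k zc(1) v(1) A by (auto simp: Z_def intro: chain_on_mono)
    show "cycle_on n F (Z k)"
    proof (cases "k < m1")
      case True
      then show ?thesis using zc[OF True] bdA[OF _ zc(1)[OF True]] AQ by (auto simp: Z_def cycle_on_def)
    next
      case False
      then show ?thesis using v(2)[of "k - m1"] k by (auto simp: Z_def)
    qed
  next
    fix f :: "nat set \<Rightarrow> 'k" assume f: "chain_on F i0 f \<and> cycle_on n F f"
    then have "chain_on Q i0 (restr Q f) \<and> cycle_on n Q (restr Q f)"
      using cycQ chain_on_restr by blast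
    then obtain b y where y: "chain_on Q (Suc i0) y"
      "\<And>S. S \<in> Q \<Longrightarrow> restr Q f S = (\<Sum>k<m2. b k * z' k S) + boundary n y S"
      using z' unfolding homology_basis_def by blast
    let ?f = "\<lambda>S. f S - (\<Sum>k<m2. b k * v k S)"
    have cf: "chain_on F i0 ?f"
      using f v(1) by (intro chain_on_diff chain_on_sum chain_on_scale) auto
    have "?f S = boundary n y S" if "S \<in> Q" for S
      using y(2)[OF that] that v(3) by (simp add: restr_def)
    then obtain g where g: "chain_on A i0 g" "\<And>S. S \<in> F \<Longrightarrow> boundary n g S = boundary n ?f S" "\<And>S. S \<in> F \<Longrightarrow> ?f S = g S + boundary n y S"
      using reduce[OF cf y(1)] by blast
    have "boundary n ?f S = 0" if "S \<in> F" for S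
      unfolding boundary_diff boundary_sum boundary_scale using f v(2) that by (simp add: cycle_on_def)
    then have "cycle_on n A g" using g(2) A by (auto simp: cycle_on_def)
    then obtain a y' where y': "chain_on A (Suc i0) y'"
      "\<And>S. S \<in> A \<Longrightarrow> g S = (\<Sum>k<m1. a k * z k S) + boundary n y' S"
      using g(1) z unfolding homology_basis_def by blast
    define c where "c k = (if k < m1 then a k else b (k - m1))" for k
    have "f S = (\<Sum>k<m1 + m2. c k * Z k S) + boundary n (\<lambda>S. y' S + y S) S" if S: "S \<in> F" for S
    proof -
      have "g S = (\<Sum>k<m1. a k * z k S) + boundary n y' S"
        using y'(2)[of S] bdA[OF _ y'(1)] A0[OF _ g(1)] z0 S AQ by fastforce
      moreover have "(\<Sum>k<m1 + m2. c k * Z k S) = (\<Sum>k<m1. a k * z k S) + (\<Sum>k<m2. b k * v k S)"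
        by (simp add: Zsum c_def)
      ultimately show ?thesis using g(3)[OF S]
        by (simp add: boundary_add algebra_simps)
    qed
    moreover have "chain_on F (Suc i0) (\<lambda>S. y' S + y S)"
      using chain_on_add[OF chain_on_mono[OF y'(1) A] chain_on_mono[OF y(1) Q]] .
    ultimately show "\<exists>a y. chain_on F (Suc i0) y \<and> (\<forall>S\<in>F. f S = (\<Sum>k<m1 + m2. a k * Z k S) + boundary n y S)"
      by blast
  next
    fix a and y :: "nat set \<Rightarrow> 'k" and k
    assume y: "chain_on F (Suc i0) y \<and> (\<forall>S\<in>F. (\<Sum>k<m1 + m2. a k * Z k S) = boundary n y S)" and k: "k < m1 + m2"
    have "(\<Sum>k<m2. a (m1 + k) * z' k S) = boundary n (restr Q y) S" if "S \<in> Q" for S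
    proof -
      have "(\<Sum>k<m2. a (m1 + k) * z' k S) = (\<Sum>k<m1 + m2. a k * Z k S)"
        unfolding Zsum z0[OF that] using v(3)[OF _ that] by simp
      also have "\<dots> = boundary n y S" using y that Q by blast
      finally show ?thesis using bdQ[OF that conjunct1[OF y]] by simp
    qed
    then have b: "a (m1 + k) = 0" if "k < m2" for k
      using homology_basis_independent[OF z' chain_on_restr[OF conjunct1[OF y]], of "\<lambda>k. a (m1 + k)"] that by simp
    \<comment> \<open>\<open>y\<close> itself need not be a chain of \<open>A\<close>, but it is one up to a boundary\<close>
    have az: "(\<Sum>k<m1. a k * z k S) = boundary n y S" if "S \<in> F" for S
      using y that b by (simp add: Zsum)
    have c1: "chain_on Q (Suc i0) (restr Q y)" using chain_on_restr y by blast
    have c2: "cycle_on n Q (restr Q y)"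
      unfolding cycle_on_def
    proof
      fix S assume S: "S \<in> Q"
      then show "boundary n (restr Q y) S = 0"
        using bdQ[OF S conjunct1[OF y]] az[of S] z0[OF S] Q by auto
    qed
    have "Suc i0 \<noteq> i0" by simp
    obtain y2 where y2: "chain_on Q (Suc (Suc i0)) y2" "\<And>S. S \<in> Q \<Longrightarrow> restr Q y S = boundary n y2 S"
      using exact_atD[OF exQ[OF \<open>Suc i0 \<noteq> i0\<close>] c1 c2] by blast
    then obtain g where g: "chain_on A (Suc i0) g" "\<And>S. S \<in> F \<Longrightarrow> boundary n g S = boundary n y S"
      using reduce[of "Suc i0" y y2] y by (auto simp: restr_def)
    then have "(\<Sum>k<m1. a k * z k S) = boundary n g S" if "S \<in> A" for S using az[of S] A that by auto
    then have "a k = 0" if "k < m1" for k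
      using homology_basis_independent[OF z g(1), of a] that by simp
    then show "a k = 0" using b[of "k - m1"] k by (cases "k < m1") auto
  qed
  then show ?thesis using ex unfolding homology_in_degree_def by blast
qed

section \<open>Sets that meet every window of a cycle\<close>

text \<open>
  The elements up to position \<open>a\<close> are fixed to be those of \<open>A\<close>; the others range over the positions
  strictly between \<open>a\<close> and \<open>e\<close>.  The last condition, on the \<open>v\<close> positions before \<open>e\<close>, is what a window
  that wraps around the cycle leaves behind when the gap after \<open>0\<close> has length \<open>v\<close>.
\<close>

definition tail_family :: "nat \<Rightarrow> nat \<Rightarrow> nat \<Rightarrow> nat set \<Rightarrow> nat \<Rightarrow> nat set set" where
  "tail_family t v e A a = {S. A \<subseteq> S \<and> S \<subseteq> A \<union> {a<..<e} \<and>
     (\<forall>j. a < j \<and> j + t \<le> e \<longrightarrow> S \<inter> {j..<j + t} \<noteq> {}) \<and> S \<inter> {e - v..<e} \<noteq> {}}"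

lemma interval_closed_tail_family: "interval_closed (tail_family t v e A a)"
  unfolding interval_closed_def tail_family_def
  by (clarsimp simp: disjoint_iff) (meson in_mono order_trans)

lemma tail_familyI:
  assumes "A \<subseteq> S" "S \<subseteq> A \<union> {a<..<e}" "S \<inter> {e - v..<e} \<noteq> {}"
    and "\<And>j. a < j \<Longrightarrow> j + t \<le> e \<Longrightarrow> S \<inter> {j..<j + t} \<noteq> {}"
  shows "S \<in> tail_family t v e A a"
  using assms by (simp add: tail_family_def)

lemma tail_familyD:
  assumes "S \<in> tail_family t v e A a"
  shows "A \<subseteq> S" "S \<subseteq> A \<union> {a<..<e}" "S \<inter> {e - v..<e} \<noteq> {}"
    and "\<And>j. a < j \<Longrightarrow> j + t \<le> e \<Longrightarrow> S \<inter> {j..<j + t} \<noteq> {}"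
  using assms by (simp_all add: tail_family_def)

lemma tail_family_insert:
  assumes "S \<in> tail_family t v e A a" "a < x" "x < e"
  shows "insert x S \<in> tail_family t v e A a"
  using tail_familyD[OF assms(1)] assms(2,3) by (intro tail_familyI) auto

lemma tail_family_remove:
  assumes "S \<in> tail_family t v e A a" "x \<notin> A" "(S - {x}) \<inter> {e - v..<e} \<noteq> {}"
    and "\<And>j. a < j \<Longrightarrow> j + t \<le> e \<Longrightarrow> (S - {x}) \<inter> {j..<j + t} \<noteq> {}"
  shows "S - {x} \<in> tail_family t v e A a"
  using tail_familyD[OF assms(1)] assms(2-) by (intro tail_familyI) auto

lemma tail_family_subset:
  assumes "A \<subseteq> {..a}" "a < e" "e \<le> n"
  shows "tail_family t v e A a \<subseteq> Pow {..<n}"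
proof -
  have "A \<union> {a<..<e} \<subseteq> {..<n}" using assms by fastforce
  then show ?thesis by (auto simp: tail_family_def)
qed

text \<open>
  The sets from which \<open>x\<close> can be removed inside \<open>F\<close>, together with the sets without \<open>x\<close>, form a quotient
  complex that is closed under toggling \<open>x\<close> and therefore acyclic.
\<close>

lemma homology_toggle_step:
  assumes F: "F \<subseteq> Pow {..<n}" "interval_closed F" and x: "x < n"
    and up: "\<And>S. S \<in> F \<Longrightarrow> insert x S \<in> F"
    and U: "homology_in_degree TYPE('k::field) n {S \<in> F. x \<in> S \<and> S - {x} \<notin> F} i0 m"
  shows "homology_in_degree TYPE('k) n F i0 m"
proof -
  let ?U = "{S \<in> F. x \<in> S \<and> S - {x} \<notin> F}"
  let ?Q = "{S \<in> F. S - {x} \<in> F}"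
  have "homology_in_degree TYPE('k) n F i0 (m + 0)"
  proof (rule homology_of_filtration_step[OF F _ _ _ U])
    show "F = ?U \<union> ?Q" using insert_absorb by fastforce
    show "?U \<inter> ?Q = {}" by auto
    show "homology_in_degree TYPE('k) n ?Q i0 0"
      by (rule homology_if_toggle[OF _ x]) (use F up in auto)
    fix T s assume T: "T \<in> ?Q" "s < n"
    show "insert s T \<notin> ?U"
    proof
      assume S: "insert s T \<in> ?U"
      show False
      proof (cases "s = x")
        case True
        then show False using S T by (cases "x \<in> T") (auto simp: insert_absorb)
      next
        case False
        have "insert s T - {x} \<in> F"
          using interval_closedD[OF F(2), of "T - {x}" "insert s T" "insert s T - {x}"] S T by auto
        then show False using S by auto
      qed
    qed
  qed
  then show ?thesis by simp
qed

text \<open>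
  Toggle \<open>a + 1\<close>.  If at least \<open>t + 1\<close> positions are free, a set needs \<open>a + 1\<close> only if it has no other
  element in the window that starts there; the next window then forces \<open>a + t + 1\<close>, and the same family
  with \<open>t + 1\<close> fewer positions remains.  At the end \<open>d\<close> positions are free.  If \<open>d = 0\<close>, the only set is
  \<open>A\<close>.  If \<open>0 < d < v\<close>, the condition on the last \<open>v\<close> positions is met by \<open>a\<close>; if \<open>v < d\<close>, it does not
  involve \<open>a + 1\<close>, and it implies the condition on the one window that may start there; in both cases \<open>a + 1\<close> can be toggled freely.  If \<open>v = d\<close>, the condition requires an
  element among the free positions, and only \<open>insert (a + 1) A\<close> cannot spare \<open>a + 1\<close>.
\<close>

lemma homology_tail_family:
  assumes "e = a + 1 + (t + 1) * q + d" "e \<le> n" "a \<in> A" "A \<subseteq> {..a}" "1 \<le> v" "v \<le> t" "d \<le> t"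
  shows "homology_in_degree TYPE('k::field) n (tail_family t v e A a)
     (card A + 2 * q + (if d = 0 then 0 else 1)) (if d = 0 \<or> v = d then 1 else 0)"
  using assms
proof (induction q arbitrary: a A)
  case 0
  have sub: "tail_family t v e A a \<subseteq> Pow {..<n}" using 0 by (intro tail_family_subset) auto
  have finA: "finite A" using 0 finite_subset by blast
  have "{..a} \<subseteq> {..<n}" using 0 by auto
  then have AN: "A \<subseteq> {..<n}" using 0 by blast
  consider "d = 0" | "0 < d" "v \<noteq> d" | "0 < d" "v = d" by linarith
  then show ?case
  proof cases
    case 1
    have "{a<..<e} = {}" "a \<in> A \<inter> {e - v..<e}" "\<not> (a < j \<and> j + t \<le> e)" for j
      using 0 1 by auto
    then have "tail_family t v e A a = {A}"
      unfolding tail_family_def by blast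
    then show ?thesis using homology_singleton[OF AN, where 'k='k] 0 1 by auto
  next
    case 2
    have "homology_in_degree TYPE('k) n (tail_family t v e A a) (card A + 1) 0"
    proof (rule homology_if_toggle[OF sub])
      show "a + 1 < n" using 0 2 by simp
      fix S assume S: "S \<in> tail_family t v e A a"
      have "insert (a + 1) S \<in> tail_family t v e A a"
        using 0 2 by (intro tail_family_insert[OF S]) auto
      moreover have "(S - {a + 1}) \<inter> {e - v..<e} \<noteq> {}"
      proof (cases "v < d")
        case True
        then show ?thesis using S 0 by (auto simp: tail_family_def disjoint_iff)
      next
        case False
        then have "a \<in> (S - {a + 1}) \<inter> {e - v..<e}" using S 0 2 by (auto simp: tail_family_def)
        then show ?thesis by blast
      qed
      moreover have "(S - {a + 1}) \<inter> {j..<j + t} \<noteq> {}" if "a < j" "j + t \<le> e" for j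
      proof -
        have "d = t" "j = a + 1" using that 0 by auto
        then have "{e - v..<e} \<subseteq> {j..<j + t}" using 0 2 by auto
        then show ?thesis using \<open>(S - {a + 1}) \<inter> {e - v..<e} \<noteq> {}\<close> by blast
      qed
      moreover have "a + 1 \<notin> A" using 0 by auto
      ultimately show "insert (a + 1) S \<in> tail_family t v e A a \<and> S - {a + 1} \<in> tail_family t v e A a"
        using tail_family_remove[OF S] by blast
    qed
    then show ?thesis using 2 by simp
  next
    case 3
    have e: "e = a + 1 + v" using 0 3 by simp
    have aA: "a + 1 \<notin> A" using 0 by auto
    have U: "{S \<in> tail_family t v e A a. a + 1 \<in> S \<and> S - {a + 1} \<notin> tail_family t v e A a} = {insert (a + 1) A}"
      (is "?U = _")
    proof (intro equalityI subsetI)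
      fix S assume S: "S \<in> ?U"
      have "(S - {a + 1}) \<inter> {e - v..<e} = {}"
      proof (rule ccontr)
        assume h: "\<not> ?thesis"
        have "{e - v..<e} \<subseteq> {j..<j + t}" if "a < j" "j + t \<le> e" for j using that e 0 3 by auto
        then have "S - {a + 1} \<in> tail_family t v e A a" using S h aA by (intro tail_family_remove) blast+
        then show False using S by simp
      qed
      then have "x \<notin> {a<..<e}" if "x \<in> S" "x \<noteq> a + 1" for x using that e by auto
      moreover have "A \<subseteq> S" "S \<subseteq> A \<union> {a<..<e}" "a + 1 \<in> S" using S tail_familyD by blast+
      ultimately have "S = insert (a + 1) A" by blast
      then show "S \<in> {insert (a + 1) A}" by simp
    next
      fix S assume S: "S \<in> {insert (a + 1) A}"
      have "insert (a + 1) A \<inter> {j..<j + t} \<noteq> {}" if "a < j" "j + t \<le> e" for j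
      proof -
        have "a + 1 \<in> {j..<j + t}" using that e 0 3 by auto
        then show ?thesis by blast
      qed
      moreover have "a + 1 \<in> {e - v..<e}" "a + 1 \<in> {a<..<e}" using e 0 by auto
      ultimately have "insert (a + 1) A \<in> tail_family t v e A a" by (intro tail_familyI) blast+
      moreover have "A \<inter> {e - v..<e} = {}" using e 0 by auto
      then have "A \<notin> tail_family t v e A a" using tail_familyD(3) by blast
      ultimately show "S \<in> ?U" using S aA by simp
    qed
    have "homology_in_degree TYPE('k) n (tail_family t v e A a) (card (insert (a + 1) A)) 1"
    proof (rule homology_toggle_step[OF sub interval_closed_tail_family])
      show "a + 1 < n" using 0 3 by simp
      show "insert (a + 1) S \<in> tail_family t v e A a" if "S \<in> tail_family t v e A a" for S
        using 0 3 by (intro tail_family_insert[OF that]) auto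
      show "homology_in_degree TYPE('k) n ?U (card (insert (a + 1) A)) 1"
        unfolding U using AN 0 3 by (intro homology_singleton) auto
    qed
    then show ?thesis using 3 finA aA by simp
  qed
next
  case (Suc q)
  let ?F = "tail_family t v e A a"
  let ?A = "A \<union> {a + 1, a + t + 1}"
  have sub: "?F \<subseteq> Pow {..<n}" using Suc.prems by (intro tail_family_subset) auto
  have finA: "finite A" using Suc.prems finite_subset by blast
  have e: "a + 1 + (t + 1) \<le> e" using Suc.prems(1) by simp
  have aA: "a + 1 \<notin> A" using Suc.prems(4) by auto
  have U: "{S \<in> ?F. a + 1 \<in> S \<and> S - {a + 1} \<notin> ?F} = tail_family t v e ?A (a + t + 1)" (is "?U = ?R")
  proof (intro equalityI subsetI)
    fix S assume S: "S \<in> ?U"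
    have SF: "S \<in> ?F" using S by blast
    have "a + 1 \<notin> {e - v..<e}" using e Suc.prems(5,6) by auto
    then have last: "(S - {a + 1}) \<inter> {e - v..<e} \<noteq> {}" using tail_familyD(3)[OF SF] by blast
    have "\<exists>j. a < j \<and> j + t \<le> e \<and> (S - {a + 1}) \<inter> {j..<j + t} = {}"
    proof (rule ccontr)
      assume "\<not> ?thesis"
      then have "S - {a + 1} \<in> ?F" using last aA by (intro tail_family_remove[OF SF]) blast+
      then show False using S by simp
    qed
    then obtain j where j: "a < j" "j + t \<le> e" "(S - {a + 1}) \<inter> {j..<j + t} = {}" by blast
    have "j = a + 1"
    proof (rule ccontr)
      assume "j \<noteq> a + 1"
      then have "(S - {a + 1}) \<inter> {j..<j + t} = S \<inter> {j..<j + t}" using j(1) by auto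
      then show False using j tail_familyD(4)[OF SF j(1,2)] by simp
    qed
    then have gap: "S \<inter> {a + 2..<a + t + 1} = {}" using j(3) by auto
    have "S \<inter> {a + 2..<a + 2 + t} \<noteq> {}" using e by (intro tail_familyD(4)[OF SF]) auto
    moreover have "{a + 2..<a + 2 + t} = {a + 2..<a + t + 1} \<union> {a + t + 1}" using Suc.prems(5,6) by auto
    ultimately have last: "a + t + 1 \<in> S" using gap by auto
    have rest: "x \<in> ?A \<union> {a + t + 1<..<e}" if "x \<in> S" for x
    proof (rule ccontr)
      assume "x \<notin> ?A \<union> {a + t + 1<..<e}"
      moreover have "x \<in> A \<union> {a<..<e}" using tail_familyD(2)[OF SF] that by blast
      ultimately have "x \<in> {a + 2..<a + t + 1}" by auto
      then show False using gap that by blast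
    qed
    show "S \<in> ?R"
    proof (rule tail_familyI)
      show "?A \<subseteq> S" using last S tail_familyD(1)[OF SF] by blast
      show "S \<subseteq> ?A \<union> {a + t + 1<..<e}" using rest by blast
      show "S \<inter> {e - v..<e} \<noteq> {}" using tail_familyD(3)[OF SF] .
      show "S \<inter> {j..<j + t} \<noteq> {}" if "a + t + 1 < j" "j + t \<le> e" for j
        using tail_familyD(4)[OF SF, of j] that by simp
    qed
  next
    fix S assume S: "S \<in> ?R"
    note SD = tail_familyD[OF S]
    have win: "S \<inter> {j..<j + t} \<noteq> {}" if aj: "a < j" "j + t \<le> e" for j
    proof -
      consider "j = a + 1" | "a + 1 < j" "j \<le> a + t + 1" | "a + t + 1 < j"
        using aj by linarith
      then show ?thesis
      proof cases
        case 1
        then have "a + 1 \<in> S \<inter> {j..<j + t}" using SD(1) Suc.prems(5,6) by auto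
        then show ?thesis by blast
      next
        case 2
        then have "a + t + 1 \<in> S \<inter> {j..<j + t}" using SD(1) by auto
        then show ?thesis by blast
      qed (use SD(4) that in simp)
    qed
    have "{a + t + 1<..<e} \<union> {a + 1, a + t + 1} \<subseteq> {a<..<e}" using e by auto
    then have "S \<in> ?F" using SD(1-3) win by (intro tail_familyI) blast+
    moreover have "a + 1 \<in> S" using SD(1) by simp
    moreover have "(A \<union> {a + t + 1} \<union> {a + t + 1<..<e}) \<inter> {a + 1..<a + 1 + t} = {}"
      using Suc.prems(4) by auto
    then have "(S - {a + 1}) \<inter> {a + 1..<a + 1 + t} = {}" using SD(2) by blast
    then have "S - {a + 1} \<notin> ?F" using e tail_familyD(4)[of _ t v e A a "a + 1"] by auto
    ultimately show "S \<in> ?U" by blast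
  qed
  have "a + 1 \<notin> A" "a + t + 1 \<notin> A" using Suc.prems by auto
  then have cA: "card ?A = card A + 2" using finA Suc.prems by simp
  have "homology_in_degree TYPE('k) n ?R (card ?A + 2 * q + (if d = 0 then 0 else 1)) (if d = 0 \<or> v = d then 1 else 0)"
    by (rule Suc.IH) (use Suc.prems in auto)
  then have "homology_in_degree TYPE('k) n ?R (card A + 2 * Suc q + (if d = 0 then 0 else 1)) (if d = 0 \<or> v = d then 1 else 0)"
    unfolding cA by (simp add: algebra_simps)
  then show ?case
  proof (intro homology_toggle_step[OF sub interval_closed_tail_family, of "a + 1"], unfold U)
    show "a + 1 < n" using e Suc.prems by simp
    show "insert (a + 1) S \<in> ?F" if "S \<in> ?F" for S
      using e by (intro tail_family_insert[OF that]) auto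
  qed
qed

definition hitting_sets :: "nat \<Rightarrow> nat \<Rightarrow> nat set set" where
  "hitting_sets n t = {S. S \<subseteq> {..<n} \<and> (\<forall>j<n. \<exists>k<t. (j + k) mod n \<in> S)}"

lemma interval_closed_hitting: "interval_closed (hitting_sets n t)"
  unfolding interval_closed_def hitting_sets_def by blast

text \<open>
  A window is either an interval or, if it wraps around, consists of the last \<open>u\<close> and the first \<open>t - u\<close>
  positions.
\<close>

lemma hitting_sets_linear:
  assumes "t \<le> n" "0 < n"
  shows "S \<in> hitting_sets n t \<longleftrightarrow> S \<subseteq> {..<n} \<and> (\<forall>j. j + t \<le> n \<longrightarrow> S \<inter> {j..<j + t} \<noteq> {})
     \<and> (\<forall>u. 0 < u \<and> u < t \<longrightarrow> S \<inter> ({n - u..<n} \<union> {..<t - u}) \<noteq> {})"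
proof -
  have win: "(\<exists>k<t. (j + k) mod n \<in> S) \<longleftrightarrow> (if j + t \<le> n then S \<inter> {j..<j + t} \<noteq> {}
       else S \<inter> ({j..<n} \<union> {..<t - (n - j)}) \<noteq> {})" if "j < n" for j
  proof -
    have "(\<lambda>k. (j + k) mod n) ` {..<t} = (if j + t \<le> n then {j..<j + t} else {j..<n} \<union> {..<t - (n - j)})"
      (is "_ = ?R")
    proof (intro equalityI subsetI)
      fix x assume "x \<in> (\<lambda>k. (j + k) mod n) ` {..<t}"
      then obtain k where k: "k < t" "x = (j + k) mod n" by auto
      show "x \<in> ?R"
      proof (cases "j + k < n")
        case True
        then show ?thesis using k by auto
      next
        case False
        then have "x = j + k - n" using k that assms by (simp add: mod_if)
        then show ?thesis using k False that by auto
      qed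
    next
      fix x assume x: "x \<in> ?R"
      show "x \<in> (\<lambda>k. (j + k) mod n) ` {..<t}"
      proof (cases "j \<le> x \<and> x < n")
        case True
        then have "x - j < t" using x that by (auto split: if_splits)
        then show ?thesis using True by (intro image_eqI[of _ _ "x - j"]) auto
      next
        case False
        then have "\<not> j + t \<le> n" "x < t - (n - j)" using x by (auto split: if_splits)
        then show ?thesis using that assms by (intro image_eqI[of _ _ "n - j + x"]) auto
      qed
    qed
    moreover have "(\<exists>k<t. (j + k) mod n \<in> S) \<longleftrightarrow> S \<inter> (\<lambda>k. (j + k) mod n) ` {..<t} \<noteq> {}" by auto
    ultimately show ?thesis by simp
  qed
  show ?thesis
  proof
    assume S: "S \<in> hitting_sets n t"
    have h: "\<exists>k<t. (j + k) mod n \<in> S" if "j < n" for j using S that by (auto simp: hitting_sets_def)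
    have "S \<inter> {j..<j + t} \<noteq> {}" if "j + t \<le> n" for j
    proof (cases "j < n")
      case True
      then show ?thesis using win[of j] h[of j] that by simp
    next
      case False
      then show ?thesis using h[of 0] assms that by auto
    qed
    moreover have "S \<inter> ({n - u..<n} \<union> {..<t - u}) \<noteq> {}" if "0 < u" "u < t" for u
      using win[of "n - u"] h[of "n - u"] that assms by (simp split: if_splits)
    ultimately show "S \<subseteq> {..<n} \<and> (\<forall>j. j + t \<le> n \<longrightarrow> S \<inter> {j..<j + t} \<noteq> {})
     \<and> (\<forall>u. 0 < u \<and> u < t \<longrightarrow> S \<inter> ({n - u..<n} \<union> {..<t - u}) \<noteq> {})"
      using S by (auto simp: hitting_sets_def)
  next
    assume S: "S \<subseteq> {..<n} \<and> (\<forall>j. j + t \<le> n \<longrightarrow> S \<inter> {j..<j + t} \<noteq> {})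
     \<and> (\<forall>u. 0 < u \<and> u < t \<longrightarrow> S \<inter> ({n - u..<n} \<union> {..<t - u}) \<noteq> {})"
    have "\<exists>k<t. (j + k) mod n \<in> S" if "j < n" for j
    proof (cases "j + t \<le> n")
      case True
      then show ?thesis using S win[OF that] by simp
    next
      case False
      then have "0 < n - j" "n - j < t" using that by auto
      then have "S \<inter> ({n - (n - j)..<n} \<union> {..<t - (n - j)}) \<noteq> {}" using S by blast
      moreover have "n - (n - j) = j" using that by simp
      ultimately show ?thesis using win[OF that] False by simp
    qed
    then show "S \<in> hitting_sets n t" using S by (auto simp: hitting_sets_def)
  qed
qed

text \<open>
  If \<open>0\<close> is indispensable, some window contains \<open>0\<close> as its only element of \<open>S\<close>.  Since the first element
  after \<open>0\<close> is \<open>v\<close>, such a window can only exist if the last \<open>t - v\<close> positions are empty.  The last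
  window without wrap-around must be met, hence \<open>S\<close> has an element among the \<open>v\<close> positions before these.
  Conversely, \<open>0\<close>, \<open>v\<close> and this element meet all windows that are not inside the tail, and \<open>0\<close> is
  indispensable for the window that consists of the last \<open>t - v\<close> and the first \<open>v\<close> positions.
\<close>

lemma gap_family_iff:
  assumes t: "2 \<le> t" "t < n" and v: "1 \<le> v" "v \<le> t"
  shows "(S \<in> hitting_sets n t \<and> 0 \<in> S \<and> S - {0} \<notin> hitting_sets n t \<and> v \<in> S \<and> S \<inter> {0<..<v} = {})
    \<longleftrightarrow> S \<in> tail_family t v (n - t + v) {0, v} v"
    (is "?L \<longleftrightarrow> ?R")
proof
  have n: "t \<le> n" "0 < n" using t by auto
  note lin = hitting_sets_linear[OF n]
  assume L: ?L
  have SL: "S \<subseteq> {..<n}" "\<And>j. j + t \<le> n \<Longrightarrow> S \<inter> {j..<j + t} \<noteq> {}"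
     "\<And>u. 0 < u \<Longrightarrow> u < t \<Longrightarrow> S \<inter> ({n - u..<n} \<union> {..<t - u}) \<noteq> {}"
    using L unfolding lin by blast+
  let ?T = "S - {0}"
  have "\<not> (?T \<subseteq> {..<n} \<and> (\<forall>j. j + t \<le> n \<longrightarrow> ?T \<inter> {j..<j + t} \<noteq> {})
     \<and> (\<forall>u. 0 < u \<and> u < t \<longrightarrow> ?T \<inter> ({n - u..<n} \<union> {..<t - u}) \<noteq> {}))"
    using L unfolding lin by blast
  then consider j where "j + t \<le> n" "?T \<inter> {j..<j + t} = {}"
    | u where "0 < u" "u < t" "?T \<inter> ({n - u..<n} \<union> {..<t - u}) = {}" using SL(1) by blast
  then obtain u where u: "u < t" "?T \<inter> ({n - u..<n} \<union> {..<t - u}) = {}"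
  proof cases
    case (1 j)
    have "j = 0"
    proof (rule ccontr)
      assume "j \<noteq> 0"
      then have "?T \<inter> {j..<j + t} = S \<inter> {j..<j + t}" by auto
      then show False using SL(2)[OF 1(1)] 1(2) by simp
    qed
    then show ?thesis using 1 t that[of 0] by (auto simp: lessThan_atLeast0)
  qed (use that in blast)
  have uv: "t \<le> u + v" using u L v by (auto simp: disjoint_iff)
  have "x < n - t + v" if "x \<in> S" for x
  proof (rule ccontr)
    assume "\<not> ?thesis"
    then have "x \<in> ?T \<inter> ({n - u..<n} \<union> {..<t - u})" using that SL(1) uv t v by auto
    then show False using u by blast
  qed
  moreover have "x = 0 \<or> x = v \<or> v < x" if "x \<in> S" for x
    using L that by (auto simp: disjoint_iff)
  ultimately have "S \<subseteq> {0, v} \<union> {v<..<n - t + v}" by fastforce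
  moreover have "S \<inter> {n - t + v - v..<n - t + v} \<noteq> {}"
  proof -
    have "S \<inter> {n - t..<n - t + t} \<noteq> {}" using SL(2)[of "n - t"] t by simp
    then show ?thesis using \<open>\<And>x. x \<in> S \<Longrightarrow> x < n - t + v\<close> by (auto simp: disjoint_iff)
  qed
  ultimately show ?R using L SL(2) v by (intro tail_familyI) auto
next
  have n: "t \<le> n" "0 < n" using t by auto
  note lin = hitting_sets_linear[OF n]
  assume ?R
  note R = tail_familyD[OF this]
  have S0: "0 \<in> S" "v \<in> S" using R(1) by auto
  have R3: "S \<inter> {n - t..<n - t + v} \<noteq> {}" using R(3) by simp
  have "S \<subseteq> {..<n}" using R(2) t v by fastforce
  moreover have "S \<inter> {j..<j + t} \<noteq> {}" if j: "j + t \<le> n" for j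
  proof -
    consider "j \<le> v" | "v < j" "j + t \<le> n - t + v" | "n - t + v < j + t" by linarith
    then show ?thesis
    proof cases
      case 1
      have "(if j = 0 then 0 else v) \<in> S \<inter> {j..<j + t}" using 1 S0 v by auto
      then show ?thesis by blast
    next
      case 2
      then show ?thesis using R(4) by blast
    next
      case 3
      then have "{n - t..<n - t + v} \<subseteq> {j..<j + t}" using j by auto
      then show ?thesis using R3 by blast
    qed
  qed
  moreover have "S \<inter> ({n - u..<n} \<union> {..<t - u}) \<noteq> {}" if "0 < u" "u < t" for u
    using S0 that by (auto simp: disjoint_iff)
  ultimately have "S \<in> hitting_sets n t" unfolding lin by blast
  moreover have "S - {0} \<notin> hitting_sets n t"
  proof
    assume "S - {0} \<in> hitting_sets n t"
    then have T: "\<And>j. j + t \<le> n \<Longrightarrow> (S - {0}) \<inter> {j..<j + t} \<noteq> {}"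
     "\<And>u. 0 < u \<Longrightarrow> u < t \<Longrightarrow> (S - {0}) \<inter> ({n - u..<n} \<union> {..<t - u}) \<noteq> {}"
      unfolding lin by blast+
    have sub: "S - {0} \<subseteq> {v..<n - t + v}" using R(2) t by auto
    show False
    proof (cases "v = t")
      case True
      then show False using T(1)[of 0] sub t by (auto simp: disjoint_iff)
    next
      case False
      then have "0 < t - v" "t - v < t" using v by auto
      moreover have "{v..<n - t + v} \<inter> ({n - (t - v)..<n} \<union> {..<t - (t - v)}) = {}" using v t by auto
      ultimately show False using T(2)[of "t - v"] sub by blast
    qed
  qed
  moreover have "S \<inter> {0<..<v} = {}" using R(2) by auto
  ultimately show ?L using S0 by blast
qed

text \<open>
  After toggling \<open>0\<close>, the remaining sets are filtered by the first element \<open>v\<close> after \<open>0\<close>.  Removing an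
  element can only increase \<open>v\<close>, so the sets with \<open>v \<ge> k\<close> form a subcomplex for every \<open>k\<close>, and the
  homology is built up from \<open>v = t\<close> downwards.
\<close>

lemma homology_hitting_sets:
  assumes n: "n = (t + 1) * p + d" and d: "d \<le> t" and t: "2 \<le> t" "t \<le> n"
  shows "homology_in_degree TYPE('k::field) n (hitting_sets n t)
     (2 * p + (if d = 0 then 0 else 1)) (if d = 0 then t else 1)"
proof -
  let ?C = "hitting_sets n t"
  let ?U = "{S \<in> ?C. 0 \<in> S \<and> S - {0} \<notin> ?C}"
  have C: "?C \<subseteq> Pow {..<n}" by (auto simp: hitting_sets_def)
  have n0: "0 < n" using t by simp
  have up: "insert 0 S \<in> ?C" if "S \<in> ?C" for S using that n0 unfolding hitting_sets_def by blast
  have "homology_in_degree TYPE('k) n ?U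
     (2 * p + (if d = 0 then 0 else 1)) (if d = 0 then t else 1)"
  proof (cases p)
    case 0
    then have nt: "n = t" "d = t" using n d t by auto
    have C': "S \<in> ?C \<longleftrightarrow> S \<subseteq> {..<n} \<and> S \<noteq> {}" for S
    proof -
      have "\<exists>k<n. (j + k) mod n = x" if "j < n" "x < n" for j x
        using that by (intro exI[of _ "(n - j + x) mod n"]) (simp add: mod_simps)
      then show ?thesis using n0 unfolding hitting_sets_def nt by blast
    qed
    have "?U = {{0}}" using n0 by (auto simp: C')
    then show ?thesis using homology_singleton[of "{0}" n, where 'k='k] n0 0 nt t by simp
  next
    case (Suc q)
    then have nt: "t < n" using n by simp
    \<comment> \<open>the subcomplex of sets whose first element after \<open>0\<close> is at least \<open>k\<close>\<close>
    let ?W = "\<lambda>k. {S \<in> ?U. S \<inter> {0<..<k} = {}}"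
    let ?g = "\<lambda>v. if d = 0 \<or> v = d then 1 else 0 :: nat"
    let ?i = "2 * p + (if d = 0 then 0 else 1)"
    have W: "homology_in_degree TYPE('k) n (?W (t + 1 - m)) ?i (\<Sum>v\<in>{t - m<..t}. ?g v)"
      if "m \<le> t" for m
      using that
    proof (induction m)
      case 0
      have W0: "?W (t + 1) = {}"
      proof (rule ccontr)
        assume "?W (t + 1) \<noteq> {}"
        then obtain S where S: "S \<in> ?C" "S \<inter> {0<..<t + 1} = {}" by blast
        then have "S \<inter> {1..<1 + t} = {}" by auto
        have "\<forall>j. j + t \<le> n \<longrightarrow> S \<inter> {j..<j + t} \<noteq> {}"
          using S(1) hitting_sets_linear[OF t(2) n0, of S] by blast
        moreover have "1 + t \<le> n" using nt by simp
        ultimately have "S \<inter> {1..<1 + t} \<noteq> {}" by blast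
        then show False using \<open>S \<inter> {1..<1 + t} = {}\<close> by blast
      qed
      have "homology_in_degree TYPE('k) n {} ?i 0"
        by (rule homology_if_toggle[OF _ n0]) auto
      then show ?case unfolding diff_zero W0 by simp
    next
      case (Suc m)
      define v where "v = t - m"
      have v: "1 \<le> v" "v \<le> t" "t + 1 - Suc m = v" "t + 1 - m = v + 1" "t - Suc m = v - 1" "t - m = v"
        using Suc.prems by (auto simp: v_def)
      let ?Q = "{S \<in> ?W v. v \<in> S}"
      have Q: "?Q = tail_family t v (n - t + v) {0, v} v"
        using gap_family_iff[OF t(1) nt v(1,2)] by blast
      have "homology_in_degree TYPE('k) n (tail_family t v (n - t + v) {0, v} v)
          (card {0, v} + 2 * q + (if d = 0 then 0 else 1)) (?g v)"
        by (rule homology_tail_family) (use n d v nt \<open>p = Suc q\<close> in auto)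
      moreover have "card {0, v} + 2 * q + (if d = 0 then 0 else 1) = ?i" using v(1) \<open>p = Suc q\<close> by simp
      ultimately have HQ: "homology_in_degree TYPE('k) n ?Q ?i (?g v)" unfolding Q by simp
      have s: "(\<Sum>v\<in>{v - 1<..t}. ?g v) = (\<Sum>v\<in>{v<..t}. ?g v) + ?g v"
      proof -
        have "{v - 1<..t} = insert v {v<..t}" using v by auto
        then show ?thesis by (simp add: add.commute)
      qed
      have IH: "homology_in_degree TYPE('k) n (?W (v + 1)) ?i (\<Sum>v\<in>{v<..t}. ?g v)"
        using Suc.IH Suc.prems unfolding v by simp
      show ?case
        unfolding v s
      proof (rule homology_of_filtration_step[OF _ _ _ _ _ IH HQ])
        show "?W v \<subseteq> Pow {..<n}" using C by blast
        show "interval_closed (?W v)"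
          unfolding interval_closed_def
        proof (intro ballI allI impI)
          fix S T R assume h: "S \<in> ?W v" "T \<in> ?W v" "S \<subseteq> R \<and> R \<subseteq> T"
          have "R \<in> ?C" using interval_closedD[OF interval_closed_hitting, of S n t T R] h by blast
          moreover have "R - {0} \<notin> ?C"
          proof
            assume "R - {0} \<in> ?C"
            then have "T - {0} \<in> ?C"
              using interval_closedD[OF interval_closed_hitting, of "R - {0}" n t T "T - {0}"] h by blast
            then show False using h by blast
          qed
          ultimately show "R \<in> ?W v" using h by blast
        qed
        have "{0<..<v + 1} = insert v {0<..<v}" using v by auto
        then have "S \<inter> {0<..<v + 1} = {} \<longleftrightarrow> v \<notin> S \<and> S \<inter> {0<..<v} = {}" for S by simp
        then show "?W v = ?W (v + 1) \<union> ?Q" by (simp only:) blast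
        show "?W (v + 1) \<inter> ?Q = {}" using v(1) by auto
        show "insert s T \<notin> ?W (v + 1)" if "T \<in> ?Q" "s < n" for T s
          using that v(1) by auto
      qed
    qed
    have "(\<Sum>v\<in>{0<..t}. ?g v) = (if d = 0 then t else 1)" using d by auto
    moreover have "?W 1 = ?U" by auto
    ultimately show ?thesis using W[of t] by simp
  qed
  from homology_toggle_step[OF C interval_closed_hitting n0 up this] show ?thesis .
qed

section \<open>Finite systems of linear equations\<close>

text \<open>
  Gaussian elimination of one unknown with the help of one equation.
\<close>

lemma nontrivial_solution:
  fixes M :: "'b \<Rightarrow> 'a \<Rightarrow> 'k::field"
  assumes "finite B" "finite A" "card B < card A"
  shows "\<exists>a. (\<exists>x\<in>A. a x \<noteq> 0) \<and> (\<forall>b\<in>B. (\<Sum>x\<in>A. M b x * a x) = 0)"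
  using assms
proof (induction B arbitrary: A M rule: finite_induct)
  case empty
  then obtain x where "x \<in> A" by fastforce
  then show ?case by (intro exI[of _ "\<lambda>_. 1"]) auto
next
  case (insert b B)
  show ?case
  proof (cases "\<forall>x\<in>A. M b x = 0")
    case True
    have "card B < card A" using insert by simp
    then obtain a where "\<exists>x\<in>A. a x \<noteq> 0" "\<forall>b\<in>B. (\<Sum>x\<in>A. M b x * a x) = 0"
      using insert.IH[OF insert.prems(1)] by blast
    then show ?thesis using True by (intro exI[of _ a]) auto
  next
    case False
    then obtain x0 where x0: "x0 \<in> A" "M b x0 \<noteq> 0" by blast
    define M' where "M' c x = M c x - M c x0 * (M b x / M b x0)" for c x
    have "card B < card (A - {x0})" using insert x0 by simp
    then obtain a where a: "\<exists>x\<in>A - {x0}. a x \<noteq> 0" "\<And>c. c \<in> B \<Longrightarrow> (\<Sum>x\<in>A - {x0}. M' c x * a x) = 0"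
      using insert.IH[of "A - {x0}" M'] insert.prems by auto
    define r where "r = (\<Sum>x\<in>A - {x0}. M b x / M b x0 * a x)"
    define a' where "a' x = (if x = x0 then - r else a x)" for x
    have split: "(\<Sum>x\<in>A. M c x * a' x) = (\<Sum>x\<in>A - {x0}. M c x * a x) - M c x0 * r" for c
      using x0 insert.prems(1) by (simp add: sum.remove a'_def)
    have "(\<Sum>x\<in>A. M c x * a' x) = 0" if "c \<in> insert b B" for c
    proof (cases "c = b")
      case True
      have "M b x0 * r = (\<Sum>x\<in>A - {x0}. M b x * a x)"
        unfolding r_def sum_distrib_left using x0 by simp
      then show ?thesis using split[of b] True by simp
    next
      case False
      then have "0 = (\<Sum>x\<in>A - {x0}. M' c x * a x)" using a(2) that by simp
      also have "\<dots> = (\<Sum>x\<in>A - {x0}. M c x * a x) - M c x0 * r"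
        unfolding r_def M'_def sum_distrib_left by (simp add: algebra_simps sum_subtractf)
      finally show ?thesis using split[of c] by simp
    qed
    moreover have "\<exists>x\<in>A. a' x \<noteq> 0" using a(1) by (auto simp: a'_def)
    ultimately show ?thesis by blast
  qed
qed

text \<open>
  Induction on the number of coordinates: one vector with nonzero coordinate \<open>b\<close> reduces the others to
  the subspace where this coordinate vanishes.
\<close>

lemma subspace_finitely_generated:
  fixes V :: "('b \<Rightarrow> 'k::field) set"
  assumes "finite B" "\<And>u x. u \<in> V \<Longrightarrow> u x \<noteq> 0 \<Longrightarrow> x \<in> B"
    and "\<And>u v c. u \<in> V \<Longrightarrow> v \<in> V \<Longrightarrow> (\<lambda>x. u x - c * v x) \<in> V"
  shows "\<exists>U. finite U \<and> U \<subseteq> V \<and> (\<forall>v\<in>V. \<exists>a. \<forall>x. v x = (\<Sum>u\<in>U. a u * u x))"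
  using assms
proof (induction B arbitrary: V rule: finite_induct)
  case empty
  then have "v x = 0" if "v \<in> V" for v x using that by auto
  then show ?case by (intro exI[of _ "{}"]) auto
next
  case (insert b B)
  let ?V = "{v \<in> V. v b = 0}"
  have "\<exists>U. finite U \<and> U \<subseteq> ?V \<and> (\<forall>v\<in>?V. \<exists>a. \<forall>x. v x = (\<Sum>u\<in>U. a u * u x))"
  proof (rule insert.IH)
    show "x \<in> B" if "u \<in> ?V" "u x \<noteq> 0" for u x using insert.prems(1)[of u x] that by auto
    show "(\<lambda>x. u x - c * v x) \<in> ?V" if "u \<in> ?V" "v \<in> ?V" for u v c
      using insert.prems(2)[of u v c] that by simp
  qed
  then obtain U where U': "finite U \<and> U \<subseteq> ?V \<and> (\<forall>v\<in>?V. \<exists>a. \<forall>x. v x = (\<Sum>u\<in>U. a u * u x))" ..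
  note U = conjunct1[OF U'] conjunct1[OF conjunct2[OF U']] bspec[OF conjunct2[OF conjunct2[OF U']]]
  show ?case
  proof (cases "V = ?V")
    case True
    show ?thesis
    proof (intro exI[of _ U] conjI ballI)
      show "finite U" "U \<subseteq> V" using U(1,2) by auto
      show "\<exists>a. \<forall>x. v x = (\<Sum>u\<in>U. a u * u x)" if "v \<in> V" for v
      proof (rule U(3))
        show "v \<in> ?V" using subsetD[OF equalityD1[OF True] that] .
      qed
    qed
  next
    case False
    then obtain u where u: "u \<in> V" "u b \<noteq> 0" by blast
    have "\<exists>a. \<forall>x. v x = (\<Sum>u\<in>insert u U. a u * u x)" if v: "v \<in> V" for v
    proof -
      have "(\<lambda>x. v x - v b / u b * u x) \<in> ?V" using insert.prems(2)[OF v u(1), of "v b / u b"] u by simp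
      then obtain a where a: "\<And>x. v x - v b / u b * u x = (\<Sum>u\<in>U. a u * u x)"
        using U(3) by blast
      have "u \<notin> U" using U(2) u by blast
      then have "(\<Sum>w\<in>insert u U. (a(u := v b / u b)) w * w x) = v b / u b * u x + (\<Sum>w\<in>U. a w * w x)" for x
        using U(1) by (auto intro!: sum.cong simp: sum.insert)
      then have "v x = (\<Sum>w\<in>insert u U. (a(u := v b / u b)) w * w x)" for x
        unfolding a[symmetric] by simp
      then show ?thesis by blast
    qed
    then show ?thesis using U(1,2) u(1) by (intro exI[of _ "insert u U"]) auto
  qed
qed

section \<open>Homology of a complex from a minimal model\<close>

text \<open>
  The index set \<open>J\<close> is the basis of a complex with zero differential, \<open>\<phi>\<close> and \<open>w\<close> are chain maps to
  the complex of \<open>C\<close> and back with \<open>w \<phi> = 1\<close>, and \<open>\<phi> w\<close> is homotopic to the identity on cycles.  Both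
  inequalities follow by counting equations: if there were fewer elements in \<open>J\<close> than basis cycles, some
  nontrivial combination of basis cycles would be killed by \<open>w\<close> and hence be a boundary; if there were
  more, some nontrivial combination of the \<open>\<phi> c\<close> would be a boundary and hence be killed by \<open>w\<close>.
\<close>

lemma retract_dimension:
  fixes \<phi> w :: "'j \<Rightarrow> nat set \<Rightarrow> 'k::field"
  assumes J: "finite J" and X: "finite X" "X \<subseteq> C"
    and phi: "\<And>c. c \<in> J \<Longrightarrow> chain_on C i (\<phi> c)" "\<And>c. c \<in> J \<Longrightarrow> cycle_on N C (\<phi> c)"
    and w_bd: "\<And>y c. chain_on C (Suc i) y \<Longrightarrow> c \<in> J \<Longrightarrow> (\<Sum>S\<in>X. w c S * boundary N y S) = 0"
    and w_phi: "\<And>c c'. c \<in> J \<Longrightarrow> c' \<in> J \<Longrightarrow> (\<Sum>S\<in>X. w c S * \<phi> c' S) = (if c = c' then 1 else 0)"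
    and phi_w: "\<And>z. chain_on C i z \<Longrightarrow> cycle_on N C z \<Longrightarrow>
      \<exists>y. chain_on C (Suc i) y \<and> (\<forall>S\<in>C. (\<Sum>c\<in>J. (\<Sum>S'\<in>X. w c S' * z S') * \<phi> c S) = z S + boundary N y S)"
  shows "exact_at TYPE('k) N C i \<Longrightarrow> card J = 0" and "homology_basis N C i m (z :: nat \<Rightarrow> nat set \<Rightarrow> 'k) \<Longrightarrow> card J = m"
proof -
  have main: "card J = m" if B: "homology_basis N C i m z" for m and z :: "nat \<Rightarrow> nat set \<Rightarrow> 'k"
  proof (rule antisym)
    have zc: "chain_on C i (z k)" "cycle_on N C (z k)" if "k < m" for k
      using B that by (simp_all add: homology_basis_def)
    show "m \<le> card J"
    proof (rule ccontr)
      assume "\<not> m \<le> card J"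
      then have "card J < card {..<m}" by simp
      then obtain b where b: "\<exists>k\<in>{..<m}. b k \<noteq> 0"
        "\<forall>c\<in>J. (\<Sum>k\<in>{..<m}. (\<Sum>S\<in>X. w c S * z k S) * b k) = 0"
        using nontrivial_solution[OF J finite_lessThan, of m "\<lambda>c k. \<Sum>S\<in>X. w c S * z k S"] by blast
      let ?z = "\<lambda>S. \<Sum>k<m. b k * z k S"
      have ch: "chain_on C i ?z" using zc by (intro chain_on_sum chain_on_scale) auto
      have cy: "cycle_on N C ?z" using zc(2) by (simp add: cycle_on_def boundary_sum boundary_scale)
      obtain y where y: "chain_on C (Suc i) y"
        "\<And>S. S \<in> C \<Longrightarrow> (\<Sum>c\<in>J. (\<Sum>S'\<in>X. w c S' * ?z S') * \<phi> c S) = ?z S + boundary N y S"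
        using phi_w[OF ch cy] by blast
      have "(\<Sum>S'\<in>X. w c S' * ?z S') = 0" if "c \<in> J" for c
      proof -
        have "(\<Sum>S'\<in>X. w c S' * ?z S') = (\<Sum>S'\<in>X. \<Sum>k<m. w c S' * z k S' * b k)"
          by (simp add: sum_distrib_left mult.commute mult.left_commute)
        also have "\<dots> = (\<Sum>k<m. \<Sum>S'\<in>X. w c S' * z k S' * b k)" by (rule sum.swap)
        also have "\<dots> = 0" using b(2) that by (simp add: sum_distrib_right)
        finally show ?thesis .
      qed
      then have "0 = ?z S + boundary N y S" if "S \<in> C" for S using y(2)[OF that] by simp
      then have "?z S = - boundary N y S" if "S \<in> C" for S using that by (simp add: eq_neg_iff_add_eq_0)
      then have "?z S = boundary N (\<lambda>S. (-1) * y S) S" if "S \<in> C" for S using that unfolding boundary_scale by simp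
      then have "b k = 0" if "k < m" for k
        using homology_basis_independent[OF B chain_on_scale[OF y(1), of "-1"], of b k] that by blast
      then show False using b(1) by auto
    qed
    show "card J \<le> m"
    proof (rule ccontr)
      assume "\<not> card J \<le> m"
      then have lt: "card {..<m} < card J" by simp
      have "\<exists>x y. chain_on C (Suc i) y \<and> (\<forall>S\<in>C. \<phi> c S = (\<Sum>k<m. x k * z k S) + boundary N y S)" if "c \<in> J" for c
        using B phi[OF that] unfolding homology_basis_def by blast
      then obtain x y where xy: "\<And>c. c \<in> J \<Longrightarrow> chain_on C (Suc i) (y c)"
        "\<And>c S. c \<in> J \<Longrightarrow> S \<in> C \<Longrightarrow> \<phi> c S = (\<Sum>k<m. x c k * z k S) + boundary N (y c) S"
        by metis
      obtain a where a: "\<exists>c\<in>J. a c \<noteq> 0" "\<forall>k\<in>{..<m}. (\<Sum>c\<in>J. x c k * a c) = 0"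
        using nontrivial_solution[OF finite_lessThan J lt, of "\<lambda>k c. x c k"] by blast
      have comb: "(\<Sum>c\<in>J. a c * \<phi> c S) = boundary N (\<lambda>S. \<Sum>c\<in>J. a c * y c S) S" if S: "S \<in> C" for S
      proof -
        have "(\<Sum>c\<in>J. a c * \<phi> c S) = (\<Sum>c\<in>J. \<Sum>k<m. x c k * a c * z k S) + (\<Sum>c\<in>J. a c * boundary N (y c) S)"
          using xy(2)[OF _ S] by (simp add: distrib_left sum.distrib sum_distrib_left mult.commute mult.left_commute)
        also have "(\<Sum>c\<in>J. \<Sum>k<m. x c k * a c * z k S) = (\<Sum>k<m. \<Sum>c\<in>J. x c k * a c * z k S)" by (rule sum.swap)
        also have "\<dots> = 0" using a(2) by (simp flip: sum_distrib_right)
        finally show ?thesis by (simp add: boundary_sum boundary_scale)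
      qed
      have "a c = 0" if c: "c \<in> J" for c
      proof -
        have "(\<Sum>S\<in>X. w c S * (\<Sum>c'\<in>J. a c' * \<phi> c' S)) = (\<Sum>S\<in>X. \<Sum>c'\<in>J. a c' * (w c S * \<phi> c' S))"
          by (simp add: sum_distrib_left mult.left_commute)
        also have "\<dots> = (\<Sum>c'\<in>J. \<Sum>S\<in>X. a c' * (w c S * \<phi> c' S))" by (rule sum.swap)
        also have "\<dots> = (\<Sum>c'\<in>J. a c' * (if c = c' then 1 else 0))"
          using w_phi[OF c] by (simp flip: sum_distrib_left)
        also have "\<dots> = (\<Sum>c'\<in>J. if c' = c then a c' else 0)" by (rule sum.cong) auto
        also have "\<dots> = a c" using J c by simp
        finally have "a c = (\<Sum>S\<in>X. w c S * boundary N (\<lambda>S. \<Sum>c\<in>J. a c * y c S) S)"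
          using comb X(2) by (simp add: subset_iff)
        also have "\<dots> = 0" using c xy(1) by (intro w_bd chain_on_sum chain_on_scale) auto
        finally show ?thesis .
      qed
      then show False using a(1) by blast
    qed
  qed
  then show "homology_basis N C i m z \<Longrightarrow> card J = m" by blast
  show "exact_at TYPE('k) N C i \<Longrightarrow> card J = 0" using main[of 0] homology_basis_0 by blast
qed

section \<open>Polynomials and homogeneous components\<close>

lemma poly_ring_0: "0 \<in> poly_ring n"
  and poly_ring_1: "1 \<in> poly_ring n"
  by (simp_all add: poly_ring_def)

lemma poly_ring_add: "f \<in> poly_ring n \<Longrightarrow> g \<in> poly_ring n \<Longrightarrow> f + g \<in> poly_ring n"
  using Poly_Mapping.keys_add[of f g] by (auto simp: poly_ring_def)

lemma keys_uminus: "Poly_Mapping.keys (- f) = Poly_Mapping.keys (f :: 'a \<Rightarrow>\<^sub>0 'b::ab_group_add)"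
  by (auto simp: in_keys_iff)

lemma poly_ring_uminus: "f \<in> poly_ring n \<Longrightarrow> - f \<in> poly_ring n"
  by (simp add: poly_ring_def keys_uminus)

lemma poly_ring_diff: "f \<in> poly_ring n \<Longrightarrow> g \<in> poly_ring n \<Longrightarrow> f - g \<in> poly_ring n"
  using poly_ring_add[of f n "- g"] poly_ring_uminus[of g n] by simp

lemma keys_plus_exponent: "Poly_Mapping.keys (a + b) = Poly_Mapping.keys a \<union> Poly_Mapping.keys (b :: nat \<Rightarrow>\<^sub>0 nat)"
  by (auto simp: in_keys_iff lookup_add)

lemma poly_ring_mult:
  assumes "f \<in> poly_ring n" "g \<in> poly_ring n"
  shows "f * g \<in> poly_ring n"
  unfolding poly_ring_def
proof safe
  fix m x assume "m \<in> Poly_Mapping.keys (f * g)" "x \<in> Poly_Mapping.keys m"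
  then obtain a b where "m = a + b" "a \<in> Poly_Mapping.keys f" "b \<in> Poly_Mapping.keys g"
    using Poly_Mapping.keys_mult[of f g] by blast
  then show "x \<in> {1..n}" using assms \<open>x \<in> Poly_Mapping.keys m\<close>
    by (auto simp: poly_ring_def keys_plus_exponent simp del: atLeastAtMost_iff)
qed

lemma poly_ring_sum: "(\<And>i. i \<in> I \<Longrightarrow> f i \<in> poly_ring n) \<Longrightarrow> sum f I \<in> poly_ring n"
  by (induction I rule: infinite_finite_induct) (auto simp: poly_ring_0 poly_ring_add)

lemma poly_ring_single: "Poly_Mapping.keys m \<subseteq> {1..n} \<Longrightarrow> Poly_Mapping.single m c \<in> poly_ring n"
  by (simp add: poly_ring_def)

lemma poly_mapping_sum_singles:
  "f = (\<Sum>m\<in>Poly_Mapping.keys f. Poly_Mapping.single m (Poly_Mapping.lookup f m))"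
proof (rule poly_mapping_eqI)
  fix k
  show "Poly_Mapping.lookup f k = Poly_Mapping.lookup (\<Sum>m\<in>Poly_Mapping.keys f. Poly_Mapping.single m (Poly_Mapping.lookup f m)) k"
    by (simp add: lookup_sum lookup_single when_def sum.delta in_keys_iff)
qed

lemma lookup_single_mult:
  fixes f :: "'k::field mpoly"
  shows "Poly_Mapping.lookup (Poly_Mapping.single a c * f) k =
    (\<Sum>m\<in>Poly_Mapping.keys f. if a + m = k then c * Poly_Mapping.lookup f m else 0)"
proof -
  have "Poly_Mapping.single a c * f = (\<Sum>m\<in>Poly_Mapping.keys f. Poly_Mapping.single (a + m) (c * Poly_Mapping.lookup f m))"
    by (subst poly_mapping_sum_singles[of f]) (simp add: sum_distrib_left mult_single)
  then show ?thesis by (simp add: lookup_sum lookup_single when_def)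
qed

lemma lookup_single_mult_add:
  fixes f :: "'k::field mpoly"
  shows "Poly_Mapping.lookup (Poly_Mapping.single a c * f) (a + k) = c * Poly_Mapping.lookup f k"
  by (simp add: lookup_single_mult sum.delta in_keys_iff)

lemma lookup_single_mult_0:
  fixes f :: "'k::field mpoly"
  assumes "\<And>m. k \<noteq> a + m"
  shows "Poly_Mapping.lookup (Poly_Mapping.single a c * f) k = 0"
  unfolding lookup_single_mult using assms by (intro sum.neutral) metis

lemma lookup_mult_0:
  fixes f g :: "'k::field mpoly"
  shows "Poly_Mapping.lookup (f * g) 0 = Poly_Mapping.lookup f 0 * Poly_Mapping.lookup g 0"
proof -
  have z: "a + m = 0 \<longleftrightarrow> a = 0 \<and> m = 0" for a m :: "nat \<Rightarrow>\<^sub>0 nat"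
    by (auto simp: poly_mapping_eq_iff lookup_add fun_eq_iff)
  have s: "Poly_Mapping.lookup (Poly_Mapping.single a c * g) 0 = (if a = 0 then c * Poly_Mapping.lookup g 0 else 0)" for a c
    by (simp add: lookup_single_mult z sum.delta in_keys_iff)
  have "f * g = (\<Sum>m\<in>Poly_Mapping.keys f. Poly_Mapping.single m (Poly_Mapping.lookup f m) * g)"
    by (subst poly_mapping_sum_singles[of f]) (simp add: sum_distrib_right)
  then show ?thesis by (simp add: lookup_sum s sum.delta in_keys_iff)
qed

lemma mon_degree_add: "mon_degree (a + b) = mon_degree a + mon_degree b"
proof -
  let ?K = "Poly_Mapping.keys a \<union> Poly_Mapping.keys b"
  have "mon_degree a = (\<Sum>i\<in>?K. Poly_Mapping.lookup a i)" "mon_degree b = (\<Sum>i\<in>?K. Poly_Mapping.lookup b i)"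
    unfolding mon_degree_def by (intro sum.mono_neutral_left; auto simp: in_keys_iff)+
  then show ?thesis
    unfolding mon_degree_def keys_plus_exponent by (simp add: lookup_add sum.distrib)
qed

lemma mon_degree_0: "mon_degree 0 = 0" by (simp add: mon_degree_def)

text \<open>
  An entry of a graded matrix from a generator of degree \<open>e\<close> to a generator of degree \<open>s\<close>.
\<close>

definition homogeneous :: "nat \<Rightarrow> nat \<Rightarrow> 'k::field mpoly \<Rightarrow> bool" where
  "homogeneous s e f \<longleftrightarrow> (\<forall>m\<in>Poly_Mapping.keys f. mon_degree m + s = e)"

lemma homogeneous_0: "homogeneous s e 0" by (simp add: homogeneous_def)

lemma homogeneous_1: "homogeneous s s 1" by (simp add: homogeneous_def mon_degree_0)

lemma homogeneous_add: "homogeneous s e f \<Longrightarrow> homogeneous s e g \<Longrightarrow> homogeneous s e (f + g)"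
  using Poly_Mapping.keys_add[of f g] unfolding homogeneous_def by blast

lemma homogeneous_diff: "homogeneous s e f \<Longrightarrow> homogeneous s e g \<Longrightarrow> homogeneous s e (f - g)"
  using homogeneous_add[of s e f "- g"] by (simp add: homogeneous_def keys_uminus)

lemma homogeneous_sum: "(\<And>i. i \<in> I \<Longrightarrow> homogeneous s e (f i)) \<Longrightarrow> homogeneous s e (sum f I)"
  by (induction I rule: infinite_finite_induct) (auto simp: homogeneous_0 homogeneous_add)

lemma homogeneous_mult:
  assumes "homogeneous s e f" "homogeneous e u g"
  shows "homogeneous s u (f * g)"
  unfolding homogeneous_def
proof
  fix m assume "m \<in> Poly_Mapping.keys (f * g)"
  then obtain a b where "m = a + b" "a \<in> Poly_Mapping.keys f" "b \<in> Poly_Mapping.keys g"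
    using Poly_Mapping.keys_mult[of f g] by blast
  then show "mon_degree m + s = u" using assms by (auto simp: homogeneous_def mon_degree_add)
qed

lift_definition homogeneous_part :: "nat \<Rightarrow> nat \<Rightarrow> 'k::field mpoly \<Rightarrow> 'k mpoly" is
  "\<lambda>s e f m. if mon_degree m + s = e then f m else 0"
  by (rule finite_subset[rotated]) auto

lemma lookup_homogeneous_part: "Poly_Mapping.lookup (homogeneous_part s e f) m = (if mon_degree m + s = e then Poly_Mapping.lookup f m else 0)"
  by transfer rule

lemma homogeneous_homogeneous_part: "homogeneous s e (homogeneous_part s e f)"
  by (auto simp: homogeneous_def in_keys_iff lookup_homogeneous_part split: if_splits)

lemma homogeneous_part_poly_ring: "f \<in> poly_ring n \<Longrightarrow> homogeneous_part s e f \<in> poly_ring n"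
  by (auto simp: poly_ring_def in_keys_iff lookup_homogeneous_part split: if_splits)

lemma homogeneous_part_sum: "homogeneous_part s e (sum f I) = (\<Sum>i\<in>I. homogeneous_part s e (f i))"
  by (rule poly_mapping_eqI) (simp add: lookup_sum lookup_homogeneous_part)

lemma homogeneous_part_id: "homogeneous s e f \<Longrightarrow> homogeneous_part s e f = f"
  by (rule poly_mapping_eqI) (auto simp: lookup_homogeneous_part homogeneous_def in_keys_iff)

text \<open>
  The terms of \<open>g\<close> outside the right degree contribute only terms of wrong degree to \<open>f * g\<close>.
\<close>

lemma homogeneous_part_mult:
  assumes "homogeneous s e f"
  shows "homogeneous_part s u (f * g) = f * homogeneous_part e u g"
proof -
  let ?r = "g - homogeneous_part e u g"
  have "homogeneous_part s u (f * ?r) = 0"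
  proof (rule poly_mapping_eqI)
    fix m
    have "Poly_Mapping.lookup (f * ?r) m = 0" if d: "mon_degree m + s = u"
    proof (rule ccontr)
      assume "\<not> ?thesis"
      then have "m \<in> Poly_Mapping.keys (f * ?r)" by (simp add: in_keys_iff)
      then obtain a b where m: "m = a + b" "a \<in> Poly_Mapping.keys f" "b \<in> Poly_Mapping.keys ?r"
        using Poly_Mapping.keys_mult[of f ?r] by blast
      then have "mon_degree b + e \<noteq> u" by (auto simp: in_keys_iff lookup_minus lookup_homogeneous_part split: if_splits)
      moreover have "mon_degree a + s = e" using m assms by (auto simp: homogeneous_def)
      ultimately show False using d m by (auto simp: mon_degree_add)
    qed
    then show "Poly_Mapping.lookup (homogeneous_part s u (f * ?r)) m = Poly_Mapping.lookup 0 m" by (simp add: lookup_homogeneous_part)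
  qed
  moreover have "homogeneous_part s u (f * g) = homogeneous_part s u (f * homogeneous_part e u g) + homogeneous_part s u (f * ?r)"
    by (rule poly_mapping_eqI) (simp add: lookup_add lookup_homogeneous_part algebra_simps lookup_minus)
  moreover have "homogeneous_part s u (f * homogeneous_part e u g) = f * homogeneous_part e u g"
    by (intro homogeneous_part_id homogeneous_mult[OF assms] homogeneous_homogeneous_part)
  ultimately show ?thesis by simp
qed

section \<open>Comparison of graded free resolutions\<close>

lemma graded_maps_iff:
  "A \<in> graded_maps n ds es \<longleftrightarrow> A \<in> carrier_mat (length ds) (length es) \<and>
     (\<forall>r<length ds. \<forall>c<length es. A $$ (r, c) \<in> poly_ring n \<and> homogeneous (ds ! r) (es ! c) (A $$ (r, c)))"
  by (auto simp: graded_maps_def homogeneous_def)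

lemma graded_maps_carrier: "A \<in> graded_maps n ds es \<Longrightarrow> A \<in> carrier_mat (length ds) (length es)"
  by (simp add: graded_maps_iff)

lemma mult_entry:
  assumes "A \<in> carrier_mat nr m" "B \<in> carrier_mat m nc" "r < nr" "c < nc"
  shows "(A * B) $$ (r, c) = (\<Sum>k<m. A $$ (r, k) * B $$ (k, c))"
  using assms by (auto simp: scalar_prod_def lessThan_atLeast0)

lemma mult_vec_entry:
  assumes "A \<in> carrier_mat nr m" "v \<in> carrier_vec m" "r < nr"
  shows "(A *\<^sub>v v) $ r = (\<Sum>k<m. A $$ (r, k) * v $ k)"
  using assms by (auto simp: scalar_prod_def lessThan_atLeast0)

lemma graded_maps_mult:
  assumes "A \<in> graded_maps n ds es" "B \<in> graded_maps n es us"
  shows "A * B \<in> graded_maps n ds us"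
  unfolding graded_maps_iff
proof (intro conjI allI impI)
  note A = graded_maps_carrier[OF assms(1)] and B = graded_maps_carrier[OF assms(2)]
  show "A * B \<in> carrier_mat (length ds) (length us)" using A B by simp
  fix r c assume rc: "r < length ds" "c < length us"
  show "(A * B) $$ (r, c) \<in> poly_ring n"
    unfolding mult_entry[OF A B rc]
    using assms rc by (intro poly_ring_sum poly_ring_mult) (auto simp: graded_maps_iff)
  show "homogeneous (ds ! r) (us ! c) ((A * B) $$ (r, c))"
    unfolding mult_entry[OF A B rc]
  proof (rule homogeneous_sum)
    fix k assume "k \<in> {..<length es}"
    then show "homogeneous (ds ! r) (us ! c) (A $$ (r, k) * B $$ (k, c))"
      using assms rc by (intro homogeneous_mult[of _ "es ! k"]) (auto simp: graded_maps_iff)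
  qed
qed

lemma graded_maps_diff:
  assumes "A \<in> graded_maps n ds es" "B \<in> graded_maps n ds es"
  shows "A - B \<in> graded_maps n ds es"
  using assms by (auto simp: graded_maps_iff poly_ring_diff homogeneous_diff)

lemma graded_maps_one: "1\<^sub>m (length ds) \<in> graded_maps n ds ds"
  by (auto simp: graded_maps_iff poly_ring_0 poly_ring_1 homogeneous_0 homogeneous_1)

lemma graded_maps_zero: "0\<^sub>m (length ds) (length es) \<in> graded_maps n ds es"
  by (auto simp: graded_maps_iff poly_ring_0 homogeneous_0)

lemma col_in_free_module:
  assumes "A \<in> graded_maps n ds es" "c < length es"
  shows "col A c \<in> free_module n ds"
  using assms by (auto simp: free_module_def graded_maps_iff)

lemma mult_vec_in_free_module:
  assumes A: "A \<in> graded_maps n ds es" and v: "v \<in> free_module n es"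
  shows "A *\<^sub>v v \<in> free_module n ds"
proof -
  have vc: "v \<in> carrier_vec (length es)" using v by (simp add: free_module_def)
  note Ac = graded_maps_carrier[OF A]
  have "(A *\<^sub>v v) $ r \<in> poly_ring n" if r: "r < length ds" for r
    unfolding mult_vec_entry[OF Ac vc r]
    using A v r by (intro poly_ring_sum poly_ring_mult) (auto simp: graded_maps_iff free_module_def)
  then show ?thesis using Ac by (auto simp: free_module_def mult_mat_vec_def)
qed

text \<open>
  Preimages of the columns can be replaced by their homogeneous parts of the right degree, because \<open>D\<close>
  preserves degrees.
\<close>

lemma graded_lift:
  assumes D: "D \<in> graded_maps n ds es" and A: "A \<in> graded_maps n ds us"
    and im: "\<And>c. c < length us \<Longrightarrow> col A c \<in> (*\<^sub>v) D ` free_module n es"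
  shows "\<exists>B\<in>graded_maps n es us. A = D * B"
proof -
  have "\<exists>w. w \<in> free_module n es \<and> col A c = D *\<^sub>v w" if "c < length us" for c
    using im[OF that] by blast
  then obtain w where w: "\<And>c. c < length us \<Longrightarrow> w c \<in> free_module n es"
      "\<And>c. c < length us \<Longrightarrow> col A c = D *\<^sub>v w c" by metis
  define B where "B = mat (length es) (length us) (\<lambda>(k, c). homogeneous_part (es ! k) (us ! c) (w c $ k))"
  have Bc: "B \<in> carrier_mat (length es) (length us)" by (simp add: B_def)
  note Dc = graded_maps_carrier[OF D] and Ac = graded_maps_carrier[OF A]
  have "B \<in> graded_maps n es us"
    unfolding graded_maps_iff using w(1) Bc
    by (auto simp: B_def homogeneous_homogeneous_part free_module_def intro!: homogeneous_part_poly_ring)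
  moreover have "A = D * B"
  proof (rule eq_matI)
    fix r c assume "r < dim_row (D * B)" "c < dim_col (D * B)"
    then have rc: "r < length ds" "c < length us" using Dc Bc by auto
    have wc: "w c \<in> carrier_vec (length es)" using w(1)[OF rc(2)] by (simp add: free_module_def)
    have h: "homogeneous (ds ! r) (es ! k) (D $$ (r, k))" if "k < length es" for k
      using D that rc by (simp add: graded_maps_iff)
    have "(D * B) $$ (r, c) = (\<Sum>k<length es. D $$ (r, k) * homogeneous_part (es ! k) (us ! c) (w c $ k))"
      unfolding mult_entry[OF Dc Bc rc] using rc by (simp add: B_def)
    also have "\<dots> = homogeneous_part (ds ! r) (us ! c) (\<Sum>k<length es. D $$ (r, k) * w c $ k)"
      unfolding homogeneous_part_sum using homogeneous_part_mult[OF h] by simp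
    also have "(\<Sum>k<length es. D $$ (r, k) * w c $ k) = A $$ (r, c)"
      using mult_vec_entry[OF Dc wc rc(1)] arg_cong[OF w(2)[OF rc(2)], of "\<lambda>v. v $ r"] Ac rc by auto
    also have "homogeneous_part (ds ! r) (us ! c) (A $$ (r, c)) = A $$ (r, c)"
      using A rc by (intro homogeneous_part_id) (simp add: graded_maps_iff)
    finally show "A $$ (r, c) = (D * B) $$ (r, c)" ..
  qed (use Ac Bc Dc in auto)
  ultimately show ?thesis by blast
qed

context
  fixes n :: nat and I :: "'k::field mpoly set" and F D
  assumes res: "graded_free_resolution n I F D"
begin

lemma resolution_start: "F 0 = [0]"
  and resolution_maps: "D i \<in> graded_maps n (F i) (F (Suc i))"
  and resolution_exact_0: "{v \<in> free_module n (F 0). v $ 0 \<in> I} = (*\<^sub>v) (D 0) ` free_module n (F 1)"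
  and resolution_exact_Suc: "{v \<in> free_module n (F (Suc i)). D i *\<^sub>v v = 0\<^sub>v (length (F i))} =
          (*\<^sub>v) (D (Suc i)) ` free_module n (F (Suc (Suc i)))"
  using res unfolding graded_free_resolution_def by blast+

lemma resolution_carrier: "D i \<in> carrier_mat (length (F i)) (length (F (Suc i)))"
  using graded_maps_carrier[OF resolution_maps] .

lemma col_in_image:
  assumes "c < length (F (Suc i))"
  shows "col (D i) c \<in> (*\<^sub>v) (D i) ` free_module n (F (Suc i))"
proof
  show "col (D i) c = D i *\<^sub>v unit_vec (length (F (Suc i))) c"
    using col_mult2[OF resolution_carrier one_carrier_mat assms]
    by (simp add: col_one[OF assms] right_mult_one_mat[OF resolution_carrier])
  show "unit_vec (length (F (Suc i))) c \<in> free_module n (F (Suc i))"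
    by (auto simp: free_module_def unit_vec_def poly_ring_0 poly_ring_1)
qed

lemma resolution_DD: "D i * D (Suc i) = 0\<^sub>m (length (F i)) (length (F (Suc (Suc i))))"
proof (rule eq_matI)
  note c1 = resolution_carrier[of i] and c2 = resolution_carrier[of "Suc i"]
  fix r c assume "r < dim_row (0\<^sub>m (length (F i)) (length (F (Suc (Suc i)))) :: 'k mpoly mat)"
    "c < dim_col (0\<^sub>m (length (F i)) (length (F (Suc (Suc i)))) :: 'k mpoly mat)"
  then have rc: "r < length (F i)" "c < length (F (Suc (Suc i)))" by auto
  have "D i *\<^sub>v col (D (Suc i)) c = 0\<^sub>v (length (F i))"
    using col_in_image[OF rc(2)] resolution_exact_Suc by blast
  then have "col (D i * D (Suc i)) c = 0\<^sub>v (length (F i))" using col_mult2[OF c1 c2 rc(2)] by simp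
  then have "col (D i * D (Suc i)) c $ r = 0" using rc by simp
  then show "(D i * D (Suc i)) $$ (r, c) = 0\<^sub>m (length (F i)) (length (F (Suc (Suc i)))) $$ (r, c)"
    using rc c1 c2 by auto
qed (use resolution_carrier[of i] resolution_carrier[of "Suc i"] in auto)

lemma resolution_lift_0:
  assumes A: "A \<in> graded_maps n [0] us" and I: "\<And>c. c < length us \<Longrightarrow> A $$ (0, c) \<in> I"
  shows "\<exists>B\<in>graded_maps n (F (Suc 0)) us. A = D 0 * B"
proof (rule graded_lift[of _ n "[0]"])
  show "D 0 \<in> graded_maps n [0] (F (Suc 0))" using resolution_maps[of 0] resolution_start by simp
  show "A \<in> graded_maps n [0] us" by fact
  fix c assume c: "c < length us"
  then have "col A c \<in> {v \<in> free_module n (F 0). v $ 0 \<in> I}"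
    using col_in_free_module[OF A] I graded_maps_carrier[OF A] by (simp add: resolution_start)
  then show "col A c \<in> (*\<^sub>v) (D 0) ` free_module n (F (Suc 0))"
    unfolding resolution_exact_0 by simp
qed

lemma resolution_lift_Suc:
  assumes A: "A \<in> graded_maps n (F (Suc i)) us" and 0: "D i * A = 0\<^sub>m (length (F i)) (length us)"
  shows "\<exists>B\<in>graded_maps n (F (Suc (Suc i))) us. A = D (Suc i) * B"
proof (rule graded_lift[OF resolution_maps A])
  fix c assume c: "c < length us"
  have "D i *\<^sub>v col A c = col (D i * A) c"
    using col_mult2[OF resolution_carrier graded_maps_carrier[OF A] c] by simp
  also have "\<dots> = 0\<^sub>v (length (F i))" unfolding 0 using c by (intro eq_vecI) auto
  finally show "col A c \<in> (*\<^sub>v) (D (Suc i)) ` free_module n (F (Suc (Suc i)))"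
    using col_in_free_module[OF A c] resolution_exact_Suc by blast
qed

lemma resolution_D0_in_ideal:
  assumes "c < length (F (Suc 0))"
  shows "D 0 $$ (0, c) \<in> I"
proof -
  have "col (D 0) c \<in> {v \<in> free_module n (F 0). v $ 0 \<in> I}"
    unfolding resolution_exact_0 using col_in_image[OF assms] by simp
  then show ?thesis using assms resolution_carrier[of 0] by (simp add: resolution_start)
qed

end

text \<open>
  The comparison theorem: free modules are projective, so the identity of \<open>R\<close> lifts step by step along
  the exact complex \<open>G\<close>.  In the recursion, the composite of the last map with the differential has to
  take values in the kernel of the next differential of \<open>G\<close>.
\<close>

lemma resolution_comparison:
  assumes F: "graded_free_resolution n I F D" and G: "graded_free_resolution n I G E"
  shows "\<exists>f. f 0 = 1\<^sub>m 1 \<and> (\<forall>i. f i \<in> graded_maps n (G i) (F i)) \<and> (\<forall>i. E i * f (Suc i) = f i * D i)"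
proof -
  note DF = resolution_maps[OF F] and EG = resolution_maps[OF G]
  note dF = resolution_carrier[OF F] and eG = resolution_carrier[OF G]
  define P where "P i x \<longleftrightarrow> x \<in> graded_maps n (G i) (F i) \<and> (case i of 0 \<Rightarrow> x = 1\<^sub>m 1
     | Suc k \<Rightarrow> E k * (x * D i) = 0\<^sub>m (length (G k)) (length (F (Suc i))))" for i x
  define Q where "Q i x y \<longleftrightarrow> E i * y = x * D i" for i x y
  have "\<exists>f. \<forall>i. P i (f i) \<and> Q i (f i) (f (Suc i))"
  proof (rule dependent_nat_choice)
    show "\<exists>x. P 0 x"
      using graded_maps_one[of "[0]" n] by (simp add: P_def resolution_start[OF F] resolution_start[OF G])
    fix x i assume P: "P i x"
    have x: "x \<in> graded_maps n (G i) (F i)" using P by (simp add: P_def)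
    have "\<exists>y\<in>graded_maps n (G (Suc i)) (F (Suc i)). x * D i = E i * y"
    proof (cases i)
      case 0
      have "D 0 = x * D i" using P 0 dF[of 0] by (simp add: P_def resolution_start[OF F])
      then show ?thesis
        using resolution_lift_0[OF G, of "x * D i"] graded_maps_mult[OF x DF] 0
          resolution_D0_in_ideal[OF F] resolution_start[OF G] by simp
    next
      case (Suc k)
      then show ?thesis
        using resolution_lift_Suc[OF G, of "x * D i" k] graded_maps_mult[OF x DF] P by (simp add: P_def)
    qed
    then obtain y where y: "y \<in> graded_maps n (G (Suc i)) (F (Suc i))" "x * D i = E i * y" by blast
    have "E i * (y * D (Suc i)) = x * D i * D (Suc i)"
      using assoc_mult_mat[OF eG graded_maps_carrier[OF y(1)] dF] y(2) by simp
    also have "\<dots> = x * (D i * D (Suc i))"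
      by (rule assoc_mult_mat[OF graded_maps_carrier[OF x] dF dF])
    also have "\<dots> = 0\<^sub>m (length (G i)) (length (F (Suc (Suc i))))"
      unfolding resolution_DD[OF F] using graded_maps_carrier[OF x] by simp
    finally have "P (Suc i) y" using y(1) by (simp add: P_def)
    then show "\<exists>y. P (Suc i) y \<and> Q i x y" using y(2) by (auto simp: Q_def)
  qed
  then obtain f where f: "\<And>i. P i (f i)" "\<And>i. Q i (f i) (f (Suc i))" by blast
  show ?thesis
  proof (intro exI conjI allI)
    show "f 0 = 1\<^sub>m 1" using f(1)[of 0] by (simp add: P_def)
  qed (use f in \<open>auto simp: P_def Q_def\<close>)
qed

text \<open>
  Any chain map from a resolution to itself that lifts the identity of \<open>R\<close> is homotopic to the identity;
  the homotopy is again constructed by lifting.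
\<close>

lemma resolution_homotopy:
  assumes F: "graded_free_resolution n I F D"
    and e: "e 0 = 1\<^sub>m 1" "\<And>i. e i \<in> graded_maps n (F i) (F i)" "\<And>i. D i * e (Suc i) = e i * D i"
  shows "\<exists>h. h 0 = 0\<^sub>m (length (F 1)) 1 \<and> (\<forall>i. h i \<in> graded_maps n (F (Suc i)) (F i)) \<and>
     (\<forall>i. e (Suc i) - 1\<^sub>m (length (F (Suc i))) - h i * D i = D (Suc i) * h (Suc i))"
proof -
  note DF = resolution_maps[OF F] and dF = resolution_carrier[OF F]
  note ec = graded_maps_carrier[OF e(2)]
  define P where "P i x \<longleftrightarrow> x \<in> graded_maps n (F (Suc i)) (F i) \<and> (i = 0 \<longrightarrow> x = 0\<^sub>m (length (F 1)) 1) \<and>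
    D i * (x * D i) = e i * D i - D i" for i x
  define Q where "Q i x y \<longleftrightarrow> e (Suc i) - 1\<^sub>m (length (F (Suc i))) - x * D i = D (Suc i) * y" for i x y
  have "\<exists>f. \<forall>i. P i (f i) \<and> Q i (f i) (f (Suc i))"
  proof (rule dependent_nat_choice)
    have "1\<^sub>m 1 * D 0 = D 0" using dF[of 0] resolution_start[OF F] by simp
    moreover have "D 0 - D 0 = 0\<^sub>m 1 (length (F 1))" using dF[of 0] resolution_start[OF F] by (intro eq_matI) auto
    moreover have "0\<^sub>m (length (F 1)) 1 * D 0 = 0\<^sub>m (length (F 1)) (length (F 1))"
      using dF[of 0] resolution_start[OF F] by simp
    moreover have "D 0 * 0\<^sub>m (length (F 1)) (length (F 1)) = 0\<^sub>m 1 (length (F 1))"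
      using dF[of 0] resolution_start[OF F] by simp
    ultimately have "P 0 (0\<^sub>m (length (F 1)) 1)"
      using graded_maps_zero[of "F 1" "F 0" n] resolution_start[OF F] e(1) by (simp add: P_def)
    then show "\<exists>x. P 0 x" ..
    fix x i assume P: "P i x"
    have x: "x \<in> graded_maps n (F (Suc i)) (F i)" using P by (simp add: P_def)
    note xc = graded_maps_carrier[OF x]
    let ?J = "1\<^sub>m (length (F (Suc i))) :: 'a mpoly mat"
    let ?A = "e (Suc i) - ?J - x * D i"
    have A: "?A \<in> graded_maps n (F (Suc i)) (F (Suc i))"
      by (intro graded_maps_diff e(2) graded_maps_one graded_maps_mult[OF x DF])
    have xD: "x * D i \<in> carrier_mat (length (F (Suc i))) (length (F (Suc i)))"
      using xc dF[of i] by simp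
    have eJ: "e (Suc i) - ?J \<in> carrier_mat (length (F (Suc i))) (length (F (Suc i)))"
      by (rule minus_carrier_mat[OF one_carrier_mat])
    have "D i * ?A = D i * (e (Suc i) - ?J) - D i * (x * D i)"
      by (rule mult_minus_distrib_mat[OF dF eJ xD])
    also have "D i * (e (Suc i) - ?J) = D i * e (Suc i) - D i * ?J"
      by (rule mult_minus_distrib_mat[OF dF ec one_carrier_mat])
    also have "D i * ?J = D i" using dF[of i] by simp
    also have "D i * (x * D i) = D i * e (Suc i) - D i" using P e(3)[of i] by (simp add: P_def)
    also have "D i * e (Suc i) - D i - (D i * e (Suc i) - D i) = 0\<^sub>m (length (F i)) (length (F (Suc i)))"
      using dF[of i] ec[of "Suc i"] by (intro eq_matI) auto
    finally obtain y where y: "y \<in> graded_maps n (F (Suc (Suc i))) (F (Suc i))" "?A = D (Suc i) * y"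
      using resolution_lift_Suc[OF F A] by blast
    have "D (Suc i) * (y * D (Suc i)) = ?A * D (Suc i)"
      using assoc_mult_mat[OF dF graded_maps_carrier[OF y(1)] dF] y(2) by simp
    also have "\<dots> = (e (Suc i) - ?J) * D (Suc i) - x * D i * D (Suc i)"
      by (rule minus_mult_distrib_mat[OF eJ xD dF])
    also have "(e (Suc i) - ?J) * D (Suc i) = e (Suc i) * D (Suc i) - ?J * D (Suc i)"
      by (rule minus_mult_distrib_mat[OF ec one_carrier_mat dF])
    also have "?J * D (Suc i) = D (Suc i)" using dF[of "Suc i"] by simp
    also have "x * D i * D (Suc i) = x * (D i * D (Suc i))" by (rule assoc_mult_mat[OF xc dF dF])
    also have "\<dots> = 0\<^sub>m (length (F (Suc i))) (length (F (Suc (Suc i))))"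
      unfolding resolution_DD[OF F] using xc by simp
    also have "e (Suc i) * D (Suc i) - D (Suc i) - 0\<^sub>m (length (F (Suc i))) (length (F (Suc (Suc i))))
       = e (Suc i) * D (Suc i) - D (Suc i)"
      using dF[of "Suc i"] ec[of "Suc i"] by (intro eq_matI) auto
    finally have "P (Suc i) y" using y(1) by (simp add: P_def)
    then show "\<exists>y. P (Suc i) y \<and> Q i x y" using y(2) by (auto simp: Q_def)
  qed
  then obtain h where h: "\<And>i. P i (h i)" "\<And>i. Q i (h i) (h (Suc i))" by blast
  show ?thesis
  proof (intro exI conjI allI)
    show "h 0 = 0\<^sub>m (length (F 1)) 1" using h(1)[of 0] by (simp add: P_def)
  qed (use h in \<open>auto simp: P_def Q_def\<close>)
qed

section \<open>Resolutions given by squarefree labels\<close>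

definition sqfree_mon :: "nat set \<Rightarrow> nat \<Rightarrow>\<^sub>0 nat" where
  "sqfree_mon \<sigma> = (\<Sum>i\<in>\<sigma>. Poly_Mapping.single i 1)"

lemma lookup_sqfree_mon: "finite \<sigma> \<Longrightarrow> Poly_Mapping.lookup (sqfree_mon \<sigma>) x = (if x \<in> \<sigma> then 1 else 0)"
  by (simp add: sqfree_mon_def lookup_sum lookup_single when_def)

lemma keys_sqfree_mon: "finite \<sigma> \<Longrightarrow> Poly_Mapping.keys (sqfree_mon \<sigma>) = \<sigma>"
  by (auto simp: in_keys_iff lookup_sqfree_mon split: if_splits)

lemma mon_degree_sqfree_mon: "finite \<sigma> \<Longrightarrow> mon_degree (sqfree_mon \<sigma>) = card \<sigma>"
  by (simp add: mon_degree_def keys_sqfree_mon lookup_sqfree_mon)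

lemma sqfree_mon_minus_add:
  assumes "finite \<sigma>" "\<sigma> \<subseteq> Poly_Mapping.keys \<alpha>"
  shows "\<alpha> - sqfree_mon \<sigma> + sqfree_mon \<sigma> = \<alpha>"
  by (rule poly_mapping_eqI) (use assms in \<open>auto simp: lookup_add lookup_minus lookup_sqfree_mon in_keys_iff\<close>)

text \<open>
  The part of multidegree \<open>\<alpha>\<close> of a vector in a free module whose generators have the squarefree
  multidegrees listed in \<open>L\<close>.  In each coordinate it is a scalar multiple of a single monomial, hence a
  vector of scalars.
\<close>

definition component :: "nat set list \<Rightarrow> 'k::field mpoly vec \<Rightarrow> (nat \<Rightarrow>\<^sub>0 nat) \<Rightarrow> nat \<Rightarrow> 'k" where
  "component L v \<alpha> c = (if c < length L \<and> L ! c \<subseteq> Poly_Mapping.keys \<alpha>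
     then Poly_Mapping.lookup (v $ c) (\<alpha> - sqfree_mon (L ! c)) else 0)"

text \<open>
  The homogenization of a scalar matrix: entries are multiplied by the monomials that make the matrix
  preserve multidegrees.
\<close>

definition monomial_matrix ::
  "nat set list \<Rightarrow> nat set list \<Rightarrow> (nat \<Rightarrow> nat \<Rightarrow> 'k::field) \<Rightarrow> 'k mpoly mat" where
  "monomial_matrix L L' d = mat (length L) (length L')
     (\<lambda>(r, c). if L ! r \<subseteq> L' ! c then Poly_Mapping.single (sqfree_mon (L' ! c - L ! r)) (d r c) else 0)"

definition supported :: "(nat \<Rightarrow> 'k::field) \<Rightarrow> nat set list \<Rightarrow> nat set \<Rightarrow> bool" where
  "supported u L \<sigma> \<longleftrightarrow> (\<forall>c. u c \<noteq> 0 \<longrightarrow> c < length L \<and> L ! c \<subseteq> \<sigma>)"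

lemma supported_component: "supported (component L v \<alpha>) L (Poly_Mapping.keys \<alpha>)"
  by (auto simp: supported_def component_def)

definition labels_in :: "nat \<Rightarrow> nat set list \<Rightarrow> bool" where
  "labels_in n L \<longleftrightarrow> (\<forall>\<sigma>\<in>set L. \<sigma> \<subseteq> {1..n})"

lemma labels_inD: "labels_in n L \<Longrightarrow> c < length L \<Longrightarrow> L ! c \<subseteq> {1..n} \<and> finite (L ! c)"
  unfolding labels_in_def by (meson finite_atLeastAtMost finite_subset nth_mem)

text \<open>
  In every multidegree a homogenized matrix acts as the scalar matrix from which it was formed.
\<close>

lemma component_mult:
  assumes L: "labels_in n L" "labels_in n L'" and v: "v \<in> carrier_vec (length L')"
    and d: "\<And>c. c < length L' \<Longrightarrow> d r c \<noteq> 0 \<Longrightarrow> L ! r \<subseteq> L' ! c" and r: "r < length L"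
  shows "component L (monomial_matrix L L' d *\<^sub>v v) \<alpha> r = (\<Sum>c<length L'. d r c * component L' v \<alpha> c)"
proof (cases "L ! r \<subseteq> Poly_Mapping.keys \<alpha>")
  case True
  let ?M = "monomial_matrix L L' d"
  have M: "?M \<in> carrier_mat (length L) (length L')" by (simp add: monomial_matrix_def)
  have "component L (?M *\<^sub>v v) \<alpha> r = (\<Sum>c<length L'. Poly_Mapping.lookup (?M $$ (r, c) * v $ c) (\<alpha> - sqfree_mon (L ! r)))"
    using True r by (simp add: component_def mult_vec_entry[OF M v r] lookup_sum)
  also have "\<dots> = (\<Sum>c<length L'. d r c * component L' v \<alpha> c)"
  proof (rule sum.cong[OF refl])
    fix c assume "c \<in> {..<length L'}"
    then have c: "c < length L'" by simp
    have fin: "finite (L ! r)" "finite (L' ! c)" using labels_inD L c r by blast+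
    show "Poly_Mapping.lookup (?M $$ (r, c) * v $ c) (\<alpha> - sqfree_mon (L ! r)) = d r c * component L' v \<alpha> c"
    proof (cases "L ! r \<subseteq> L' ! c")
      case False
      then show ?thesis using d[OF c] r c by (auto simp: monomial_matrix_def)
    next
      case sub: True
      then have e: "?M $$ (r, c) = Poly_Mapping.single (sqfree_mon (L' ! c - L ! r)) (d r c)"
        using r c by (simp add: monomial_matrix_def)
      show ?thesis
      proof (cases "L' ! c \<subseteq> Poly_Mapping.keys \<alpha>")
        case True
        have "\<alpha> - sqfree_mon (L ! r) = sqfree_mon (L' ! c - L ! r) + (\<alpha> - sqfree_mon (L' ! c))"
        proof (rule poly_mapping_eqI)
          fix x
          have "x \<in> L' ! c \<Longrightarrow> Poly_Mapping.lookup \<alpha> x \<noteq> 0" using True by (auto simp: in_keys_iff)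
          then show "Poly_Mapping.lookup (\<alpha> - sqfree_mon (L ! r)) x =
            Poly_Mapping.lookup (sqfree_mon (L' ! c - L ! r) + (\<alpha> - sqfree_mon (L' ! c))) x"
            using sub fin by (auto simp: lookup_add lookup_minus lookup_sqfree_mon)
        qed
        then show ?thesis using True c by (simp add: e lookup_single_mult_add component_def)
      next
        case False
        then obtain x where x: "x \<in> L' ! c" "x \<notin> Poly_Mapping.keys \<alpha>" by blast
        have "\<alpha> - sqfree_mon (L ! r) \<noteq> sqfree_mon (L' ! c - L ! r) + m" for m
        proof
          assume "\<alpha> - sqfree_mon (L ! r) = sqfree_mon (L' ! c - L ! r) + m"
          then have "Poly_Mapping.lookup (\<alpha> - sqfree_mon (L ! r)) x = Poly_Mapping.lookup (sqfree_mon (L' ! c - L ! r) + m) x"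
            by simp
          moreover have "x \<notin> L ! r" using x \<open>L ! r \<subseteq> Poly_Mapping.keys \<alpha>\<close> by blast
          ultimately show False
            using x fin by (simp add: lookup_add lookup_minus lookup_sqfree_mon in_keys_iff)
        qed
        then show ?thesis using False by (simp add: e lookup_single_mult_0 component_def)
      qed
    qed
  qed
  finally show ?thesis .
next
  case False
  have "d r c * component L' v \<alpha> c = 0" if "c < length L'" for c
    using d[OF that] False by (auto simp: component_def)
  then have "(\<Sum>c<length L'. d r c * component L' v \<alpha> c) = 0" by (intro sum.neutral) auto
  then show ?thesis using False by (simp add: component_def[of L])
qed

lemma eq_if_components_eq:
  assumes L: "labels_in n L" and v: "v \<in> carrier_vec (length L)" "v' \<in> carrier_vec (length L)"
    and eq: "\<And>\<alpha> c. c < length L \<Longrightarrow> component L v \<alpha> c = component L v' \<alpha> c"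
  shows "v = v'"
proof (rule eq_vecI)
  fix c assume "c < dim_vec v'"
  then have c: "c < length L" using v by simp
  then have fin: "finite (L ! c)" using labels_inD[OF L] by blast
  show "v $ c = v' $ c"
  proof (rule poly_mapping_eqI)
    fix m
    have "L ! c \<subseteq> Poly_Mapping.keys (m + sqfree_mon (L ! c))"
      using fin by (simp add: keys_plus_exponent keys_sqfree_mon)
    then show "Poly_Mapping.lookup (v $ c) m = Poly_Mapping.lookup (v' $ c) m"
      using eq[OF c, of "m + sqfree_mon (L ! c)"] c by (simp add: component_def)
  qed
qed (use v in simp)

lemma finite_component_support:
  assumes L: "labels_in n L"
  shows "finite {\<alpha>. \<exists>c. component L v \<alpha> c \<noteq> 0}"
proof -
  have "{\<alpha>. \<exists>c. component L v \<alpha> c \<noteq> 0} \<subseteq>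
    (\<Union>c<length L. (\<lambda>m. m + sqfree_mon (L ! c)) ` Poly_Mapping.keys (v $ c))"
  proof clarify
    fix \<alpha> c assume h: "component L v \<alpha> c \<noteq> 0"
    then have c: "c < length L" "L ! c \<subseteq> Poly_Mapping.keys \<alpha>"
      "\<alpha> - sqfree_mon (L ! c) \<in> Poly_Mapping.keys (v $ c)"
      by (auto simp: component_def in_keys_iff split: if_splits)
    moreover have "\<alpha> = \<alpha> - sqfree_mon (L ! c) + sqfree_mon (L ! c)"
      using sqfree_mon_minus_add c labels_inD[OF L] by metis
    ultimately show "\<alpha> \<in> (\<Union>c<length L. (\<lambda>m. m + sqfree_mon (L ! c)) ` Poly_Mapping.keys (v $ c))"
      by blast
  qed
  then show ?thesis by (rule finite_subset) auto
qed

lemma component_keys: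
  assumes L: "labels_in n L" and v: "v \<in> free_module n (map card L)" and h: "component L v \<alpha> c \<noteq> 0"
  shows "Poly_Mapping.keys \<alpha> \<subseteq> {1..n}"
proof -
  have c: "c < length L" "L ! c \<subseteq> Poly_Mapping.keys \<alpha>"
      "\<alpha> - sqfree_mon (L ! c) \<in> Poly_Mapping.keys (v $ c)"
    using h by (auto simp: component_def in_keys_iff split: if_splits)
  have "\<alpha> = \<alpha> - sqfree_mon (L ! c) + sqfree_mon (L ! c)"
    using sqfree_mon_minus_add c labels_inD[OF L] by metis
  then have "Poly_Mapping.keys \<alpha> = Poly_Mapping.keys (\<alpha> - sqfree_mon (L ! c)) \<union> L ! c"
    using keys_plus_exponent keys_sqfree_mon labels_inD[OF L c(1)] by metis
  moreover have "Poly_Mapping.keys (\<alpha> - sqfree_mon (L ! c)) \<subseteq> {1..n}"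
    using v c by (simp add: free_module_def poly_ring_def)
  ultimately show ?thesis using labels_inD[OF L c(1)] by blast
qed

lemma vector_of_components:
  fixes w :: "(nat \<Rightarrow>\<^sub>0 nat) \<Rightarrow> nat \<Rightarrow> 'k::field"
  assumes L: "labels_in n L" and fin: "finite {\<alpha>. \<exists>c. w \<alpha> c \<noteq> 0}"
    and w: "\<And>\<alpha>. supported (w \<alpha>) L (Poly_Mapping.keys \<alpha>)"
    and keys: "\<And>\<alpha> c. w \<alpha> c \<noteq> 0 \<Longrightarrow> Poly_Mapping.keys \<alpha> \<subseteq> {1..n}"
  shows "\<exists>v\<in>free_module n (map card L). \<forall>\<alpha>. component L v \<alpha> = w \<alpha>"
proof -
  have finc: "finite {m. w (m + sqfree_mon (L ! c)) c \<noteq> 0}" for c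
  proof (rule finite_imageD)
    show "finite ((\<lambda>m. m + sqfree_mon (L ! c)) ` {m. w (m + sqfree_mon (L ! c)) c \<noteq> 0})"
      by (rule finite_subset[OF _ fin]) auto
    show "inj_on (\<lambda>m. m + sqfree_mon (L ! c)) {m. w (m + sqfree_mon (L ! c)) c \<noteq> 0}"
      by (rule inj_onI) simp
  qed
  define v where "v = vec (length L) (\<lambda>c. Poly_Mapping.Abs_poly_mapping (\<lambda>m. w (m + sqfree_mon (L ! c)) c))"
  have look: "Poly_Mapping.lookup (v $ c) m = w (m + sqfree_mon (L ! c)) c" if "c < length L" for c m
    using that finc by (simp add: v_def)
  have "v \<in> free_module n (map card L)"
    unfolding free_module_def poly_ring_def
  proof (intro CollectI conjI allI impI ballI)
    show "v \<in> carrier_vec (length (map card L))" by (simp add: v_def)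
    fix c m assume c: "c < length (map card L)" "m \<in> Poly_Mapping.keys (v $ c)"
    then have "w (m + sqfree_mon (L ! c)) c \<noteq> 0" by (simp add: in_keys_iff look)
    then show "Poly_Mapping.keys m \<subseteq> {1..n}" using keys keys_plus_exponent by blast
  qed
  moreover have "component L v \<alpha> c = w \<alpha> c" for \<alpha> c
  proof (cases "c < length L \<and> L ! c \<subseteq> Poly_Mapping.keys \<alpha>")
    case True
    then show ?thesis
      using sqfree_mon_minus_add labels_inD[OF L, of c] by (simp add: component_def look)
  next
    case False
    then show ?thesis using w[of \<alpha>] by (auto simp: component_def supported_def)
  qed
  ultimately show ?thesis by blast
qed

text \<open>
  Preimages can be chosen separately in each multidegree.  To glue them to polynomials, the preimage of
  zero is chosen to be zero; then only finitely many multidegrees contribute.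
\<close>

lemma image_iff_components:
  assumes L: "labels_in n L" "labels_in n L'"
    and d: "\<And>r c. r < length L \<Longrightarrow> c < length L' \<Longrightarrow> d r c \<noteq> 0 \<Longrightarrow> L ! r \<subseteq> L' ! c"
    and v: "v \<in> free_module n (map card L)"
  shows "v \<in> (*\<^sub>v) (monomial_matrix L L' d) ` free_module n (map card L') \<longleftrightarrow>
    (\<forall>\<alpha>. Poly_Mapping.keys \<alpha> \<subseteq> {1..n} \<longrightarrow> (\<exists>w. supported w L' (Poly_Mapping.keys \<alpha>) \<and>
       (\<forall>r<length L. component L v \<alpha> r = (\<Sum>c<length L'. d r c * w c))))"
    (is "?L \<longleftrightarrow> ?R")
proof
  assume ?L
  then obtain w where w: "w \<in> free_module n (map card L')" "v = monomial_matrix L L' d *\<^sub>v w" by blast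
  have "w \<in> carrier_vec (length L')" using w by (simp add: free_module_def)
  then show ?R
    using supported_component component_mult[OF L _ d] unfolding w(2) by blast
next
  assume R: ?R
  have "\<exists>w. supported w L' (Poly_Mapping.keys \<alpha>) \<and>
       (\<forall>r<length L. component L v \<alpha> r = (\<Sum>c<length L'. d r c * w c)) \<and>
       ((\<forall>r. component L v \<alpha> r = 0) \<longrightarrow> w = (\<lambda>_. 0))" for \<alpha>
  proof (cases "\<forall>r. component L v \<alpha> r = 0")
    case True
    then show ?thesis by (intro exI[of _ "\<lambda>_. 0"]) (simp add: supported_def)
  next
    case False
    then have "Poly_Mapping.keys \<alpha> \<subseteq> {1..n}" using component_keys[OF L(1) v] by blast
    then show ?thesis using R False by blast
  qed
  then obtain w where w: "\<And>\<alpha>. supported (w \<alpha>) L' (Poly_Mapping.keys \<alpha>)"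
    "\<And>\<alpha> r. r < length L \<Longrightarrow> component L v \<alpha> r = (\<Sum>c<length L'. d r c * w \<alpha> c)"
    "\<And>\<alpha>. (\<forall>r. component L v \<alpha> r = 0) \<Longrightarrow> w \<alpha> = (\<lambda>_. 0)"
    by metis
  have nz: "\<exists>r. component L v \<alpha> r \<noteq> 0" if "w \<alpha> c \<noteq> 0" for \<alpha> c using w(3) that by metis
  have "finite {\<alpha>. \<exists>c. w \<alpha> c \<noteq> 0}"
    by (rule finite_subset[OF _ finite_component_support[OF L(1), of v]]) (use nz in blast)
  moreover have "Poly_Mapping.keys \<alpha> \<subseteq> {1..n}" if "w \<alpha> c \<noteq> 0" for \<alpha> c
    using nz[OF that] component_keys[OF L(1) v] by blast
  ultimately obtain x where x: "x \<in> free_module n (map card L')" "\<And>\<alpha>. component L' x \<alpha> = w \<alpha>"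
    using vector_of_components[OF L(2) _ w(1)] by blast
  have xc: "x \<in> carrier_vec (length L')" using x by (simp add: free_module_def)
  have "v = monomial_matrix L L' d *\<^sub>v x"
  proof (rule eq_if_components_eq[OF L(1)])
    show "v \<in> carrier_vec (length L)" using v by (simp add: free_module_def)
    show "monomial_matrix L L' d *\<^sub>v x \<in> carrier_vec (length L)"
      by (auto simp: monomial_matrix_def mult_mat_vec_def)
    show "component L v \<alpha> r = component L (monomial_matrix L L' d *\<^sub>v x) \<alpha> r" if "r < length L" for \<alpha> r
      using component_mult[OF L xc d[OF that] that] w(2)[OF that] x(2) by simp
  qed
  then show ?L using x(1) by blast
qed

text \<open>
  Scalar data of a multigraded resolution of a squarefree monomial ideal, with \<open>W\<close> the set of supports
  of its generators.  In multidegree \<open>\<alpha>\<close> exactly the generators whose label is contained in the support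
  \<open>\<sigma>\<close> of \<open>\<alpha>\<close> contribute, and always by one scalar; so exactness in all multidegrees amounts to
  exactness of the scalar complex restricted to each \<open>\<sigma>\<close>.
\<close>

locale labelled_resolution =
  fixes n :: nat and W :: "nat set set" and L :: "nat \<Rightarrow> nat set list" and d :: "nat \<Rightarrow> nat \<Rightarrow> nat \<Rightarrow> 'k::field"
  assumes start: "L 0 = [{}]"
    and labels: "labels_in n (L i)"
    and subset: "r < length (L i) \<Longrightarrow> c < length (L (Suc i)) \<Longrightarrow> d i r c \<noteq> 0 \<Longrightarrow> L i ! r \<subseteq> L (Suc i) ! c"
    and exact_0: "\<sigma> \<subseteq> {1..n} \<Longrightarrow>
      (\<exists>w. supported w (L (Suc 0)) \<sigma> \<and> (\<Sum>c<length (L (Suc 0)). d 0 0 c * w c) = 1) \<longleftrightarrow> (\<exists>\<omega>\<in>W. \<omega> \<subseteq> \<sigma>)"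
    and exact_Suc: "\<sigma> \<subseteq> {1..n} \<Longrightarrow> supported u (L (Suc i)) \<sigma> \<Longrightarrow>
      (\<forall>r<length (L i). (\<Sum>c<length (L (Suc i)). d i r c * u c) = 0) \<longleftrightarrow>
      (\<exists>w. supported w (L (Suc (Suc i))) \<sigma> \<and>
         (\<forall>c<length (L (Suc i)). u c = (\<Sum>k<length (L (Suc (Suc i))). d (Suc i) c k * w k)))"
begin

lemma monomial_matrix_graded:
  "monomial_matrix (L i) (L (Suc i)) (d i) \<in> graded_maps n (map card (L i)) (map card (L (Suc i)))"
  unfolding graded_maps_iff
proof (intro conjI allI impI)
  show "monomial_matrix (L i) (L (Suc i)) (d i) \<in> carrier_mat (length (map card (L i))) (length (map card (L (Suc i))))"
    by (simp add: monomial_matrix_def)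
  fix r c assume "r < length (map card (L i))" "c < length (map card (L (Suc i)))"
  then have rc: "r < length (L i)" "c < length (L (Suc i))" by auto
  note fin = labels_inD[OF labels rc(1)] labels_inD[OF labels rc(2)]
  show "monomial_matrix (L i) (L (Suc i)) (d i) $$ (r, c) \<in> poly_ring n"
    using rc fin by (auto simp: monomial_matrix_def poly_ring_0 keys_sqfree_mon intro!: poly_ring_single)
  have "card (L (Suc i) ! c - L i ! r) + card (L i ! r) = card (L (Suc i) ! c)" if "L i ! r \<subseteq> L (Suc i) ! c"
    using that fin by (simp add: card_Diff_subset card_mono)
  then show "homogeneous (map card (L i) ! r) (map card (L (Suc i)) ! c) (monomial_matrix (L i) (L (Suc i)) (d i) $$ (r, c))"
    using rc fin by (auto simp: monomial_matrix_def homogeneous_def mon_degree_sqfree_mon)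
qed

lemma matrix_image_iff:
  assumes v: "v \<in> free_module n (map card (L i))"
  shows "v \<in> (*\<^sub>v) (monomial_matrix (L i) (L (Suc i)) (d i)) ` free_module n (map card (L (Suc i))) \<longleftrightarrow>
    (\<forall>\<alpha>. Poly_Mapping.keys \<alpha> \<subseteq> {1..n} \<longrightarrow> (\<exists>w. supported w (L (Suc i)) (Poly_Mapping.keys \<alpha>) \<and>
       (\<forall>r<length (L i). component (L i) v \<alpha> r = (\<Sum>c<length (L (Suc i)). d i r c * w c))))"
  by (rule image_iff_components[OF labels labels _ v]) (use subset in auto)

lemma matrix_kernel_iff:
  assumes v: "v \<in> free_module n (map card (L (Suc i)))"
  shows "monomial_matrix (L i) (L (Suc i)) (d i) *\<^sub>v v = 0\<^sub>v (length (L i)) \<longleftrightarrow>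
    (\<forall>\<alpha>. Poly_Mapping.keys \<alpha> \<subseteq> {1..n} \<longrightarrow>
       (\<forall>r<length (L i). (\<Sum>c<length (L (Suc i)). d i r c * component (L (Suc i)) v \<alpha> c) = 0))"
    (is "?M *\<^sub>v v = _ \<longleftrightarrow> ?R")
proof -
  have vc: "v \<in> carrier_vec (length (L (Suc i)))" using v by (simp add: free_module_def)
  have comp: "component (L i) (?M *\<^sub>v v) \<alpha> r = (\<Sum>c<length (L (Suc i)). d i r c * component (L (Suc i)) v \<alpha> c)"
    if "r < length (L i)" for \<alpha> r
    using component_mult[OF labels labels vc subset[OF that] that] .
  have comp0: "component (L i) (0\<^sub>v (length (L i))) \<alpha> r = (0 :: 'k)" for \<alpha> r
    by (simp add: component_def)
  show ?thesis
  proof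
    assume "?M *\<^sub>v v = 0\<^sub>v (length (L i))"
    then show ?R using comp comp0 by metis
  next
    assume R: ?R
    show "?M *\<^sub>v v = 0\<^sub>v (length (L i))"
    proof (rule eq_if_components_eq[OF labels])
      show "?M *\<^sub>v v \<in> carrier_vec (length (L i))" by (auto simp: monomial_matrix_def mult_mat_vec_def)
      show "0\<^sub>v (length (L i)) \<in> carrier_vec (length (L i))" by simp
      fix \<alpha> r assume r: "r < length (L i)"
      have "component (L (Suc i)) v \<alpha> c = 0" if "\<not> Poly_Mapping.keys \<alpha> \<subseteq> {1..n}" for c
        using component_keys[OF labels v] that by blast
      then have "(\<Sum>c<length (L (Suc i)). d i r c * component (L (Suc i)) v \<alpha> c) = 0"
        using R r by (cases "Poly_Mapping.keys \<alpha> \<subseteq> {1..n}") auto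
      then show "component (L i) (?M *\<^sub>v v) \<alpha> r = component (L i) (0\<^sub>v (length (L i))) \<alpha> r"
        using comp[OF r] comp0 by simp
    qed
  qed
qed

lemma homogenization:
  assumes I: "\<And>f. f \<in> I \<longleftrightarrow> f \<in> poly_ring n \<and> (\<forall>m\<in>Poly_Mapping.keys f. \<exists>\<omega>\<in>W. \<omega> \<subseteq> Poly_Mapping.keys m)"
  shows "graded_free_resolution n I (\<lambda>i. map card (L i)) (\<lambda>i. monomial_matrix (L i) (L (Suc i)) (d i))"
  unfolding graded_free_resolution_def
proof (intro conjI allI)
  show "{v \<in> free_module n (map card (L 0)). v $ 0 \<in> I} =
      (*\<^sub>v) (monomial_matrix (L 0) (L (Suc 0)) (d 0)) ` free_module n (map card (L 1))" (is "?A = ?B")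
  proof -
    have "v $ 0 \<in> I \<longleftrightarrow> v \<in> ?B" if v: "v \<in> free_module n (map card (L 0))" for v
    proof -
      have v0: "v $ 0 \<in> poly_ring n" using v start by (simp add: free_module_def)
      have c0: "component [{}] v \<alpha> 0 = Poly_Mapping.lookup (v $ 0) \<alpha>" for \<alpha>
        by (simp add: component_def sqfree_mon_def)
      have "(\<exists>w. supported w (L (Suc 0)) \<sigma> \<and> a = (\<Sum>c<length (L (Suc 0)). d 0 0 c * w c))
          \<longleftrightarrow> a = 0 \<or> (\<exists>\<omega>\<in>W. \<omega> \<subseteq> \<sigma>)" (is "?l \<longleftrightarrow> _") if \<sigma>: "\<sigma> \<subseteq> {1..n}" for \<sigma> a
      proof
        assume ?l
        then obtain w where w: "supported w (L (Suc 0)) \<sigma>" "a = (\<Sum>c<length (L (Suc 0)). d 0 0 c * w c)" by blast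
        have "\<exists>\<omega>\<in>W. \<omega> \<subseteq> \<sigma>" if "a \<noteq> 0"
          unfolding exact_0[OF \<sigma>, symmetric]
        proof (intro exI conjI)
          show "supported (\<lambda>c. w c / a) (L (Suc 0)) \<sigma>" using w(1) by (simp add: supported_def)
          show "(\<Sum>c<length (L (Suc 0)). d 0 0 c * (w c / a)) = 1"
            using w(2) that by (simp flip: sum_divide_distrib)
        qed
        then show "a = 0 \<or> (\<exists>\<omega>\<in>W. \<omega> \<subseteq> \<sigma>)" by blast
      next
        assume "a = 0 \<or> (\<exists>\<omega>\<in>W. \<omega> \<subseteq> \<sigma>)"
        then show ?l
        proof
          assume "a = 0"
          then show ?l by (intro exI[of _ "\<lambda>_. 0"]) (simp add: supported_def)
        next
          assume "\<exists>\<omega>\<in>W. \<omega> \<subseteq> \<sigma>"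
          then obtain w where w: "supported w (L (Suc 0)) \<sigma>" "(\<Sum>c<length (L (Suc 0)). d 0 0 c * w c) = 1"
            using exact_0[OF \<sigma>] by blast
          show ?l
          proof (intro exI conjI)
            show "supported (\<lambda>c. a * w c) (L (Suc 0)) \<sigma>" using w(1) by (simp add: supported_def)
            show "a = (\<Sum>c<length (L (Suc 0)). d 0 0 c * (a * w c))"
              using w(2) by (simp add: mult.left_commute flip: sum_distrib_left)
          qed
        qed
      qed
      then have "v \<in> ?B \<longleftrightarrow> (\<forall>\<alpha>. Poly_Mapping.keys \<alpha> \<subseteq> {1..n} \<longrightarrow>
          Poly_Mapping.lookup (v $ 0) \<alpha> = 0 \<or> (\<exists>\<omega>\<in>W. \<omega> \<subseteq> Poly_Mapping.keys \<alpha>))"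
        using matrix_image_iff[OF v] by (simp add: start c0)
      also have "\<dots> \<longleftrightarrow> v $ 0 \<in> I"
      proof -
        have "v $ 0 \<in> I \<longleftrightarrow> (\<forall>\<alpha>. Poly_Mapping.lookup (v $ 0) \<alpha> \<noteq> 0 \<longrightarrow> (\<exists>\<omega>\<in>W. \<omega> \<subseteq> Poly_Mapping.keys \<alpha>))"
          unfolding I using v0 by (simp add: Ball_def in_keys_iff)
        moreover have "Poly_Mapping.keys \<alpha> \<subseteq> {1..n}" if "Poly_Mapping.lookup (v $ 0) \<alpha> \<noteq> 0" for \<alpha>
          using v0 that unfolding poly_ring_def in_keys_iff[symmetric] by blast
        ultimately show ?thesis by blast
      qed
      finally show ?thesis by simp
    qed
    moreover have "?B \<subseteq> free_module n (map card (L 0))"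
      using mult_vec_in_free_module[OF monomial_matrix_graded] by auto
    ultimately show ?thesis by blast
  qed
  fix i
  let ?M = "\<lambda>i. monomial_matrix (L i) (L (Suc i)) (d i)"
  show "{v \<in> free_module n (map card (L (Suc i))). ?M i *\<^sub>v v = 0\<^sub>v (length (map card (L i)))} =
      (*\<^sub>v) (?M (Suc i)) ` free_module n (map card (L (Suc (Suc i))))" (is "?A = ?B")
  proof -
    have "?M i *\<^sub>v v = 0\<^sub>v (length (L i)) \<longleftrightarrow> v \<in> ?B" if v: "v \<in> free_module n (map card (L (Suc i)))" for v
      unfolding matrix_kernel_iff[OF v] matrix_image_iff[OF v] using exact_Suc[OF _ supported_component] by blast
    moreover have "?B \<subseteq> free_module n (map card (L (Suc i)))"
      using mult_vec_in_free_module[OF monomial_matrix_graded] by blast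
    ultimately show ?thesis by auto
  qed
qed (simp_all add: start monomial_matrix_graded)

end

section \<open>The Taylor resolution\<close>

text \<open>
  A fixed enumeration, since free modules are indexed by initial segments of the natural numbers.
\<close>

definition subset_list :: "nat \<Rightarrow> nat \<Rightarrow> nat set list" where
  "subset_list N i = (SOME xs. distinct xs \<and> set xs = {S. S \<subseteq> {..<N} \<and> card S = i})"

lemma subset_list: "distinct (subset_list N i)" "set (subset_list N i) = {S. S \<subseteq> {..<N} \<and> card S = i}"
proof -
  have "finite {S. S \<subseteq> {..<N} \<and> card S = i}" by (rule finite_subset[of _ "Pow {..<N}"]) auto
  from finite_distinct_list[OF this]
  have "\<exists>xs. distinct xs \<and> set xs = {S. S \<subseteq> {..<N} \<and> card S = i}"
    by (elim exE conjE) (intro exI conjI)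
  then have "distinct (subset_list N i) \<and> set (subset_list N i) = {S. S \<subseteq> {..<N} \<and> card S = i}"
    unfolding subset_list_def by (rule someI_ex)
  then show "distinct (subset_list N i)" "set (subset_list N i) = {S. S \<subseteq> {..<N} \<and> card S = i}" by simp_all
qed

lemma subset_list_nth:
  assumes "c < length (subset_list N i)"
  shows "subset_list N i ! c \<subseteq> {..<N}" "card (subset_list N i ! c) = i" "finite (subset_list N i ! c)"
proof -
  have "subset_list N i ! c \<in> {S. S \<subseteq> {..<N} \<and> card S = i}" using nth_mem[OF assms] subset_list(2) by blast
  then show "subset_list N i ! c \<subseteq> {..<N}" "card (subset_list N i ! c) = i" by auto
  then show "finite (subset_list N i ! c)" using finite_subset by blast
qed

lemma subset_list_index:
  assumes "S \<subseteq> {..<N}" "card S = i"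
  obtains c where "c < length (subset_list N i)" "subset_list N i ! c = S"
  using assms subset_list(2)[of N i] by (metis (mono_tags, lifting) in_set_conv_nth mem_Collect_eq)

lemma sum_subset_list:
  "(\<Sum>c<length (subset_list N i). f (subset_list N i ! c)) = (\<Sum>S | S \<subseteq> {..<N} \<and> card S = i. f S)"
  using sum.reindex_bij_betw[OF bij_betw_nth[OF subset_list(1) refl refl], of f] subset_list(2)
  by (simp add: lessThan_atLeast0)

text \<open>
  The entries of the matrix of the simplicial boundary.  At most one summand is nonzero, and all vanish
  unless \<open>T\<close> is a facet of \<open>S\<close>.
\<close>

definition face_coeff :: "nat set \<Rightarrow> nat set \<Rightarrow> 'k::field" where
  "face_coeff T S = (\<Sum>s\<in>S - T. if S = insert s T then facet_sign s T else 0)"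

lemma face_coeff_insert: "s \<notin> T \<Longrightarrow> face_coeff T (insert s T) = facet_sign s T"
  by (simp add: face_coeff_def insert_Diff_if)

lemma face_coeff_nonzero:
  assumes "face_coeff T S \<noteq> 0"
  obtains s where "s \<notin> T" "S = insert s T"
proof -
  obtain s where "s \<in> S - T" "(if S = insert s T then facet_sign s T else 0 :: 'a) \<noteq> 0"
    by (rule sum.not_neutral_contains_not_neutral[OF assms[unfolded face_coeff_def]])
  then show ?thesis using that by (auto split: if_splits)
qed

lemma sum_face_coeff:
  assumes T: "T \<subseteq> {..<N}" "card T = i"
  shows "(\<Sum>c<length (subset_list N (Suc i)). face_coeff T (subset_list N (Suc i) ! c) * f (subset_list N (Suc i) ! c))
    = boundary N f T"
proof -
  have fin: "finite T" using T finite_subset by blast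
  have "(\<Sum>S | S \<subseteq> {..<N} \<and> card S = Suc i. face_coeff T S * f S) = (\<Sum>S\<in>(\<lambda>s. insert s T) ` ({..<N} - T). face_coeff T S * f S)"
  proof (rule sum.mono_neutral_right)
    show "finite {S. S \<subseteq> {..<N} \<and> card S = Suc i}" by (rule finite_subset[of _ "Pow {..<N}"]) auto
    show "(\<lambda>s. insert s T) ` ({..<N} - T) \<subseteq> {S. S \<subseteq> {..<N} \<and> card S = Suc i}" using T fin by auto
    show "\<forall>S\<in>{S. S \<subseteq> {..<N} \<and> card S = Suc i} - (\<lambda>s. insert s T) ` ({..<N} - T). face_coeff T S * f S = 0"
    proof
      fix S assume S: "S \<in> {S. S \<subseteq> {..<N} \<and> card S = Suc i} - (\<lambda>s. insert s T) ` ({..<N} - T)"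
      have "face_coeff T S = (0 :: 'a)"
        by (rule ccontr, erule face_coeff_nonzero) (use S in auto)
      then show "face_coeff T S * f S = 0" by simp
    qed
  qed
  also have "\<dots> = (\<Sum>s\<in>{..<N} - T. face_coeff T (insert s T) * f (insert s T))"
    by (rule sum.reindex_cong[of "\<lambda>s. insert s T"]) (auto simp: inj_on_def)
  also have "\<dots> = boundary N f T" unfolding boundary_def by (rule sum.cong) (auto simp: face_coeff_insert)
  finally show ?thesis
    using sum_subset_list[where N=N and i="Suc i" and f="\<lambda>S. face_coeff T S * f S"] by simp
qed

definition chain_of :: "nat \<Rightarrow> nat \<Rightarrow> (nat \<Rightarrow> 'k::field) \<Rightarrow> nat set \<Rightarrow> 'k" where
  "chain_of N i u S = (\<Sum>c<length (subset_list N i). if subset_list N i ! c = S then u c else 0)"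

lemma chain_of_nth: "c < length (subset_list N i) \<Longrightarrow> chain_of N i u (subset_list N i ! c) = u c"
  using subset_list(1)[of N i] by (simp add: chain_of_def nth_eq_iff_index_eq sum.delta' sum.delta)

lemma chain_of_nonzero:
  assumes "chain_of N i u S \<noteq> 0"
  obtains c where "c < length (subset_list N i)" "subset_list N i ! c = S" "u c \<noteq> 0"
proof -
  obtain c where "c \<in> {..<length (subset_list N i)}" "(if subset_list N i ! c = S then u c else 0) \<noteq> 0"
    by (rule sum.not_neutral_contains_not_neutral[OF assms[unfolded chain_of_def]])
  then show ?thesis using that by (auto split: if_splits)
qed

lemma boundary_wrong_card: "chain_on F j f \<Longrightarrow> finite S \<Longrightarrow> Suc (card S) \<noteq> j \<Longrightarrow> boundary n f S = 0"
  unfolding boundary_def by (intro sum.neutral) (auto simp: chain_on_def)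

lemma simplex_exact:
  assumes A: "A \<subseteq> {..<N}" and f: "chain_on (Pow A) (Suc i) f" and cyc: "cycle_on N (Pow A) f"
  shows "\<exists>y :: nat set \<Rightarrow> 'k::field. chain_on (Pow A) (Suc (Suc i)) y \<and> (\<forall>S. f S = boundary N y S)"
proof -
  have "exact_at TYPE('k) N (Pow A) (Suc i)"
  proof (cases "A = {}")
    case True
    show ?thesis unfolding exact_at_def
    proof (intro allI impI exI conjI ballI)
      show "chain_on (Pow A) (Suc (Suc i)) (\<lambda>_. 0 :: 'k)" by (simp add: chain_on_def)
      fix h :: "nat set \<Rightarrow> 'k" and S
      assume "chain_on (Pow A) (Suc i) h \<and> cycle_on N (Pow A) h"
      then have "h S = 0" using True unfolding chain_on_def by fastforce
      then show "h S = boundary N (\<lambda>_. 0) S" by (simp add: boundary_def)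
    qed
  next
    case False
    then obtain x where "x \<in> A" by blast
    then show ?thesis using A by (intro exact_if_toggle[of _ _ x]) auto
  qed
  then obtain y where y: "chain_on (Pow A) (Suc (Suc i)) y" "\<forall>S\<in>Pow A. f S = boundary N y S"
    using exact_atD[OF _ f cyc] by blast
  have "f S = boundary N y S" for S
  proof (cases "S \<subseteq> A")
    case False
    then have "boundary N y S = 0" unfolding boundary_def using y(1) by (intro sum.neutral) (auto simp: chain_on_def)
    then show ?thesis using f False by (auto simp: chain_on_def)
  qed (use y(2) in auto)
  then show ?thesis using y(1) by blast
qed

definition taylor_labels :: "(nat \<Rightarrow> nat set) \<Rightarrow> nat \<Rightarrow> nat \<Rightarrow> nat set list" where
  "taylor_labels g N i = map (\<lambda>S. \<Union>s\<in>S. g s) (subset_list N i)"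

definition taylor_coeff :: "nat \<Rightarrow> nat \<Rightarrow> nat \<Rightarrow> nat \<Rightarrow> 'k::field" where
  "taylor_coeff N i r c = face_coeff (subset_list N i ! r) (subset_list N (Suc i) ! c)"

lemma length_taylor_labels: "length (taylor_labels g N i) = length (subset_list N i)"
  by (simp add: taylor_labels_def)

lemma nth_taylor_labels: "c < length (subset_list N i) \<Longrightarrow> taylor_labels g N i ! c = (\<Union>s\<in>subset_list N i ! c. g s)"
  by (simp add: taylor_labels_def)

text \<open>
  The generators of multidegree at most \<open>\<sigma>\<close> are the subsets of the set \<open>A\<close> of those \<open>s\<close> with
  \<open>g s \<subseteq> \<sigma>\<close>, so the complex restricted to \<open>\<sigma>\<close> is that of the full simplex on \<open>A\<close>, which is a cone
  unless \<open>A\<close> is empty.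
\<close>

lemma taylor_labelled_resolution:
  assumes g: "\<And>s. s < N \<Longrightarrow> g s \<subseteq> {1..n}"
  shows "labelled_resolution n (g ` {..<N}) (taylor_labels g N) (taylor_coeff N :: nat \<Rightarrow> nat \<Rightarrow> nat \<Rightarrow> 'k::field)"
proof
  let ?L = "taylor_labels g N" and ?sl = "subset_list N"
  let ?d = "taylor_coeff N :: nat \<Rightarrow> nat \<Rightarrow> nat \<Rightarrow> 'k"
  have sl0: "?sl 0 = [{}]"
  proof -
    have "S \<subseteq> {..<N} \<and> card S = 0 \<longleftrightarrow> S = {}" for S
      using finite_subset[of S "{..<N}"] by auto
    then have e: "set (?sl 0) = {{}}" unfolding subset_list(2) by simp
    then have "length (?sl 0) = 1" using distinct_card[OF subset_list(1), of N 0] by simp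
    then obtain S where "?sl 0 = [S]" by (auto simp: length_Suc_conv)
    then show ?thesis using e by simp
  qed
  show "?L 0 = [{}]" by (simp add: taylor_labels_def sl0)
  show "labels_in n (?L i)" for i
    unfolding labels_in_def taylor_labels_def set_map subset_list(2)
  proof
    fix \<sigma> assume "\<sigma> \<in> (\<lambda>S. \<Union>s\<in>S. g s) ` {S. S \<subseteq> {..<N} \<and> card S = i}"
    then obtain S where "S \<subseteq> {..<N}" "\<sigma> = (\<Union>s\<in>S. g s)" by blast
    then show "\<sigma> \<subseteq> {1..n}" using g by (metis UN_least lessThan_iff subsetD)
  qed
  show "?L i ! r \<subseteq> ?L (Suc i) ! c"
    if "r < length (?L i)" "c < length (?L (Suc i))" "?d i r c \<noteq> 0" for i r c
    using that by (auto simp: length_taylor_labels nth_taylor_labels taylor_coeff_def elim!: face_coeff_nonzero)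
  fix \<sigma> :: "nat set"
  define A where "A = {s. s < N \<and> g s \<subseteq> \<sigma>}"
  have A: "A \<subseteq> {..<N}" by (auto simp: A_def)
  have sub: "?L i ! c \<subseteq> \<sigma> \<longleftrightarrow> ?sl i ! c \<subseteq> A" if "c < length (?sl i)" for c i
    using subset_list_nth(1)[OF that] by (auto simp: nth_taylor_labels[OF that] A_def subset_iff)
  have supp: "chain_on (Pow A) i (chain_of N i u)" if "supported u (?L i) \<sigma>" for u :: "nat \<Rightarrow> 'k" and i
    unfolding chain_on_def
  proof (intro allI impI)
    fix S assume "chain_of N i u S \<noteq> 0"
    then obtain c where c: "c < length (?sl i)" "?sl i ! c = S" "u c \<noteq> 0" by (rule chain_of_nonzero)
    then have "?L i ! c \<subseteq> \<sigma>" using that unfolding supported_def by blast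
    then show "S \<in> Pow A \<and> card S = i" using sub[OF c(1)] subset_list_nth(2)[OF c(1)] c(2) by simp
  qed
  have bdsum: "(\<Sum>c<length (?L (Suc i)). ?d i r c * u c) = boundary N f (?sl i ! r)"
    if "r < length (?sl i)" "\<And>c. c < length (?sl (Suc i)) \<Longrightarrow> f (?sl (Suc i) ! c) = u c"
    for i r and u :: "nat \<Rightarrow> 'k" and f
    using sum_face_coeff[OF subset_list_nth(1,2)[OF that(1)], of f] that(2)
    by (simp add: taylor_coeff_def length_taylor_labels)
  show "(\<exists>w. supported w (?L (Suc 0)) \<sigma> \<and> (\<Sum>c<length (?L (Suc 0)). ?d 0 0 c * w c) = 1) \<longleftrightarrow> (\<exists>\<omega>\<in>g ` {..<N}. \<omega> \<subseteq> \<sigma>)"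
  proof
    assume "\<exists>w. supported w (?L (Suc 0)) \<sigma> \<and> (\<Sum>c<length (?L (Suc 0)). ?d 0 0 c * w c) = 1"
    then obtain w where w: "supported w (?L (Suc 0)) \<sigma>" "(\<Sum>c<length (?L (Suc 0)). ?d 0 0 c * w c) \<noteq> 0"
      by (metis zero_neq_one)
    then obtain c where c: "c < length (?L (Suc 0))" "?d 0 0 c * w c \<noteq> 0"
      by (meson lessThan_iff sum.not_neutral_contains_not_neutral)
    then have c': "c < length (?sl (Suc 0))" "?L (Suc 0) ! c \<subseteq> \<sigma>"
      using w(1) by (auto simp: supported_def length_taylor_labels)
    then have "?sl (Suc 0) ! c \<subseteq> A" "card (?sl (Suc 0) ! c) = 1" using sub subset_list_nth(2)[OF c'(1)] by auto
    then obtain s where "s \<in> A" by (metis card_1_singletonE insert_subset)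
    then show "\<exists>\<omega>\<in>g ` {..<N}. \<omega> \<subseteq> \<sigma>" by (auto simp: A_def)
  next
    assume "\<exists>\<omega>\<in>g ` {..<N}. \<omega> \<subseteq> \<sigma>"
    then obtain s where s: "s < N" "g s \<subseteq> \<sigma>" by auto
    obtain c where c: "c < length (?sl (Suc 0))" "?sl (Suc 0) ! c = {s}"
      using subset_list_index[of "{s}" N "Suc 0"] s by auto
    have "?d 0 0 k * (if k = c then 1 else 0) = (if k = c then ?d 0 0 c else 0)" for k by simp
    moreover have "?d 0 0 c = 1" by (simp add: taylor_coeff_def sl0 c face_coeff_insert facet_sign_def)
    ultimately have "(\<Sum>k<length (?L (Suc 0)). ?d 0 0 k * (if k = c then 1 else 0)) = 1"
      using c(1) by (simp add: length_taylor_labels)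
    moreover have "supported (\<lambda>k. if k = c then 1 else 0 :: 'k) (?L (Suc 0)) \<sigma>"
      using c s by (simp add: supported_def length_taylor_labels nth_taylor_labels)
    ultimately show "\<exists>w. supported w (?L (Suc 0)) \<sigma> \<and> (\<Sum>c<length (?L (Suc 0)). ?d 0 0 c * w c) = 1"
      by blast
  qed
  fix u :: "nat \<Rightarrow> 'k" and i assume u: "supported u (?L (Suc i)) \<sigma>"
  show "(\<forall>r<length (?L i). (\<Sum>c<length (?L (Suc i)). ?d i r c * u c) = 0) \<longleftrightarrow>
      (\<exists>w. supported w (?L (Suc (Suc i))) \<sigma> \<and>
         (\<forall>c<length (?L (Suc i)). u c = (\<Sum>k<length (?L (Suc (Suc i))). ?d (Suc i) c k * w k)))"
  proof
    assume ker: "\<forall>r<length (?L i). (\<Sum>c<length (?L (Suc i)). ?d i r c * u c) = 0"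
    let ?f = "chain_of N (Suc i) u"
    have "boundary N ?f S = 0" if S: "S \<in> Pow A" for S
    proof (cases "card S = i")
      case True
      then obtain r where r: "r < length (?sl i)" "?sl i ! r = S" using subset_list_index[of S N i] S A by blast
      then show ?thesis using bdsum[OF r(1), of ?f u] chain_of_nth[of _ N "Suc i" u] ker
        by (simp add: length_taylor_labels)
    next
      case False
      then show ?thesis using boundary_wrong_card[OF supp[OF u], of S] S A finite_subset[of S "{..<N}"] by auto
    qed
    then have "cycle_on N (Pow A) ?f" by (simp add: cycle_on_def)
    then obtain y where y: "chain_on (Pow A) (Suc (Suc i)) y" "\<And>S. ?f S = boundary N y S"
      using simplex_exact[OF A supp[OF u]] by blast
    let ?w = "\<lambda>k. if k < length (?sl (Suc (Suc i))) then y (?sl (Suc (Suc i)) ! k) else 0"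
    have "supported ?w (?L (Suc (Suc i))) \<sigma>"
      unfolding supported_def
    proof (intro allI impI)
      fix k assume "?w k \<noteq> 0"
      then have k: "k < length (?sl (Suc (Suc i)))" "y (?sl (Suc (Suc i)) ! k) \<noteq> 0" by (auto split: if_splits)
      then have "?sl (Suc (Suc i)) ! k \<subseteq> A" using y(1) by (simp add: chain_on_def)
      then show "k < length (?L (Suc (Suc i))) \<and> ?L (Suc (Suc i)) ! k \<subseteq> \<sigma>"
        using sub[OF k(1)] k(1) by (simp add: length_taylor_labels)
    qed
    moreover have "u c = (\<Sum>k<length (?L (Suc (Suc i))). ?d (Suc i) c k * ?w k)" if "c < length (?L (Suc i))" for c
      using bdsum[of c "Suc i" y ?w] chain_of_nth[of c N "Suc i" u] y(2) that by (simp add: length_taylor_labels)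
    ultimately show "\<exists>w. supported w (?L (Suc (Suc i))) \<sigma> \<and>
         (\<forall>c<length (?L (Suc i)). u c = (\<Sum>k<length (?L (Suc (Suc i))). ?d (Suc i) c k * w k))" by blast
  next
    assume "\<exists>w. supported w (?L (Suc (Suc i))) \<sigma> \<and>
         (\<forall>c<length (?L (Suc i)). u c = (\<Sum>k<length (?L (Suc (Suc i))). ?d (Suc i) c k * w k))"
    then obtain w where w: "\<And>c. c < length (?L (Suc i)) \<Longrightarrow> u c = (\<Sum>k<length (?L (Suc (Suc i))). ?d (Suc i) c k * w k)"
      by blast
    let ?h = "chain_of N (Suc (Suc i)) w"
    have "boundary N ?h (?sl (Suc i) ! c) = u c" if "c < length (?sl (Suc i))" for c
      using bdsum[OF that, of ?h w] chain_of_nth[of _ N "Suc (Suc i)" w] w[of c] that by (simp add: length_taylor_labels)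
    then have "(\<Sum>c<length (?L (Suc i)). ?d i r c * u c) = boundary N (boundary N ?h) (?sl i ! r)" if "r < length (?sl i)" for r
      using bdsum[OF that, of "boundary N ?h" u] by blast
    then show "\<forall>r<length (?L i). (\<Sum>c<length (?L (Suc i)). ?d i r c * u c) = 0"
      by (simp add: length_taylor_labels boundary_boundary[OF subset_list_nth(3)])
  qed
qed

section \<open>A minimal resolution of a squarefree monomial ideal\<close>

text \<open>
  Generators of a squarefree module that has the subspace \<open>N \<sigma>\<close> in multidegree \<open>\<sigma>\<close>, each with its
  multidegree.  Minimality says that no relation has a unit coefficient: in a relation of multidegree \<open>\<sigma>\<close>
  the generators of multidegree \<open>\<sigma>\<close> itself have coefficient zero.
\<close>

definition minimal_generators ::
  "nat \<Rightarrow> (nat set \<Rightarrow> (nat \<Rightarrow> 'k::field) set) \<Rightarrow> (nat set \<times> (nat \<Rightarrow> 'k)) list \<Rightarrow> bool" where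
  "minimal_generators n N gs \<longleftrightarrow>
     (\<forall>g\<in>set gs. fst g \<subseteq> {1..n} \<and> snd g \<in> N (fst g)) \<and>
     (\<forall>\<sigma> v. \<sigma> \<subseteq> {1..n} \<and> v \<in> N \<sigma> \<longrightarrow>
        (\<exists>a. supported a (map fst gs) \<sigma> \<and> (\<forall>x. v x = (\<Sum>k<length gs. a k * snd (gs ! k) x)))) \<and>
     (\<forall>\<sigma> a k. supported a (map fst gs) \<sigma> \<and> (\<forall>x. (\<Sum>k<length gs. a k * snd (gs ! k) x) = 0) \<and>
        k < length gs \<and> fst (gs ! k) = \<sigma> \<longrightarrow> a k = 0)"

lemma minimal_generators_mem:
  assumes "minimal_generators n N gs" "g \<in> set gs"
  shows "fst g \<subseteq> {1..n}" "snd g \<in> N (fst g)"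
  using assms by (simp_all add: minimal_generators_def)

lemma minimal_generators_span:
  assumes "minimal_generators n N gs" "\<sigma> \<subseteq> {1..n}" "v \<in> N \<sigma>"
  shows "\<exists>a. supported a (map fst gs) \<sigma> \<and> (\<forall>x. v x = (\<Sum>k<length gs. a k * snd (gs ! k) x))"
  using assms by (simp add: minimal_generators_def)

lemma minimal_generators_relation:
  assumes "minimal_generators n N gs" "supported a (map fst gs) \<sigma>"
    "\<forall>x. (\<Sum>k<length gs. a k * snd (gs ! k) x) = 0" "k < length gs" "fst (gs ! k) = \<sigma>"
  shows "a k = 0"
  using assms by (simp add: minimal_generators_def)

lemma sum_nth_distinct:
  assumes "distinct xs"
  shows "(\<Sum>k<length xs. f (xs ! k)) = sum f (set xs)"
  using sum.reindex_bij_betw[OF bij_betw_nth[OF assms refl refl], of f] .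

text \<open>
  Bases of the finitely many spaces \<open>N \<sigma>\<close> generate.  A generating set of least cardinality is minimal,
  because a generator that occurs with a unit coefficient in a relation is redundant.
\<close>

lemma minimal_generators_exist:
  fixes N :: "nat set \<Rightarrow> (nat \<Rightarrow> 'k::field) set"
  assumes B: "finite B" "\<And>\<sigma> u x. u \<in> N \<sigma> \<Longrightarrow> u x \<noteq> 0 \<Longrightarrow> x \<in> B"
    and sub: "\<And>\<sigma> u v c. u \<in> N \<sigma> \<Longrightarrow> v \<in> N \<sigma> \<Longrightarrow> (\<lambda>x. u x - c * v x) \<in> N \<sigma>"
  shows "\<exists>gs. minimal_generators n N gs"
proof -
  define spans where "spans G \<sigma> v \<longleftrightarrow>
    (\<exists>a. (\<forall>g\<in>G. a g \<noteq> 0 \<longrightarrow> fst g \<subseteq> \<sigma>) \<and> (\<forall>x. v x = (\<Sum>g\<in>G. a g * snd g x)))"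
    for G :: "(nat set \<times> (nat \<Rightarrow> 'k)) set" and \<sigma> v
  define gen where "gen G \<longleftrightarrow> finite G \<and> (\<forall>g\<in>G. fst g \<subseteq> {1..n} \<and> snd g \<in> N (fst g)) \<and>
    (\<forall>\<sigma> v. \<sigma> \<subseteq> {1..n} \<and> v \<in> N \<sigma> \<longrightarrow> spans G \<sigma> v)" for G
  have genD: "spans G \<sigma> v" if "gen G" "\<sigma> \<subseteq> {1..n} \<and> v \<in> N \<sigma>" for G \<sigma> v
    using that by (simp add: gen_def)
  have "\<exists>U. finite U \<and> U \<subseteq> N \<sigma> \<and> (\<forall>v\<in>N \<sigma>. \<exists>a. \<forall>x. v x = (\<Sum>u\<in>U. a u * u x))" for \<sigma>
    by (rule subspace_finitely_generated[OF B(1)]) (use B sub in auto)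
  then obtain U where U: "\<And>\<sigma>. finite (U \<sigma>)" "\<And>\<sigma>. U \<sigma> \<subseteq> N \<sigma>"
    "\<And>\<sigma> v. v \<in> N \<sigma> \<Longrightarrow> \<exists>a. \<forall>x. v x = (\<Sum>u\<in>U \<sigma>. a u * u x)"
    by metis
  have "gen (Sigma (Pow {1..n}) U)"
    unfolding gen_def
  proof (intro conjI allI impI)
    show "finite (Sigma (Pow {1..n}) U)" using U(1) by blast
    show "\<forall>g\<in>Sigma (Pow {1..n}) U. fst g \<subseteq> {1..n} \<and> snd g \<in> N (fst g)" using U(2) by auto
    fix \<sigma> v assume h: "\<sigma> \<subseteq> {1..n} \<and> v \<in> N \<sigma>"
    then obtain a where a: "\<And>x. v x = (\<Sum>u\<in>U \<sigma>. a u * u x)" using U(3) by blast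
    let ?b = "\<lambda>(\<tau>, u). if \<tau> = \<sigma> then a u else 0"
    have "(\<Sum>g\<in>Sigma (Pow {1..n}) U. ?b g * snd g x) = (\<Sum>\<tau>\<in>Pow {1..n}. \<Sum>u\<in>U \<tau>. ?b (\<tau>, u) * u x)" for x
      using sum.Sigma[of "Pow {1..n}" U "\<lambda>\<tau> u. ?b (\<tau>, u) * u x"] U(1) by (simp add: case_prod_beta)
    also have "\<dots> x = (\<Sum>\<tau>\<in>Pow {1..n}. if \<tau> = \<sigma> then v x else 0)" for x
      by (intro sum.cong refl) (auto simp: a)
    finally have "v x = (\<Sum>g\<in>Sigma (Pow {1..n}) U. ?b g * snd g x)" for x
      using h by simp
    moreover have "\<forall>g\<in>Sigma (Pow {1..n}) U. ?b g \<noteq> 0 \<longrightarrow> fst g \<subseteq> \<sigma>" by auto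
    ultimately show "spans (Sigma (Pow {1..n}) U) \<sigma> v" unfolding spans_def by blast
  qed
  then obtain G where G: "gen G" "\<And>G'. gen G' \<Longrightarrow> card G \<le> card G'"
    using ex_has_least_nat[of gen _ card] by blast
  have finG: "finite G" using G(1) by (simp add: gen_def)
  \<comment> \<open>a relation that involves a generator in its own degree makes that generator redundant\<close>
  have minimal: "a g = 0" if g: "g \<in> G" and a: "\<And>h. h \<in> G \<Longrightarrow> a h \<noteq> 0 \<Longrightarrow> fst h \<subseteq> fst g"
     and rel: "\<And>x. (\<Sum>h\<in>G. a h * snd h x) = 0" for g a
  proof (rule ccontr)
    assume ag: "a g \<noteq> 0"
    have "gen (G - {g})"
      unfolding gen_def
    proof (intro conjI allI impI)
      show "finite (G - {g})" using finG by simp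
      show "\<forall>g\<in>G - {g}. fst g \<subseteq> {1..n} \<and> snd g \<in> N (fst g)" using G(1) by (simp add: gen_def)
      fix \<sigma> v assume "\<sigma> \<subseteq> {1..n} \<and> v \<in> N \<sigma>"
      then have "spans G \<sigma> v" by (rule genD[OF G(1)])
      then obtain b where b: "\<And>h. h \<in> G \<Longrightarrow> b h \<noteq> 0 \<Longrightarrow> fst h \<subseteq> \<sigma>" "\<And>x. v x = (\<Sum>h\<in>G. b h * snd h x)"
        unfolding spans_def by blast
      let ?c = "\<lambda>h. b h - b g / a g * a h"
      have "(\<Sum>h\<in>G - {g}. ?c h * snd h x) = (\<Sum>h\<in>G. ?c h * snd h x)" for x
        using finG g ag by (simp add: sum.remove)
      also have "\<dots> x = (\<Sum>h\<in>G. b h * snd h x) - b g / a g * (\<Sum>h\<in>G. a h * snd h x)" for x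
        unfolding sum_distrib_left by (simp add: algebra_simps sum_subtractf)
      finally have "v x = (\<Sum>h\<in>G - {g}. ?c h * snd h x)" for x using b(2) rel by simp
      moreover have "fst h \<subseteq> \<sigma>" if "h \<in> G - {g}" "?c h \<noteq> 0" for h
      proof (cases "b h = 0")
        case True
        then have "b g \<noteq> 0" "a h \<noteq> 0" using that by auto
        then show ?thesis using b(1)[OF g] a[of h] that by blast
      qed (use b(1) that in blast)
      ultimately show "spans (G - {g}) \<sigma> v"
        unfolding spans_def by (intro exI[of _ ?c] conjI ballI allI impI)
    qed
    then have "card G \<le> card (G - {g})" by (rule G(2))
    then show False using card_Diff1_less[OF finG g] by simp
  qed
  obtain gs where gs: "set gs = G" "distinct gs" using finite_distinct_list[OF finG] by blast
  have "minimal_generators n N gs"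
    unfolding minimal_generators_def
  proof (intro conjI allI impI)
    show "\<forall>g\<in>set gs. fst g \<subseteq> {1..n} \<and> snd g \<in> N (fst g)" using G(1) gs by (simp add: gen_def)
    fix \<sigma> v assume "\<sigma> \<subseteq> {1..n} \<and> v \<in> N \<sigma>"
    then have "spans G \<sigma> v" by (rule genD[OF G(1)])
    then obtain a where a: "\<And>g. g \<in> G \<Longrightarrow> a g \<noteq> 0 \<Longrightarrow> fst g \<subseteq> \<sigma>" "\<And>x. v x = (\<Sum>g\<in>G. a g * snd g x)"
      unfolding spans_def by blast
    let ?b = "\<lambda>k. if k < length gs then a (gs ! k) else 0"
    have "supported ?b (map fst gs) \<sigma>"
      unfolding supported_def
    proof (intro allI impI)
      fix k assume "?b k \<noteq> 0"
      then have k: "k < length gs" "a (gs ! k) \<noteq> 0" by (auto split: if_splits)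
      then have "fst (gs ! k) \<subseteq> \<sigma>" using a(1) gs(1) nth_mem by blast
      then show "k < length (map fst gs) \<and> map fst gs ! k \<subseteq> \<sigma>" using k by simp
    qed
    moreover have "v x = (\<Sum>k<length gs. ?b k * snd (gs ! k) x)" for x
      using sum_nth_distinct[OF gs(2), of "\<lambda>g. a g * snd g x"] gs a(2) by simp
    ultimately show "\<exists>a. supported a (map fst gs) \<sigma> \<and> (\<forall>x. v x = (\<Sum>k<length gs. a k * snd (gs ! k) x))"
      by blast
  next
    fix \<sigma> a k
    assume h: "supported a (map fst gs) \<sigma> \<and> (\<forall>x. (\<Sum>k<length gs. a k * snd (gs ! k) x) = 0) \<and>
        k < length gs \<and> fst (gs ! k) = \<sigma>"
    define b where "b g = a (inv_into {..<length gs} ((!) gs) g)" for g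
    have inj: "inj_on ((!) gs) {..<length gs}" using gs(2) by (simp add: inj_on_nth)
    have b: "b (gs ! j) = a j" if "j < length gs" for j using that inj by (simp add: b_def inv_into_f_f)
    have "b (gs ! k) = 0"
    proof (rule minimal)
      show "gs ! k \<in> G" using h gs by auto
      show "fst g \<subseteq> fst (gs ! k)" if "g \<in> G" "b g \<noteq> 0" for g
      proof -
        have "g \<in> set gs" using that(1) gs(1) by simp
        then obtain j where "j < length gs" "g = gs ! j" by (auto simp: in_set_conv_nth)
        then have "j < length gs" "a j \<noteq> 0" "g = gs ! j" using that(2) b by auto
        moreover have "supported a (map fst gs) \<sigma>" using h by simp
        ultimately have "map fst gs ! j \<subseteq> \<sigma>" unfolding supported_def by blast
        then show ?thesis using \<open>j < length gs\<close> \<open>g = gs ! j\<close> h by simp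
      qed
      fix x
      have "(\<Sum>g\<in>G. b g * snd g x) = (\<Sum>k<length gs. b (gs ! k) * snd (gs ! k) x)"
        unfolding sum_nth_distinct[OF gs(2), of "\<lambda>g. b g * snd g x"] gs(1) ..
      also have "\<dots> = (\<Sum>k<length gs. a k * snd (gs ! k) x)"
        by (rule sum.cong) (simp_all add: b)
      also have "\<dots> = 0" using h by blast
      finally show "(\<Sum>g\<in>G. b g * snd g x) = 0" .
    qed
    then show "a k = 0" using b h by simp
  qed
  then show ?thesis ..
qed

definition relations :: "(nat set \<times> (nat \<Rightarrow> 'k::field)) list \<Rightarrow> nat set \<Rightarrow> (nat \<Rightarrow> 'k) set" where
  "relations gs \<sigma> = {a. supported a (map fst gs) \<sigma> \<and> (\<forall>x. (\<Sum>k<length gs. a k * snd (gs ! k) x) = 0)}"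

text \<open>
  The squarefree multidegrees of the ideal, as a submodule of \<open>R\<close>: a scalar, stored in coordinate \<open>0\<close>,
  which can be nonzero only if the monomial with support \<open>\<sigma>\<close> lies in the ideal.
\<close>

definition ideal_part :: "nat set set \<Rightarrow> nat set \<Rightarrow> (nat \<Rightarrow> 'k::field) set" where
  "ideal_part W \<sigma> = {u. (\<forall>x. u x \<noteq> 0 \<longrightarrow> x = 0 \<and> (\<exists>\<omega>\<in>W. \<omega> \<subseteq> \<sigma>))}"

text \<open>
  Minimal generators of the ideal, then of the module of their relations, and so on.
\<close>

primrec syzygies :: "nat \<Rightarrow> nat set set \<Rightarrow> nat \<Rightarrow> (nat set \<times> (nat \<Rightarrow> 'k::field)) list" where
  "syzygies n W 0 = (SOME gs. minimal_generators n (ideal_part W) gs)"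
| "syzygies n W (Suc i) = (SOME gs. minimal_generators n (relations (syzygies n W i)) gs)"

lemma syzygies_minimal:
  "minimal_generators n (case i of 0 \<Rightarrow> ideal_part W | Suc k \<Rightarrow> relations (syzygies n W k))
     (syzygies n W i :: (nat set \<times> (nat \<Rightarrow> 'k::field)) list)"
proof (cases i)
  case 0
  have "\<exists>gs :: (nat set \<times> (nat \<Rightarrow> 'k)) list. minimal_generators n (ideal_part W) gs"
  proof (rule minimal_generators_exist[of "{0}"])
    show "x \<in> {0}" if "u \<in> ideal_part W \<sigma>" "u x \<noteq> 0" for \<sigma> x and u :: "nat \<Rightarrow> 'k"
      using that by (auto simp: ideal_part_def)
    fix \<sigma> c and u v :: "nat \<Rightarrow> 'k" assume "u \<in> ideal_part W \<sigma>" "v \<in> ideal_part W \<sigma>"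
    moreover have "u x \<noteq> 0 \<or> v x \<noteq> 0" if "u x - c * v x \<noteq> 0" for x using that by auto
    ultimately show "(\<lambda>x. u x - c * v x) \<in> ideal_part W \<sigma>" unfolding ideal_part_def by blast
  qed simp
  then show ?thesis unfolding 0 syzygies.simps nat.case by (rule someI_ex)
next
  case (Suc j)
  let ?gs = "syzygies n W j :: (nat set \<times> (nat \<Rightarrow> 'k)) list"
  have "\<exists>gs. minimal_generators n (relations ?gs) gs"
  proof (rule minimal_generators_exist[of "{..<length ?gs}"])
    show "x \<in> {..<length ?gs}" if "u \<in> relations ?gs \<sigma>" "u x \<noteq> 0" for \<sigma> u x
      using that by (auto simp: relations_def supported_def)
    fix \<sigma> u v and c :: 'k assume uv: "u \<in> relations ?gs \<sigma>" "v \<in> relations ?gs \<sigma>"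
    have "(\<Sum>k<length ?gs. (u k - c * v k) * snd (?gs ! k) x)
      = (\<Sum>k<length ?gs. u k * snd (?gs ! k) x) - c * (\<Sum>k<length ?gs. v k * snd (?gs ! k) x)" for x
      by (simp add: algebra_simps sum_subtractf sum_distrib_left)
    moreover have "u x \<noteq> 0 \<or> v x \<noteq> 0" if "u x - c * v x \<noteq> 0" for x using that by auto
    then have "supported (\<lambda>x. u x - c * v x) (map fst ?gs) \<sigma>"
      using uv unfolding relations_def supported_def by blast
    ultimately show "(\<lambda>x. u x - c * v x) \<in> relations ?gs \<sigma>" using uv by (simp add: relations_def)
  qed simp
  then show ?thesis unfolding Suc syzygies.simps nat.case by (rule someI_ex)
qed

definition syzygy_labels :: "'k::field itself \<Rightarrow> nat \<Rightarrow> nat set set \<Rightarrow> nat \<Rightarrow> nat set list" where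
  "syzygy_labels _ n W i = (case i of 0 \<Rightarrow> [{}] | Suc k \<Rightarrow> map fst (syzygies n W k :: (nat set \<times> (nat \<Rightarrow> 'k)) list))"

definition syzygy_coeff :: "nat \<Rightarrow> nat set set \<Rightarrow> nat \<Rightarrow> nat \<Rightarrow> nat \<Rightarrow> 'k::field" where
  "syzygy_coeff n W i r c = snd (syzygies n W i ! c) r"

lemma syzygy_in:
  assumes "c < length (syzygies n W i :: (nat set \<times> (nat \<Rightarrow> 'k::field)) list)"
  shows "fst (syzygies n W i ! c :: _ \<times> (nat \<Rightarrow> 'k)) \<subseteq> {1..n}"
    and "snd (syzygies n W i ! c :: _ \<times> (nat \<Rightarrow> 'k)) \<in>
      (case i of 0 \<Rightarrow> ideal_part W | Suc k \<Rightarrow> relations (syzygies n W k)) (fst (syzygies n W i ! c :: _ \<times> (nat \<Rightarrow> 'k)))"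
  using minimal_generators_mem[OF syzygies_minimal nth_mem[OF assms]] .

lemma syzygy_support:
  assumes "c < length (syzygies n W i :: (nat set \<times> (nat \<Rightarrow> 'k::field)) list)"
    "snd (syzygies n W i ! c) r \<noteq> (0 :: 'k)"
  shows "r < length (syzygy_labels TYPE('k) n W i)"
    "syzygy_labels TYPE('k) n W i ! r \<subseteq> fst (syzygies n W i ! c :: _ \<times> (nat \<Rightarrow> 'k))"
  using syzygy_in(2)[OF assms(1)] assms(2)
  by (cases i; auto simp: syzygy_labels_def ideal_part_def relations_def supported_def)+

lemma syzygies_labelled_resolution:
  "labelled_resolution n W (syzygy_labels TYPE('k::field) n W) (syzygy_coeff n W :: nat \<Rightarrow> nat \<Rightarrow> nat \<Rightarrow> 'k)"
proof
  let ?gs = "syzygies n W :: nat \<Rightarrow> (nat set \<times> (nat \<Rightarrow> 'k::field)) list"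
  let ?L = "syzygy_labels TYPE('k) n W"
  let ?d = "syzygy_coeff n W :: nat \<Rightarrow> nat \<Rightarrow> nat \<Rightarrow> 'k"
  have LS: "?L (Suc i) = map fst (?gs i)" for i by (simp add: syzygy_labels_def)
  show "?L 0 = [{}]" by (simp add: syzygy_labels_def)
  show "labels_in n (?L i)" for i
    using syzygy_in(1)[of _ n W, where 'k='k]
    by (cases i) (fastforce simp: labels_in_def syzygy_labels_def in_set_conv_nth)+
  show "?L i ! r \<subseteq> ?L (Suc i) ! c" if "c < length (?L (Suc i))" "?d i r c \<noteq> 0" for i r c
    using that syzygy_support(2)[of c n W i r] by (simp add: LS syzygy_coeff_def)
  have comm: "(\<Sum>c<m. ?d i r c * u c) = (\<Sum>c<m. u c * snd (?gs i ! c) r)" for m i r u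
    by (simp add: syzygy_coeff_def mult.commute)
  fix \<sigma> :: "nat set" assume \<sigma>: "\<sigma> \<subseteq> {1..n}"
  show "(\<exists>w. supported w (?L (Suc 0)) \<sigma> \<and> (\<Sum>c<length (?L (Suc 0)). ?d 0 0 c * w c) = 1) \<longleftrightarrow> (\<exists>\<omega>\<in>W. \<omega> \<subseteq> \<sigma>)"
  proof
    assume "\<exists>w. supported w (?L (Suc 0)) \<sigma> \<and> (\<Sum>c<length (?L (Suc 0)). ?d 0 0 c * w c) = 1"
    then obtain w where w: "supported w (?L (Suc 0)) \<sigma>" "(\<Sum>c<length (?L (Suc 0)). ?d 0 0 c * w c) \<noteq> 0"
      by (metis zero_neq_one)
    then obtain c where c: "c < length (?L (Suc 0))" "?d 0 0 c * w c \<noteq> 0"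
      by (meson lessThan_iff sum.not_neutral_contains_not_neutral)
    then have c': "w c \<noteq> 0" "snd (?gs 0 ! c) 0 \<noteq> 0" "c < length (?gs 0)"
      by (auto simp: syzygy_coeff_def LS simp del: syzygies.simps)
    then have "fst (?gs 0 ! c) \<subseteq> \<sigma>"
      using w(1) by (metis LS nth_map supported_def)
    moreover have "snd (?gs 0 ! c) \<in> ideal_part W (fst (?gs 0 ! c))"
      using syzygy_in(2)[OF c'(3)] by (simp del: syzygies.simps)
    then have "\<exists>\<omega>\<in>W. \<omega> \<subseteq> fst (?gs 0 ! c)" using c'(2) by (simp add: ideal_part_def del: syzygies.simps)
    ultimately show "\<exists>\<omega>\<in>W. \<omega> \<subseteq> \<sigma>" by blast
  next
    assume "\<exists>\<omega>\<in>W. \<omega> \<subseteq> \<sigma>"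
    then have "(\<lambda>x. if x = 0 then 1 else 0) \<in> ideal_part W \<sigma>" by (auto simp: ideal_part_def)
    then obtain a where "supported a (map fst (?gs 0)) \<sigma>"
      "\<And>x. (if x = 0 then 1 else 0) = (\<Sum>k<length (?gs 0). a k * snd (?gs 0 ! k) x)"
      using minimal_generators_span[OF syzygies_minimal[of n W 0, where 'k='k, unfolded nat.case] \<sigma>] by blast
    from this(1) this(2)[of 0] show "\<exists>w. supported w (?L (Suc 0)) \<sigma> \<and> (\<Sum>c<length (?L (Suc 0)). ?d 0 0 c * w c) = 1"
      unfolding comm LS length_map by (intro exI[of _ a]) simp
  qed
  fix u :: "nat \<Rightarrow> 'k" and i assume u: "supported u (?L (Suc i)) \<sigma>"
  have rel: "(\<forall>r<length (?L i). (\<Sum>c<length (?L (Suc i)). ?d i r c * u c) = 0) \<longleftrightarrow> u \<in> relations (?gs i) \<sigma>"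
  proof -
    have "snd (?gs i ! c) r = 0" if "\<not> r < length (?L i)" "c < length (?gs i)" for r c
      using syzygy_support(1)[of c n W i r] that by blast
    then have "(\<Sum>c<length (?gs i). u c * snd (?gs i ! c) r) = 0" if "\<not> r < length (?L i)" for r
      using that by (intro sum.neutral) auto
    then show ?thesis using u unfolding relations_def comm LS length_map by blast
  qed
  show "(\<forall>r<length (?L i). (\<Sum>c<length (?L (Suc i)). ?d i r c * u c) = 0) \<longleftrightarrow>
      (\<exists>w. supported w (?L (Suc (Suc i))) \<sigma> \<and>
         (\<forall>c<length (?L (Suc i)). u c = (\<Sum>k<length (?L (Suc (Suc i))). ?d (Suc i) c k * w k)))"
    unfolding rel
  proof
    assume "u \<in> relations (?gs i) \<sigma>"
    then obtain a where a: "supported a (map fst (?gs (Suc i))) \<sigma>"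
      "\<And>x. u x = (\<Sum>k<length (?gs (Suc i)). a k * snd (?gs (Suc i) ! k) x)"
      using minimal_generators_span[OF syzygies_minimal[of n W "Suc i", where 'k='k, unfolded nat.case] \<sigma>] by blast
    then show "\<exists>w. supported w (?L (Suc (Suc i))) \<sigma> \<and>
         (\<forall>c<length (?L (Suc i)). u c = (\<Sum>k<length (?L (Suc (Suc i))). ?d (Suc i) c k * w k))"
      unfolding comm LS length_map by blast
  next
    assume "\<exists>w. supported w (?L (Suc (Suc i))) \<sigma> \<and>
         (\<forall>c<length (?L (Suc i)). u c = (\<Sum>k<length (?L (Suc (Suc i))). ?d (Suc i) c k * w k))"
    then obtain w where w: "\<And>c. c < length (?gs i) \<Longrightarrow> u c = (\<Sum>k<length (?gs (Suc i)). w k * snd (?gs (Suc i) ! k) c)"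
      unfolding comm LS length_map by blast
    have "(\<Sum>c<length (?gs i). u c * snd (?gs i ! c) x) = 0" for x
    proof -
      have "(\<Sum>c<length (?gs i). u c * snd (?gs i ! c) x)
        = (\<Sum>c<length (?gs i). \<Sum>k<length (?gs (Suc i)). w k * (snd (?gs (Suc i) ! k) c * snd (?gs i ! c) x))"
        using w by (simp add: sum_distrib_right mult.assoc)
      also have "\<dots> = (\<Sum>k<length (?gs (Suc i)). w k * (\<Sum>c<length (?gs i). snd (?gs (Suc i) ! k) c * snd (?gs i ! c) x))"
        unfolding sum_distrib_left by (rule sum.swap)
      also have "\<dots> = 0"
      proof (intro sum.neutral ballI)
        fix k assume "k \<in> {..<length (?gs (Suc i))}"
        then have "snd (?gs (Suc i) ! k) \<in> relations (?gs i) (fst (?gs (Suc i) ! k))"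
          using syzygy_in(2)[of k n W "Suc i", where 'k='k] by (simp del: syzygies.simps)
        then show "w k * (\<Sum>c<length (?gs i). snd (?gs (Suc i) ! k) c * snd (?gs i ! c) x) = 0"
          by (simp add: relations_def del: syzygies.simps)
      qed
      finally show ?thesis .
    qed
    then show "u \<in> relations (?gs i) \<sigma>" using u by (simp add: relations_def LS)
  qed
qed

text \<open>
  By minimality a relation never involves a generator of its own multidegree; in homological degree \<open>0\<close>
  this says that the ideal does not contain \<open>1\<close>.
\<close>

lemma syzygy_coeff_strict:
  assumes W: "{} \<notin> W" and c: "c < length (syzygies n W i :: (nat set \<times> (nat \<Rightarrow> 'k::field)) list)"
    and nz: "syzygy_coeff n W i r c \<noteq> (0 :: 'k)"
  shows "syzygy_labels TYPE('k) n W i ! r \<noteq> syzygy_labels TYPE('k) n W (Suc i) ! c"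
proof
  assume eq: "syzygy_labels TYPE('k) n W i ! r = syzygy_labels TYPE('k) n W (Suc i) ! c"
  let ?gs = "syzygies n W :: nat \<Rightarrow> (nat set \<times> (nat \<Rightarrow> 'k::field)) list"
  have nz': "snd (?gs i ! c) r \<noteq> 0" using nz by (simp add: syzygy_coeff_def)
  show False
  proof (cases i)
    case 0
    then have "r = 0" using syzygy_support(1)[OF c nz'] by (simp add: syzygy_labels_def)
    then have "fst (?gs 0 ! c) = {}" using eq c 0 by (simp add: syzygy_labels_def del: syzygies.simps)
    then show False using syzygy_in(2)[OF c] nz' W 0 by (auto simp: ideal_part_def simp del: syzygies.simps)
  next
    case (Suc j)
    have r: "r < length (?gs j)" using syzygy_support(1)[OF c nz'] Suc by (simp add: syzygy_labels_def)
    have "snd (?gs i ! c) \<in> relations (?gs j) (fst (?gs i ! c))"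
      using syzygy_in(2)[OF c] Suc by (simp del: syzygies.simps)
    then have rel: "supported (snd (?gs i ! c)) (map fst (?gs j)) (fst (?gs i ! c))"
      "\<forall>x. (\<Sum>k<length (?gs j). snd (?gs i ! c) k * snd (?gs j ! k) x) = 0"
      by (simp_all add: relations_def del: syzygies.simps)
    have "fst (?gs j ! r) = fst (?gs i ! c)"
      using eq r c Suc by (simp add: syzygy_labels_def del: syzygies.simps)
    then show False
      using minimal_generators_relation[OF syzygies_minimal rel r] nz' by simp
  qed
qed

section \<open>Betti numbers in the top squarefree degree\<close>

text \<open>
  Reduction of a matrix modulo the ideal generated by the variables.
\<close>

definition const_term :: "'k::field mpoly mat \<Rightarrow> nat \<Rightarrow> nat \<Rightarrow> 'k" where
  "const_term A r c = Poly_Mapping.lookup (A $$ (r, c)) 0"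

lemma const_term_mult:
  assumes "A \<in> carrier_mat nr m" "B \<in> carrier_mat m nc" "r < nr" "c < nc"
  shows "const_term (A * B) r c = (\<Sum>k<m. const_term A r k * const_term B k c)"
  unfolding const_term_def mult_entry[OF assms] by (simp add: lookup_sum lookup_mult_0)

lemma const_term_one: "r < m \<Longrightarrow> c < m \<Longrightarrow> const_term (1\<^sub>m m) r c = (if r = c then 1 else 0)"
  by (simp add: const_term_def)

lemma const_term_diff:
  assumes "A \<in> carrier_mat nr nc" "B \<in> carrier_mat nr nc" "r < nr" "c < nc"
  shows "const_term (A - B) r c = const_term A r c - const_term B r c"
  using assms by (simp add: const_term_def lookup_minus)

lemma const_term_degree:
  assumes "A \<in> graded_maps n ds es" "r < length ds" "c < length es" "const_term A r c \<noteq> 0"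
  shows "ds ! r = es ! c"
proof -
  have "0 \<in> Poly_Mapping.keys (A $$ (r, c))" using assms(4) by (simp add: const_term_def in_keys_iff)
  moreover have "homogeneous (ds ! r) (es ! c) (A $$ (r, c))" using assms(1-3) by (simp add: graded_maps_iff)
  ultimately show ?thesis unfolding homogeneous_def using mon_degree_0 by (metis add.left_neutral)
qed

lemma const_term_maximal_ideal:
  assumes "f \<in> ideal_gen n (var ` {1..n})"
  shows "Poly_Mapping.lookup f 0 = 0"
proof -
  obtain A c where A: "A \<subseteq> var ` {1..n}" "f = (\<Sum>g\<in>A. c g * g)"
    using assms unfolding ideal_gen_def by blast
  have "Poly_Mapping.lookup (var i) 0 = (0 :: 'a)" for i
  proof -
    have "Poly_Mapping.single i (1::nat) \<noteq> 0" by (metis lookup_single_eq lookup_zero zero_neq_one)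
    then show ?thesis by (simp add: var_def lookup_single when_def)
  qed
  then have "Poly_Mapping.lookup g 0 = 0" if "g \<in> A" for g using A(1) that by auto
  then show ?thesis by (simp add: A(2) lookup_sum lookup_mult_0)
qed

text \<open>
  Modulo the variables only the entries between generators with equal labels survive.
\<close>

lemma const_term_monomial_matrix:
  assumes L: "labels_in n L'" and rc: "r < length L" "c < length L'"
    and d: "d r c \<noteq> 0 \<Longrightarrow> L ! r \<subseteq> L' ! c"
  shows "const_term (monomial_matrix L L' d) r c = (if L ! r = L' ! c then d r c else 0)"
proof -
  have fin: "finite (L' ! c - L ! r)" using labels_inD[OF L rc(2)] by blast
  have z: "sqfree_mon (L' ! c - L ! r) = 0 \<longleftrightarrow> L' ! c - L ! r = {}"
    using keys_sqfree_mon[OF fin] by (metis keys_zero sqfree_mon_def sum.empty)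
  show ?thesis
    using rc d z by (auto simp: const_term_def monomial_matrix_def lookup_single when_def)
qed

text \<open>
  Translates sums over members of \<open>C\<close> into sums over the index set of the Taylor resolution.
\<close>

lemma sum_chain_of:
  assumes C: "C \<subseteq> Pow {..<N}"
  shows "(\<Sum>S\<in>{S \<in> C. card S = i}. chain_of N i u S * z S)
    = (\<Sum>r<length (subset_list N i). u r * restr C z (subset_list N i ! r))"
proof -
  have "(\<Sum>r<length (subset_list N i). u r * restr C z (subset_list N i ! r))
      = (\<Sum>r<length (subset_list N i). chain_of N i u (subset_list N i ! r) * restr C z (subset_list N i ! r))"
    by (simp add: chain_of_nth)
  also have "\<dots> = (\<Sum>S | S \<subseteq> {..<N} \<and> card S = i. chain_of N i u S * restr C z S)"
    by (rule sum_subset_list[where f="\<lambda>S. chain_of N i u S * restr C z S"])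
  also have "\<dots> = (\<Sum>S\<in>{S \<in> C. card S = i}. chain_of N i u S * z S)"
  proof (rule sum.mono_neutral_cong_right)
    show "finite {S. S \<subseteq> {..<N} \<and> card S = i}" by (rule finite_subset[of _ "Pow {..<N}"]) auto
  qed (use C in \<open>auto simp: restr_def\<close>)
  finally show ?thesis ..
qed

lemma restr_id: "chain_on C i z \<Longrightarrow> restr C z = z"
  by (rule ext) (auto simp: restr_def chain_on_def)

text \<open>
  Let \<open>G\<close> be the Taylor resolution, with differentials \<open>E\<close>, let \<open>f\<close> and \<open>h\<close> be comparison maps between
  \<open>F\<close> and \<open>G\<close>, and \<open>p\<close> and \<open>q\<close> homotopies from the composites to the identity.  Modulo the variables \<open>D\<close>
  vanishes, which turns the homotopy on \<open>F\<close> into \<open>h f = 1\<close>.  A generator of \<open>G\<close> has degree \<open>n\<close> iff its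
  label is \<open>{1..n}\<close>, that is, iff it belongs to \<open>C\<close>.  As matrices over \<open>K\<close> respect degrees, the
  degree \<open>n\<close> parts of \<open>f\<close> and \<open>h\<close> make the generators of \<open>F\<^sub>i\<close> in degree \<open>n\<close> a retract of the complex
  of \<open>C\<close>.
\<close>

lemma top_betti_number_eq_homology:
  fixes I :: "'k::field mpoly set"
  assumes g: "\<And>s. s < N \<Longrightarrow> g s \<subseteq> {1..n}"
    and I: "\<And>f. f \<in> I \<longleftrightarrow> f \<in> poly_ring n \<and> (\<forall>m\<in>Poly_Mapping.keys f. \<exists>\<omega>\<in>g ` {..<N}. \<omega> \<subseteq> Poly_Mapping.keys m)"
    and F: "minimal_graded_free_resolution n I F D"
    and C: "C = {S. S \<subseteq> {..<N} \<and> (\<Union>s\<in>S. g s) = {1..n}}"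
  shows "exact_at TYPE('k) N C i \<Longrightarrow> count_list (F i) n = 0"
    and "homology_basis N C i m (z :: nat \<Rightarrow> nat set \<Rightarrow> 'k) \<Longrightarrow> count_list (F i) n = m"
proof -
  let ?L = "taylor_labels g N" and ?sl = "subset_list N"
  let ?d = "taylor_coeff N :: nat \<Rightarrow> nat \<Rightarrow> nat \<Rightarrow> 'k"
  define G where "G i = map card (?L i)" for i
  define E where "E i = monomial_matrix (?L i) (?L (Suc i)) (?d i)" for i
  interpret T: labelled_resolution n "g ` {..<N}" ?L ?d by (rule taylor_labelled_resolution[OF g])
  have resF: "graded_free_resolution n I F D" using F by (simp add: minimal_graded_free_resolution_def)
  have resG: "graded_free_resolution n I G E"
    unfolding G_def E_def by (rule T.homogenization) (rule I)
  have lenG: "length (G i) = length (?sl i)" for i by (simp add: G_def length_taylor_labels)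
  obtain f where f: "f 0 = 1\<^sub>m 1" "\<And>i. f i \<in> graded_maps n (G i) (F i)" "\<And>i. E i * f (Suc i) = f i * D i"
    using resolution_comparison[OF resF resG] by blast
  obtain h where h: "h 0 = 1\<^sub>m 1" "\<And>i. h i \<in> graded_maps n (F i) (G i)" "\<And>i. D i * h (Suc i) = h i * E i"
    using resolution_comparison[OF resG resF] by blast
  note fc = graded_maps_carrier[OF f(2)] and hc = graded_maps_carrier[OF h(2)]
  note Dc = resolution_carrier[OF resF] and Ec = resolution_carrier[OF resG]
  have F0: "F 0 = [0]" and G0: "G 0 = [0]" using resolution_start resF resG by blast+
  have hf_chain: "D i * (h (Suc i) * f (Suc i)) = h i * f i * D i" for i
  proof -
    have "D i * (h (Suc i) * f (Suc i)) = D i * h (Suc i) * f (Suc i)" using assoc_mult_mat[OF Dc hc fc] by simp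
    also have "\<dots> = h i * (E i * f (Suc i))" unfolding h(3) by (rule assoc_mult_mat[OF hc Ec fc])
    also have "\<dots> = h i * f i * D i" unfolding f(3) using assoc_mult_mat[OF hc fc Dc] by simp
    finally show ?thesis .
  qed
  have fh_chain: "E i * (f (Suc i) * h (Suc i)) = f i * h i * E i" for i
  proof -
    have "E i * (f (Suc i) * h (Suc i)) = E i * f (Suc i) * h (Suc i)" using assoc_mult_mat[OF Ec fc hc] by simp
    also have "\<dots> = f i * (D i * h (Suc i))" unfolding f(3) by (rule assoc_mult_mat[OF fc Dc hc])
    also have "\<dots> = f i * h i * E i" unfolding h(3) using assoc_mult_mat[OF fc hc Ec] by simp
    finally show ?thesis .
  qed
  have start: "h 0 * f 0 = 1\<^sub>m 1" "f 0 * h 0 = 1\<^sub>m 1" by (simp_all add: f(1) h(1))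
  obtain p where p: "\<And>i. p i \<in> graded_maps n (F (Suc i)) (F i)"
    "\<And>i. h (Suc i) * f (Suc i) - 1\<^sub>m (length (F (Suc i))) - p i * D i = D (Suc i) * p (Suc i)"
    using resolution_homotopy[OF resF, of "\<lambda>i. h i * f i"] start graded_maps_mult[OF h(2) f(2)] hf_chain by blast
  obtain q where q: "\<And>i. q i \<in> graded_maps n (G (Suc i)) (G i)"
    "\<And>i. f (Suc i) * h (Suc i) - 1\<^sub>m (length (G (Suc i))) - q i * E i = E (Suc i) * q (Suc i)"
    using resolution_homotopy[OF resG, of "\<lambda>i. f i * h i"] start graded_maps_mult[OF f(2) h(2)] fh_chain by blast
  note pc = graded_maps_carrier[OF p(1)] and qc = graded_maps_carrier[OF q(1)]
  have D0: "const_term (D i) r c = 0" if "r < length (F i)" "c < length (F (Suc i))" for i r c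
    using F that unfolding minimal_graded_free_resolution_def const_term_def
    by (intro const_term_maximal_ideal) blast
  \<comment> \<open>setting the variables to zero kills \<open>D\<close> and turns the comparison data into identities over \<open>K\<close>\<close>
  have hf1: "(\<Sum>k<length (?sl i). const_term (h i) r k * const_term (f i) k c) = (if r = c then 1 else 0)"
    if rc: "r < length (F i)" "c < length (F i)" for i r c
  proof -
    have "const_term (h i * f i) r c = (if r = c then 1 else 0)"
    proof (cases i)
      case 0
      then show ?thesis using start(1) rc F0 by (simp add: const_term_def)
    next
      case (Suc j)
      note rc' = rc[unfolded Suc]
      have hfc: "h (Suc j) * f (Suc j) \<in> carrier_mat (length (F (Suc j))) (length (F (Suc j)))"
        by (rule mult_carrier_mat[OF hc fc])
      have pDc: "p j * D j \<in> carrier_mat (length (F (Suc j))) (length (F (Suc j)))"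
        by (rule mult_carrier_mat[OF pc Dc])
      have "const_term (h (Suc j) * f (Suc j) - 1\<^sub>m (length (F (Suc j))) - p j * D j) r c
          = const_term (D (Suc j) * p (Suc j)) r c" unfolding p(2) ..
      also have "\<dots> = 0" unfolding const_term_mult[OF Dc pc rc'] using D0 rc' by simp
      finally show ?thesis
        using const_term_diff[OF minus_carrier_mat[OF one_carrier_mat] pDc rc', of "h (Suc j) * f (Suc j)"]
          const_term_diff[OF hfc one_carrier_mat rc'] const_term_mult[OF pc Dc rc'] D0 rc' const_term_one[OF rc', where 'a='k]
        by (simp add: Suc)
    qed
    then show ?thesis using const_term_mult[OF hc fc rc] lenG by simp
  qed
  have Ef0: "(\<Sum>k<length (?sl (Suc i)). const_term (E i) r k * const_term (f (Suc i)) k c) = 0"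
    if rc: "r < length (?sl i)" "c < length (F (Suc i))" for i r c
  proof -
    have r: "r < length (G i)" using rc lenG by simp
    show ?thesis
      using const_term_mult[OF Ec fc r rc(2)] const_term_mult[OF fc Dc r rc(2)] f(3)[of i] D0 rc(2) lenG by simp
  qed
  have hE0: "(\<Sum>k<length (?sl i). const_term (h i) r k * const_term (E i) k c) = 0"
    if rc: "r < length (F i)" "c < length (?sl (Suc i))" for i r c
  proof -
    have c: "c < length (G (Suc i))" using rc lenG by simp
    show ?thesis
      using const_term_mult[OF hc Ec rc(1) c] const_term_mult[OF Dc hc rc(1) c] h(3)[of i] D0 rc(1) lenG by simp
  qed
  have fh1: "(\<Sum>k<length (F i). const_term (f i) r k * const_term (h i) k c) = (if r = c then 1 else 0) +
      (case i of 0 \<Rightarrow> 0 | Suc j \<Rightarrow> (\<Sum>k<length (?sl j). const_term (q j) r k * const_term (E j) k c)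
        + (\<Sum>k<length (?sl (Suc i)). const_term (E i) r k * const_term (q i) k c))"
    if rc: "r < length (?sl i)" "c < length (?sl i)" for i r c
  proof -
    have rcG: "r < length (G i)" "c < length (G i)" using rc lenG by auto
    have "const_term (f i * h i) r c = (if r = c then 1 else 0) +
      (case i of 0 \<Rightarrow> 0 | Suc j \<Rightarrow> (\<Sum>k<length (?sl j). const_term (q j) r k * const_term (E j) k c)
        + (\<Sum>k<length (?sl (Suc i)). const_term (E i) r k * const_term (q i) k c))"
    proof (cases i)
      case 0
      then show ?thesis using start(2) rcG G0 by (simp add: const_term_def)
    next
      case (Suc j)
      note rc' = rcG[unfolded Suc]
      have fhc: "f (Suc j) * h (Suc j) \<in> carrier_mat (length (G (Suc j))) (length (G (Suc j)))"
        by (rule mult_carrier_mat[OF fc hc])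
      have qEc: "q j * E j \<in> carrier_mat (length (G (Suc j))) (length (G (Suc j)))"
        by (rule mult_carrier_mat[OF qc Ec])
      have "const_term (f (Suc j) * h (Suc j) - 1\<^sub>m (length (G (Suc j))) - q j * E j) r c
          = const_term (E (Suc j) * q (Suc j)) r c" unfolding q(2) ..
      then show ?thesis
        using const_term_diff[OF minus_carrier_mat[OF one_carrier_mat] qEc rc', of "f (Suc j) * h (Suc j)"]
          const_term_diff[OF fhc one_carrier_mat rc'] const_term_mult[OF qc Ec rc'] const_term_mult[OF Ec qc rc']
          const_term_one[OF rc', where 'a='k] lenG
        by (simp add: Suc algebra_simps)
    qed
    then show ?thesis using const_term_mult[OF fc hc rcG] by simp
  qed
  \<comment> \<open>degree \<open>n\<close> of the complex \<open>G \<otimes> K\<close> is the complex of \<open>C\<close>\<close>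
  have CN: "C \<subseteq> Pow {..<N}" by (auto simp: C)
  have top: "G i ! r = n \<longleftrightarrow> ?sl i ! r \<in> C" "?sl i ! r \<in> C \<longleftrightarrow> ?L i ! r = {1..n}"
    if r: "r < length (?sl i)" for i r
  proof -
    have "?L i ! r \<subseteq> {1..n}" using labels_inD[OF T.labels, of r i] r by (simp add: length_taylor_labels)
    then have "card (?L i ! r) = n \<longleftrightarrow> ?L i ! r = {1..n}"
      by (metis card_atLeastAtMost card_subset_eq diff_Suc_1 finite_atLeastAtMost)
    moreover show s: "?sl i ! r \<in> C \<longleftrightarrow> ?L i ! r = {1..n}"
      using subset_list_nth(1)[OF r] r by (simp add: C nth_taylor_labels)
    ultimately show "G i ! r = n \<longleftrightarrow> ?sl i ! r \<in> C" using r by (simp add: G_def length_taylor_labels)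
  qed
  have E_bd: "(\<Sum>c<length (?sl (Suc i)). const_term (E i) r c * y (?sl (Suc i) ! c)) = restr C (boundary N y) (?sl i ! r)"
    if y: "chain_on C (Suc i) y" and r: "r < length (?sl i)" for i y r
  proof -
    have ct: "const_term (E i) r c = (if ?L i ! r = ?L (Suc i) ! c then ?d i r c else 0)" if "c < length (?sl (Suc i))" for c
      unfolding E_def
      using that r T.subset by (intro const_term_monomial_matrix[OF T.labels]) (simp_all add: length_taylor_labels)
    have y0: "y (?sl (Suc i) ! c) = 0" if "c < length (?sl (Suc i))" "?L (Suc i) ! c \<noteq> {1..n}" for c
      using y top(2)[OF that(1)] that(2) by (auto simp: chain_on_def)
    show ?thesis
    proof (cases "?sl i ! r \<in> C")
      case True
      have "(\<Sum>c<length (?sl (Suc i)). const_term (E i) r c * y (?sl (Suc i) ! c))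
        = (\<Sum>c<length (?sl (Suc i)). face_coeff (?sl i ! r) (?sl (Suc i) ! c) * y (?sl (Suc i) ! c))"
      proof (rule sum.cong[OF refl])
        fix c assume "c \<in> {..<length (?sl (Suc i))}"
        then have c: "c < length (?sl (Suc i))" by simp
        show "const_term (E i) r c * y (?sl (Suc i) ! c) = face_coeff (?sl i ! r) (?sl (Suc i) ! c) * y (?sl (Suc i) ! c)"
          using ct[OF c] y0[OF c] top(2)[OF r] True
          by (cases "?L (Suc i) ! c = {1..n}") (simp_all add: taylor_coeff_def)
      qed
      also have "\<dots> = boundary N y (?sl i ! r)"
        by (rule sum_face_coeff[OF subset_list_nth(1,2)[OF r]])
      finally show ?thesis using True by (simp add: restr_def)
    next
      case False
      have "(\<Sum>c<length (?sl (Suc i)). const_term (E i) r c * y (?sl (Suc i) ! c)) = 0"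
      proof (intro sum.neutral ballI)
        fix c assume "c \<in> {..<length (?sl (Suc i))}"
        then have c: "c < length (?sl (Suc i))" by simp
        show "const_term (E i) r c * y (?sl (Suc i) ! c) = 0"
          using ct[OF c] y0[OF c] top(2)[OF r] False by (cases "?L (Suc i) ! c = {1..n}") simp_all
      qed
      then show ?thesis using False by (simp add: restr_def)
    qed
  qed
  define J where "J = {c. c < length (F i) \<and> F i ! c = n}"
  have J: "finite J" by (simp add: J_def)
  have JF: "c < length (F i)" if "c \<in> J" for c using that by (simp add: J_def)
  have cJ: "count_list (F i) n = card J"
    unfolding J_def by (simp add: count_list_eq_length_filter length_filter_conv_card eq_commute)
  let ?X = "{S \<in> C. card S = i}"
  define \<phi> where "\<phi> c = chain_of N i (\<lambda>r. const_term (f i) r c)" for c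
  define w where "w c = chain_of N i (\<lambda>r. const_term (h i) c r)" for c
  have phi_chain: "chain_on C i (\<phi> c)" if c: "c \<in> J" for c
    unfolding chain_on_def
  proof (intro allI impI)
    fix S assume "\<phi> c S \<noteq> 0"
    then obtain r where r: "r < length (?sl i)" "?sl i ! r = S" "const_term (f i) r c \<noteq> 0"
      unfolding \<phi>_def by (rule chain_of_nonzero)
    then have "G i ! r = n" using const_term_degree[OF f(2) _ JF[OF c] r(3)] lenG c by (simp add: J_def)
    then show "S \<in> C \<and> card S = i" using top(1)[OF r(1)] subset_list_nth(2)[OF r(1)] r(2) by simp
  qed
  have phi_nth: "\<phi> c (?sl i ! r) = const_term (f i) r c" if "r < length (?sl i)" for c r
    using that by (simp add: \<phi>_def chain_of_nth)
  have sumw: "(\<Sum>S\<in>?X. w c S * z S) = (\<Sum>r<length (?sl i). const_term (h i) c r * restr C z (?sl i ! r))" for c and z :: "nat set \<Rightarrow> 'k"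
    unfolding w_def by (rule sum_chain_of[OF CN])
  have phi_cycle: "cycle_on N C (\<phi> c)" if c: "c \<in> J" for c
    unfolding cycle_on_def
  proof
    fix S assume S: "S \<in> C"
    then have SN: "S \<subseteq> {..<N}" using CN by blast
    show "boundary N (\<phi> c) S = 0"
    proof (cases "Suc (card S) = i")
      case False
      then show ?thesis using boundary_wrong_card[OF phi_chain[OF c]] finite_subset[OF SN] by simp
    next
      case True
      then obtain r where r: "r < length (?sl (card S))" "?sl (card S) ! r = S"
        using subset_list_index[OF SN refl] by blast
      have "boundary N (\<phi> c) S = (\<Sum>k<length (?sl (Suc (card S))). const_term (E (card S)) r k * \<phi> c (?sl (Suc (card S)) ! k))"
        using E_bd[of "card S" "\<phi> c", OF _ r(1)] phi_chain[OF c] S r(2) by (simp add: True restr_def)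
      also have "\<dots> = (\<Sum>k<length (?sl (Suc (card S))). const_term (E (card S)) r k * const_term (f (Suc (card S))) k c)"
        using phi_nth by (simp add: True)
      also have "\<dots> = 0" using Ef0[OF r(1)] JF[OF c] by (simp add: True)
      finally show ?thesis .
    qed
  qed
  note retract = retract_dimension[of J ?X C i \<phi> N w, OF J _ _ phi_chain phi_cycle]
  have 1: "finite ?X" using CN by (auto intro: finite_subset[of _ "Pow {..<N}"])
  have 2: "?X \<subseteq> C" by auto
  have 3: "(\<Sum>S\<in>?X. w c S * boundary N y S) = 0" if y: "chain_on C (Suc i) y" and c: "c \<in> J" for y c
  proof -
    have "(\<Sum>S\<in>?X. w c S * boundary N y S) = (\<Sum>r<length (?sl i). \<Sum>k<length (?sl (Suc i)).
        const_term (h i) c r * const_term (E i) r k * y (?sl (Suc i) ! k))"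
      unfolding sumw using E_bd[OF y] by (simp add: sum_distrib_left mult.assoc flip: E_bd[OF y])
    also have "\<dots> = (\<Sum>k<length (?sl (Suc i)). \<Sum>r<length (?sl i).
        const_term (h i) c r * const_term (E i) r k * y (?sl (Suc i) ! k))" by (rule sum.swap)
    also have "\<dots> = 0" using hE0[OF JF[OF c]] by (simp flip: sum_distrib_right)
    finally show ?thesis .
  qed
  have 4: "(\<Sum>S\<in>?X. w c S * \<phi> c' S) = (if c = c' then 1 else 0)" if "c \<in> J" "c' \<in> J" for c c'
    unfolding sumw restr_id[OF phi_chain[OF that(2)]]
    using hf1[OF JF[OF that(1)] JF[OF that(2)]] phi_nth by simp
  have 5: "\<exists>y. chain_on C (Suc i) y \<and> (\<forall>S\<in>C. (\<Sum>c\<in>J. (\<Sum>S'\<in>?X. w c S' * z S') * \<phi> c S) = z S + boundary N y S)"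
    if z: "chain_on C i z" and cyc: "cycle_on N C z" for z :: "nat set \<Rightarrow> 'k"
  proof -
    \<comment> \<open>the homotopy on \<open>G\<close>, applied to \<open>z\<close>; in degree \<open>0\<close> both comparison maps are the identity\<close>
    define y where "y = (case i of 0 \<Rightarrow> (\<lambda>_. 0) | Suc j \<Rightarrow>
      chain_of N (Suc i) (\<lambda>k. \<Sum>r<length (?sl i). const_term (q i) k r * z (?sl i ! r)))"
    have y: "chain_on C (Suc i) y"
      unfolding chain_on_def
    proof (intro allI impI)
      fix S assume "y S \<noteq> 0"
      then have "chain_of N (Suc i) (\<lambda>k. \<Sum>r<length (?sl i). const_term (q i) k r * z (?sl i ! r)) S \<noteq> 0"
        by (auto simp: y_def split: nat.splits)
      then obtain k where k: "k < length (?sl (Suc i))" "?sl (Suc i) ! k = S"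
         "(\<Sum>r<length (?sl i). const_term (q i) k r * z (?sl i ! r)) \<noteq> 0" by (rule chain_of_nonzero)
      obtain r where r: "r \<in> {..<length (?sl i)}" "const_term (q i) k r * z (?sl i ! r) \<noteq> 0"
        by (rule sum.not_neutral_contains_not_neutral[OF k(3)])
      then have "?sl i ! r \<in> C" using z by (auto simp: chain_on_def)
      then have "G i ! r = n" using top(1) r(1) by blast
      then have "G (Suc i) ! k = n" using const_term_degree[OF q(1), of k i r] k(1) r lenG by simp
      then show "S \<in> C \<and> card S = Suc i" using top(1)[OF k(1)] subset_list_nth(2)[OF k(1)] k(2) by simp
    qed
    have "(\<Sum>c\<in>J. (\<Sum>S'\<in>?X. w c S' * z S') * \<phi> c S) = z S + boundary N y S" if S: "S \<in> C" for S
    proof (cases "card S = i")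
      case False
      have "\<phi> c S = 0" if "c \<in> J" for c using phi_chain[OF that] False by (auto simp: chain_on_def)
      moreover have "z S = 0" using z False by (auto simp: chain_on_def)
      moreover have "boundary N y S = 0" using boundary_wrong_card[OF y] False S CN finite_subset[of S "{..<N}"] by auto
      ultimately show ?thesis by simp
    next
      case True
      then obtain r where r: "r < length (?sl i)" "?sl i ! r = S"
        using subset_list_index[of S N i] S CN by blast
      \<comment> \<open>for degree reasons the sum over \<open>J\<close> may be extended to all generators of \<open>F i\<close>\<close>
      have out: "(\<Sum>k<length (?sl i). const_term (h i) c k * z (?sl i ! k)) = 0" if c: "c < length (F i)" "c \<notin> J" for c
      proof (intro sum.neutral ballI)
        fix k assume k: "k \<in> {..<length (?sl i)}"
        show "const_term (h i) c k * z (?sl i ! k) = 0"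
        proof (rule ccontr)
          assume nz: "\<not> ?thesis"
          then have "?sl i ! k \<in> C" using z by (auto simp: chain_on_def)
          then have "G i ! k = n" using top(1) k by blast
          then have "F i ! c = n" using const_term_degree[OF h(2) c(1), of k] k nz lenG by simp
          then show False using c by (simp add: J_def)
        qed
      qed
      have "(\<Sum>c\<in>J. (\<Sum>S'\<in>?X. w c S' * z S') * \<phi> c S)
        = (\<Sum>c\<in>J. (\<Sum>k<length (?sl i). const_term (h i) c k * z (?sl i ! k)) * const_term (f i) r c)"
        unfolding sumw restr_id[OF z] r(2)[symmetric] phi_nth[OF r(1)] ..
      also have "\<dots> = (\<Sum>c<length (F i). (\<Sum>k<length (?sl i). const_term (h i) c k * z (?sl i ! k)) * const_term (f i) r c)"
        by (rule sum.mono_neutral_left) (use JF out in auto)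
      also have "\<dots> = (\<Sum>c<length (F i). \<Sum>k<length (?sl i). const_term (f i) r c * const_term (h i) c k * z (?sl i ! k))"
        by (simp add: sum_distrib_left sum_distrib_right mult_ac)
      also have "\<dots> = (\<Sum>k<length (?sl i). \<Sum>c<length (F i). const_term (f i) r c * const_term (h i) c k * z (?sl i ! k))"
        by (rule sum.swap)
      also have "\<dots> = (\<Sum>k<length (?sl i). (\<Sum>c<length (F i). const_term (f i) r c * const_term (h i) c k) * z (?sl i ! k))"
        by (simp add: sum_distrib_right)
      also have "\<dots> = z S + boundary N y S"
      proof (cases i)
        case 0
        have "(\<Sum>k<length (?sl i). (\<Sum>c<length (F i). const_term (f i) r c * const_term (h i) c k) * z (?sl i ! k))
          = (\<Sum>k<length (?sl i). if r = k then z (?sl i ! k) else 0)"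
          using fh1[OF r(1)] 0 by (intro sum.cong) auto
        then show ?thesis using r 0 by (simp add: y_def boundary_def)
      next
        case (Suc j)
        have z0: "(\<Sum>k<length (?sl i). const_term (E j) l k * z (?sl i ! k)) = 0" if "l < length (?sl j)" for l
          using E_bd[of j z l] z that cyc Suc by (auto simp: restr_def cycle_on_def)
        have ynth: "y (?sl (Suc i) ! l) = (\<Sum>k<length (?sl i). const_term (q i) l k * z (?sl i ! k))"
          if "l < length (?sl (Suc i))" for l
          using that by (simp add: y_def Suc chain_of_nth)
        have "(\<Sum>k<length (?sl i). (\<Sum>c<length (F i). const_term (f i) r c * const_term (h i) c k) * z (?sl i ! k))
          = (\<Sum>k<length (?sl i). (if r = k then z (?sl i ! k) else 0)
            + (\<Sum>l<length (?sl j). const_term (q j) r l * (const_term (E j) l k * z (?sl i ! k)))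
            + (\<Sum>l<length (?sl (Suc i)). const_term (E i) r l * (const_term (q i) l k * z (?sl i ! k))))"
          using fh1[OF r(1)] Suc by (intro sum.cong) (auto simp: distrib_right sum_distrib_right mult.assoc)
        also have "\<dots> = z S
            + (\<Sum>k<length (?sl i). \<Sum>l<length (?sl j). const_term (q j) r l * (const_term (E j) l k * z (?sl i ! k)))
            + (\<Sum>k<length (?sl i). \<Sum>l<length (?sl (Suc i)). const_term (E i) r l * (const_term (q i) l k * z (?sl i ! k)))"
          using r by (simp add: sum.distrib)
        also have "(\<Sum>k<length (?sl i). \<Sum>l<length (?sl j). const_term (q j) r l * (const_term (E j) l k * z (?sl i ! k)))
          = (\<Sum>l<length (?sl j). const_term (q j) r l * (\<Sum>k<length (?sl i). const_term (E j) l k * z (?sl i ! k)))"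
          unfolding sum_distrib_left by (rule sum.swap)
        also have "\<dots> = 0" using z0 by simp
        also have "(\<Sum>k<length (?sl i). \<Sum>l<length (?sl (Suc i)). const_term (E i) r l * (const_term (q i) l k * z (?sl i ! k)))
          = (\<Sum>l<length (?sl (Suc i)). const_term (E i) r l * (\<Sum>k<length (?sl i). const_term (q i) l k * z (?sl i ! k)))"
          unfolding sum_distrib_left by (rule sum.swap)
        also have "\<dots> = (\<Sum>l<length (?sl (Suc i)). const_term (E i) r l * y (?sl (Suc i) ! l))"
          using ynth by simp
        also have "\<dots> = boundary N y S" using E_bd[OF y r(1)] r(2) S by (simp add: restr_def)
        finally show ?thesis by simp
      qed
      finally show ?thesis .
    qed
    then show ?thesis using y by blast
  qed
  show "exact_at TYPE('k) N C i \<Longrightarrow> count_list (F i) n = 0"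
    unfolding cJ by (rule retract(1)[OF 1 2 _ _ 3 4 5])
  show "homology_basis N C i m z \<Longrightarrow> count_list (F i) n = m"
    unfolding cJ by (rule retract(2)[OF 1 2 _ _ 3 4 5])
qed

section \<open>Path ideals of cycles\<close>

lemma prod_var:
  assumes "finite A"
  shows "(\<Prod>k\<in>A. var (x k)) = (Poly_Mapping.single (\<Sum>k\<in>A. Poly_Mapping.single (x k) 1) 1 :: 'k::field mpoly)"
  using assms by (induction A rule: finite_induct) (simp_all add: var_def mult_single)

text \<open>
  For membership of \<open>f\<close> choose for each of its terms a generator that divides it, and collect the terms
  according to the chosen generator.
\<close>

lemma in_monomial_ideal_iff:
  fixes f :: "'k::field mpoly"
  assumes W: "finite W" "W \<subseteq> Pow {1..n}"
  shows "f \<in> ideal_gen n ((\<lambda>\<omega>. Poly_Mapping.single (sqfree_mon \<omega>) 1) ` W) \<longleftrightarrow>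
    f \<in> poly_ring n \<and> (\<forall>m\<in>Poly_Mapping.keys f. \<exists>\<omega>\<in>W. \<omega> \<subseteq> Poly_Mapping.keys m)" (is "_ \<in> ideal_gen n (?x ` W) \<longleftrightarrow> _")
proof
  have fin: "finite \<omega>" if "\<omega> \<in> W" for \<omega> using W(2) that finite_subset by blast
  assume "f \<in> ideal_gen n (?x ` W)"
  then obtain A c where A: "finite A" "A \<subseteq> ?x ` W" "\<And>g. g \<in> A \<Longrightarrow> c g \<in> poly_ring n" "f = (\<Sum>g\<in>A. c g * g)"
    unfolding ideal_gen_def by blast
  have "g \<in> poly_ring n" if gA: "g \<in> A" for g
  proof -
    obtain \<omega> where "\<omega> \<in> W" "g = ?x \<omega>" using A(2) gA by blast
    moreover have "\<omega> \<subseteq> {1..n}" "finite \<omega>" using W(2) fin calculation(1) by auto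
    ultimately show ?thesis using keys_sqfree_mon[of \<omega>] by (simp add: poly_ring_single)
  qed
  then have "f \<in> poly_ring n" unfolding A(4) using A(3) by (intro poly_ring_sum poly_ring_mult) auto
  moreover have "\<exists>\<omega>\<in>W. \<omega> \<subseteq> Poly_Mapping.keys m" if "m \<in> Poly_Mapping.keys f" for m
  proof -
    have "(\<Sum>g\<in>A. Poly_Mapping.lookup (c g * g) m) \<noteq> 0" using that by (simp add: A(4) in_keys_iff lookup_sum)
    then obtain g where g: "g \<in> A" "Poly_Mapping.lookup (c g * g) m \<noteq> 0"
      by (rule sum.not_neutral_contains_not_neutral)
    then have "m \<in> Poly_Mapping.keys (c g * g)" by (simp add: in_keys_iff)
    moreover obtain \<omega> where \<omega>: "\<omega> \<in> W" "g = ?x \<omega>" using A(2) g(1) by blast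
    ultimately obtain a where "m = a + sqfree_mon \<omega>" using Poly_Mapping.keys_mult[of "c g" g] by (auto split: if_splits)
    then have "\<omega> \<subseteq> Poly_Mapping.keys m" using fin[OF \<omega>(1)] by (simp add: keys_plus_exponent keys_sqfree_mon)
    then show ?thesis using \<omega>(1) by blast
  qed
  ultimately show "f \<in> poly_ring n \<and> (\<forall>m\<in>Poly_Mapping.keys f. \<exists>\<omega>\<in>W. \<omega> \<subseteq> Poly_Mapping.keys m)" by blast
next
  have fin: "finite \<omega>" if "\<omega> \<in> W" for \<omega> using W(2) that finite_subset by blast
  assume f: "f \<in> poly_ring n \<and> (\<forall>m\<in>Poly_Mapping.keys f. \<exists>\<omega>\<in>W. \<omega> \<subseteq> Poly_Mapping.keys m)"
  then obtain w where w: "\<And>m. m \<in> Poly_Mapping.keys f \<Longrightarrow> w m \<in> W \<and> w m \<subseteq> Poly_Mapping.keys m" by metis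
  define h where "h m = Poly_Mapping.single (m - sqfree_mon (w m)) (Poly_Mapping.lookup f m)" for m
  define c where "c g = (\<Sum>m\<in>{m \<in> Poly_Mapping.keys f. ?x (w m) = g}. h m)" for g
  have hx: "h m * ?x (w m) = Poly_Mapping.single m (Poly_Mapping.lookup f m)" if "m \<in> Poly_Mapping.keys f" for m
    using sqfree_mon_minus_add[of "w m" m] w[OF that] fin by (simp add: h_def mult_single)
  have "(\<Sum>g\<in>?x ` W. c g * g) = (\<Sum>g\<in>?x ` W. \<Sum>m\<in>{m \<in> Poly_Mapping.keys f. ?x (w m) = g}. h m * ?x (w m))"
    by (intro sum.cong refl) (simp add: c_def sum_distrib_right)
  also have "\<dots> = (\<Sum>m\<in>Poly_Mapping.keys f. h m * ?x (w m))"
    by (rule sum.group) (use W(1) w in auto)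
  also have "\<dots> = f" using hx poly_mapping_sum_singles[of f] by simp
  finally have "f = (\<Sum>g\<in>?x ` W. c g * g)" ..
  moreover have "c g \<in> poly_ring n" for g
    unfolding c_def
  proof (rule poly_ring_sum)
    fix m assume "m \<in> {m \<in> Poly_Mapping.keys f. ?x (w m) = g}"
    then have m: "Poly_Mapping.keys m \<subseteq> {1..n}" using f by (auto simp: poly_ring_def)
    have "Poly_Mapping.keys (m - sqfree_mon (w m)) \<subseteq> Poly_Mapping.keys m"
      by (auto simp: in_keys_iff lookup_minus)
    then show "h m \<in> poly_ring n" unfolding h_def using m by (intro poly_ring_single) blast
  qed
  ultimately show "f \<in> ideal_gen n (?x ` W)"
    unfolding ideal_gen_def using W(1) by blast
qed

lemma single_in_maximal_ideal:
  assumes "\<tau> \<subseteq> {1..n}" "\<tau> \<noteq> {}"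
  shows "Poly_Mapping.single (sqfree_mon \<tau>) a \<in> ideal_gen n (var ` {1..n} :: 'k::field mpoly set)"
proof -
  obtain j where j: "j \<in> \<tau>" using assms(2) by blast
  have fin: "finite \<tau>" using assms(1) finite_subset by blast
  let ?c = "Poly_Mapping.single (sqfree_mon (\<tau> - {j})) a :: 'k mpoly"
  have "sqfree_mon \<tau> = sqfree_mon (\<tau> - {j}) + Poly_Mapping.single j 1"
    unfolding sqfree_mon_def using fin j by (simp add: sum.remove add.commute)
  then have "Poly_Mapping.single (sqfree_mon \<tau>) a = (\<Sum>g\<in>{var j}. ?c * g)" by (simp add: var_def mult_single)
  moreover have "?c \<in> poly_ring n" using assms(1) fin by (intro poly_ring_single) (auto simp: keys_sqfree_mon)
  moreover have "{var j} \<subseteq> (var ` {1..n} :: 'k mpoly set)" using j assms(1) by blast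
  ultimately show ?thesis unfolding ideal_gen_def
    by (intro CollectI exI[of _ "{var j}"] exI[of _ "\<lambda>_. ?c"]) simp
qed

text \<open>
  The homogenized syzygies form a resolution, and the entries of its matrices are multiples of monomials
  different from \<open>1\<close>, because the labels are distinct wherever the coefficient is nonzero.
\<close>

lemma minimal_resolution_exists:
  fixes I :: "'k::field mpoly set"
  assumes W: "{} \<notin> W"
    and I: "\<And>f. f \<in> I \<longleftrightarrow> f \<in> poly_ring n \<and> (\<forall>m\<in>Poly_Mapping.keys f. \<exists>\<omega>\<in>W. \<omega> \<subseteq> Poly_Mapping.keys m)"
  shows "\<exists>F D. minimal_graded_free_resolution n I F D"
proof -
  let ?L = "syzygy_labels TYPE('k) n W" and ?d = "syzygy_coeff n W :: nat \<Rightarrow> nat \<Rightarrow> nat \<Rightarrow> 'k"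
  interpret M: labelled_resolution n W ?L ?d by (rule syzygies_labelled_resolution)
  let ?D = "\<lambda>i. monomial_matrix (?L i) (?L (Suc i)) (?d i)"
  have "?D i $$ (r, c) \<in> ideal_gen n (var ` {1..n})" if rc: "r < length (?L i)" "c < length (?L (Suc i))" for i r c
  proof (cases "?d i r c = 0 \<or> \<not> ?L i ! r \<subseteq> ?L (Suc i) ! c")
    case True
    have "0 \<in> ideal_gen n (var ` {1..n} :: 'k mpoly set)"
      unfolding ideal_gen_def by (intro CollectI exI[of _ "{}"] exI[of _ "\<lambda>_. 0"]) simp
    then show ?thesis using True rc by (auto simp: monomial_matrix_def)
  next
    case False
    have "c < length (syzygies n W i :: (nat set \<times> (nat \<Rightarrow> 'k)) list)"
      using rc(2) by (simp add: syzygy_labels_def del: syzygies.simps)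
    then have "?L i ! r \<noteq> ?L (Suc i) ! c" using syzygy_coeff_strict[OF W] False by blast
    then have ne: "?L (Suc i) ! c - ?L i ! r \<noteq> {}" using False by blast
    have sub: "?L (Suc i) ! c - ?L i ! r \<subseteq> {1..n}" using labels_inD[OF M.labels rc(2)] by blast
    have "?D i $$ (r, c) = Poly_Mapping.single (sqfree_mon (?L (Suc i) ! c - ?L i ! r)) (?d i r c)"
      using False rc by (simp add: monomial_matrix_def)
    then show ?thesis using single_in_maximal_ideal[OF sub ne] by simp
  qed
  then have "minimal_graded_free_resolution n I (\<lambda>i. map card (?L i)) ?D"
    unfolding minimal_graded_free_resolution_def using M.homogenization[OF I] by simp
  then show ?thesis by blast
qed

text \<open>
  The support of the generator for the path that starts at \<open>x\<^bsub>s+1\<^esub>\<close>; starting points are counted from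
  \<open>0\<close> so that they range over residues modulo \<open>n\<close>.
\<close>

definition cycle_window :: "nat \<Rightarrow> nat \<Rightarrow> nat \<Rightarrow> nat set" where
  "cycle_window n t s = (\<lambda>k. (s + k) mod n + 1) ` {..<t}"

lemma cycle_window_subset: "0 < n \<Longrightarrow> cycle_window n t s \<subseteq> {1..n}"
  unfolding cycle_window_def by (auto simp: Suc_le_eq)

text \<open>
  The monomial is squarefree because a path on \<open>t \<le> n\<close> vertices does not return to its start.
\<close>

lemma cycle_path_monomial_eq:
  assumes "t \<le> n" "0 < n"
  shows "cycle_path_monomial n t (Suc s) = (Poly_Mapping.single (sqfree_mon (cycle_window n t s)) 1 :: 'k::field mpoly)"
proof -
  have inj: "inj_on (\<lambda>k. (s + k) mod n + 1) {..<t}"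
  proof (rule inj_onI)
    fix k l assume kl: "k \<in> {..<t}" "l \<in> {..<t}" "(s + k) mod n + 1 = (s + l) mod n + 1"
    then have "[s + k = s + l] (mod n)" by (simp add: cong_def)
    then have "[k = l] (mod n)" by (simp add: cong_add_lcancel_nat)
    then show "k = l" using kl assms by (simp add: cong_def)
  qed
  show ?thesis
    unfolding cycle_path_monomial_def prod_var[OF finite_lessThan] sqfree_mon_def cycle_window_def
      sum.reindex[OF inj] by (simp add: comp_def)
qed

text \<open>
  The path from \<open>s\<close> covers the position \<open>j + (t - 1)\<close> modulo \<open>n\<close> iff \<open>s\<close> lies in the window of \<open>t\<close> positions that
  starts at \<open>j\<close>.
\<close>

lemma covering_eq_hitting:
  assumes t: "1 \<le> t" "t \<le> n"
  shows "{S. S \<subseteq> {..<n} \<and> (\<Union>s\<in>S. cycle_window n t s) = {1..n}} = hitting_sets n t"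
proof -
  have n: "0 < n" using t by simp
  have "(\<Union>s\<in>S. cycle_window n t s) = {1..n} \<longleftrightarrow> (\<forall>j<n. \<exists>k<t. (j + k) mod n \<in> S)" if S: "S \<subseteq> {..<n}" for S
  proof
    assume cov: "(\<Union>s\<in>S. cycle_window n t s) = {1..n}"
    show "\<forall>j<n. \<exists>k<t. (j + k) mod n \<in> S"
    proof (intro allI impI)
      fix j assume j: "j < n"
      have "(j + (t - 1)) mod n + 1 \<in> {1..n}" using n by (simp add: Suc_le_eq)
      then obtain s k where sk: "s \<in> S" "k < t" "(j + (t - 1)) mod n = (s + k) mod n"
        unfolding cov[symmetric] cycle_window_def by auto
      have "(j + (t - 1 - k) + k) mod n = (s + k) mod n" using sk by simp
      then have "[j + (t - 1 - k) = s] (mod n)" using cong_add_rcancel_nat by (simp add: cong_def)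
      then have "(j + (t - 1 - k)) mod n = s" using sk(1) S by (auto simp: cong_def)
      then show "\<exists>k<t. (j + k) mod n \<in> S" using sk(1,2) by (intro exI[of _ "t - 1 - k"]) auto
    qed
  next
    assume hit: "\<forall>j<n. \<exists>k<t. (j + k) mod n \<in> S"
    have "x \<in> (\<Union>s\<in>S. cycle_window n t s)" if x: "x \<in> {1..n}" for x
    proof -
      define j where "j = (x - 1 + (n - (t - 1))) mod n"
      have "j < n" using n by (simp add: j_def)
      then obtain k where k: "k < t" "(j + k) mod n \<in> S" using hit by blast
      have "((j + k) mod n + (t - 1 - k)) mod n = (x - 1 + (n - (t - 1)) + (k + (t - 1 - k))) mod n"
        by (simp add: j_def mod_simps add.assoc)
      also have "x - 1 + (n - (t - 1)) + (k + (t - 1 - k)) = x - 1 + n" using k(1) t by simp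
      also have "(x - 1 + n) mod n = x - 1" using x by (cases x) auto
      finally have "((j + k) mod n + (t - 1 - k)) mod n + 1 = x" using x by simp
      then have "x \<in> cycle_window n t ((j + k) mod n)"
        unfolding cycle_window_def using k(1) by (intro image_eqI[of _ _ "t - 1 - k"]) auto
      then show ?thesis using k(2) by blast
    qed
    then show "(\<Union>s\<in>S. cycle_window n t s) = {1..n}" using cycle_window_subset[OF n] by blast
  qed
  then show ?thesis unfolding hitting_sets_def by blast
qed

theorem theorem5p1:
  fixes p t n d i :: nat
  assumes "n = (t + 1) * p + d" and "d \<le> t" and "2 \<le> t" and "t \<le> n"
  shows "graded_betti n (cycle_path_ideal n t :: 'k::field mpoly set) i n =
    (if d = 0 \<and> i = 2 * p then t
     else if d \<noteq> 0 \<and> i = 2 * p + 1 then 1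
     else 0)"
proof -
  let ?b = "if d = 0 \<and> i = 2 * p then t else if d \<noteq> 0 \<and> i = 2 * p + 1 then 1 else 0"
  let ?I = "cycle_path_ideal n t :: 'k mpoly set"
  let ?W = "cycle_window n t ` {..<n}"
  have n: "0 < n" using assms(3,4) by linarith
  have W: "finite ?W" "?W \<subseteq> Pow {1..n}" using cycle_window_subset[OF n] by auto
  have "{1..n} = Suc ` {..<n}" by (auto simp: image_Suc_lessThan)
  then have "?I = ideal_gen n ((\<lambda>\<omega>. Poly_Mapping.single (sqfree_mon \<omega>) 1) ` ?W)"
    unfolding cycle_path_ideal_def by (simp add: image_image cycle_path_monomial_eq[OF assms(4) n])
  then have I: "f \<in> ?I \<longleftrightarrow> f \<in> poly_ring n \<and> (\<forall>m\<in>Poly_Mapping.keys f. \<exists>\<omega>\<in>?W. \<omega> \<subseteq> Poly_Mapping.keys m)" for f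
    using in_monomial_ideal_iff[OF W] by simp
  have ne: "{} \<notin> ?W" using assms(3) by (auto simp: cycle_window_def lessThan_empty_iff)
  obtain F D where FD: "minimal_graded_free_resolution n ?I F D"
    using minimal_resolution_exists[OF ne I] by blast
  have H: "homology_in_degree TYPE('k) n (hitting_sets n t)
     (2 * p + (if d = 0 then 0 else 1)) (if d = 0 then t else 1)"
    by (rule homology_hitting_sets[OF assms])
  have C: "hitting_sets n t = {S. S \<subseteq> {..<n} \<and> (\<Union>s\<in>S. cycle_window n t s) = {1..n}}"
    using covering_eq_hitting[of t n] assms by simp
  have count: "count_list (F i) n = ?b" if FD: "minimal_graded_free_resolution n ?I F D" for F D
  proof -
    note top = top_betti_number_eq_homology[OF cycle_window_subset[OF n] I FD C]
    show ?thesis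
    proof (cases "i = 2 * p + (if d = 0 then 0 else 1)")
      case True
      then obtain z :: "nat \<Rightarrow> nat set \<Rightarrow> 'k" where "homology_basis n (hitting_sets n t) i (if d = 0 then t else 1) z"
        using H unfolding homology_in_degree_def by blast
      then show ?thesis using top(2) True by (cases "d = 0") auto
    next
      case False
      then have "exact_at TYPE('k) n (hitting_sets n t) i" using H unfolding homology_in_degree_def by blast
      then show ?thesis using top(1) False by auto
    qed
  qed
  show ?thesis
    unfolding graded_betti_def
  proof (rule the_equality)
    show "\<exists>F D. minimal_graded_free_resolution n ?I F D \<and> ?b = count_list (F i) n"
      using FD count[OF FD] by metis
    show "b = ?b" if "\<exists>F D. minimal_graded_free_resolution n ?I F D \<and> b = count_list (F i) n" for b
      using that count by blast
  qed
qed

end
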